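(* Let $d\ge1$, $\mathcal D=[0,1]^d$, $0<\beta<\alpha<2$ with $\alpha-d<\beta$, and $M>0$. Let $X\in\mathcal C^\beta_d([0,1]^d,M)\cap\mathcal{CB}^\alpha_d([0,1]^d\setminus\{\mathbf 0_d\},c(\cdot),V(\cdot))$ be a random field and let $I(X)=\int_{\mathcal D}X(\mathbf t)\,d\mathbf t$ be approximated by the stratified Monte Carlo quadrature $I_N(X,T_N)$, where $T_N$ is $cRS(h,\pi,d)$ (one component). Suppose that the local Hölder function $V$ satisfies the following condition: $V(\mathbf G(\cdot))$ is bounded from above by a function $R(\cdot)$ which satisfies the shifting condition with $C_L=1/\sqrt{3+d}$ and $C_U=\sqrt{3+d}$ and is such that $\int_{[0,1]^d}R(\mathbf H(\mathbf t))\,d\mathbf t<\infty$. Then $$\|I(X)-I_N(X,T_N)\|^2\sim\frac1{N^{1+\alpha/d}}\int_{\mathcal D}c(\mathbf t)\,b_{\alpha,d}(D_1(\mathbf t))\prod_{m=1}^dh(t_m)^{-1}\,d\mathbf t\quad\text{as }N\to\infty,$$ where $D_1(\mathbf t)=(1/h(t_1),\dots,1/h(t_d))$.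
   Context: Norms. For a square-integrable random variable $\xi$, $\|\xi\|=(\mathrm E\,\xi^2)^{1/2}$; for a vector, $\|\cdot\|$ is the Euclidean norm. $\mathbf 0_d$ is the zero vector in $\mathbb R^d$; $*$ between vectors is coordinatewise multiplication; $a_N\sim b_N$ means $a_N/b_N\to1$. A hyperrectangle is a set $\mathcal A=[a_1,b_1]\times\dots\times[a_d,b_d]$. Random fields. $X(\mathbf t)$, $\mathbf t\in\mathcal D=[0,1]^d$, is a random field with finite second moments, continuous in quadratic mean (and taken jointly measurable). - $X\in\mathcal C^\beta_d([0,1]^d,M)$: $\|X(\mathbf t+\mathbf s)-X(\mathbf t)\|^2\le M\|\mathbf s\|^\beta$ for all $\mathbf t,\mathbf t+\mathbf s\in[0,1]^d$. - $X\in\mathcal C^\alpha_d(\mathcal A,V(\cdot))$ (locally Hölder continuous): for all $\mathbf t,\mathbf t+\mathbf s\in\mathcal A$, $\|X(\mathbf t+\mathbf s)-X(\mathbf t)\|^2\le V(\bar{\mathbf t})\|\mathbf s\|^\alpha$ for some $\bar{\mathbf t}\in\{\mathbf t+\mathbf s*\mathbf u:\mathbf u\in[0,1]^d\}$, where $V$ is a positive continuous function. - $X\in\mathcal B^\alpha_d(\mathcal A,c(\cdot))$ (locally stationary): $\|X(\mathbf t+\mathbf s)-X(\mathbf t)\|^2/(c(\mathbf t)\|\mathbf s\|^\alpha)\to1$ as $\mathbf s\to0$ uniformly in $\mathbf t\in\mathcal A$ (with $\mathbf t,\mathbf t+\mathbf s\in\mathcal A$), where $c$ is positive, continuous and invariant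 under permutations of the coordinates. - $X\in\mathcal{CB}^\alpha_d([0,1]^d\setminus\{\mathbf 0_d\},c(\cdot),V(\cdot))$: $c,V$ are positive continuous functions on $[0,1]^d\setminus\{\mathbf 0_d\}$ and $X\in\mathcal C^\alpha_d(\mathcal A,V(\cdot))\cap\mathcal B^\alpha_d(\mathcal A,c(\cdot))$ for every hyperrectangle $\mathcal A\subset[0,1]^d\setminus\{\mathbf 0_d\}$. Shifting condition. A positive function $f$ satisfies the shifting condition with constants $0<C_L<C_U$ if there exist positive constants $C$ and $a$ such that $f(\mathbf s)\le Cf(\mathbf v)$ for all $\mathbf s,\mathbf v\in[0,a]^d\setminus\{\mathbf 0_d\}$ with $C_L\le\|\mathbf s\|/\|\mathbf v\|\le C_U$. Designs. $T_N$ is $cRS(h,\pi,d)$: $h$ is a positive continuous probability density on $[0,1]$, the number of intervals in each coordinate is $n=N^{1/d}$ (so $N$ ranges over $d$-th powers of positive integers), and the one-dimensional grid points $0=t_0<\dots<t_n=1$, the same for each coordinate, are given by $\int_0^{t_i}h(v)\,dv=i/n$. The strata are $\mathcal D_{\mathbf i}=\prod_{m=1}^d[t_{i_m},t_{i_m+1}]$, $\mathbf i\in\mathbf I=\{0,\dots,n-1\}^d$. Set $H(t)=\int_0^th(u)\,du$, $G=H^{-1}$ on $[0,1]$, $\mathbf H(\mathbf t)=(H(t_1),\dots,H(t_d))$, $\mathbf G(\mathbf t)=(G(t_1),\dots,G(t_d))$. Quadrature. $I_N(X,T_N)=\sum_{\mathbf i\in\mathbf I}X(\boldsymbol\eta_{\mathbf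 i})|\mathcal D_{\mathbf i}|$, where $|\mathcal D_{\mathbf i}|$ is the volume and $\boldsymbol\eta_{\mathbf i}$ is uniformly distributed on $\mathcal D_{\mathbf i}$; the $\boldsymbol\eta_{\mathbf i}$ are mutually independent and independent of $X$. The error $\|I(X)-I_N(X,T_N)\|^2$ is the expectation over both $X$ and the $\boldsymbol\eta_{\mathbf i}$. Constant. For $\mathbf u\in\mathbb R_+^d$: $b_{\alpha,d}(\mathbf u)=\frac12\int_{[0,1]^d}\int_{[0,1]^d}\|\mathbf u*(\mathbf t-\mathbf v)\|^\alpha\,d\mathbf t\,d\mathbf v$. *)

theory Defs
  imports "HOL-Probability.Probability"
begin

definition rms :: "'a measure \<Rightarrow> ('a \<Rightarrow> real) \<Rightarrow> real" where
  "rms M \<xi> = sqrt (integral\<^sup>L M (\<lambda>\<omega>. (\<xi> \<omega>)\<^sup>2))"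

abbreviation unit_cube :: "(real ^ 'd) set" where
  "unit_cube \<equiv> cbox 0 1"

text \<open>
  The sub-sigma-algebra \<open>F\<close> carries the randomness of the field: joint measurability is
  required with respect to \<open>F\<close>, and the sampling points will be independent of \<open>F\<close>.
  Independence of the family \<open>X t\<close> (\<open>t\<close> fixed) alone would not determine the law of \<open>X\<close>
  evaluated at a random point: the field \<open>X t \<omega> = (if \<eta> \<omega> = t then 1 else 0)\<close> vanishes almost
  surely for every fixed \<open>t\<close> but equals 1 at \<open>\<eta>\<close>.
  Values of \<open>X\<close> outside the unit cube are irrelevant.
\<close>
definition random_field :: "'a measure \<Rightarrow> 'a measure \<Rightarrow> (real ^ 'd \<Rightarrow> 'a \<Rightarrow> real) \<Rightarrow> bool" where
  "random_field M F X \<longleftrightarrow>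
     prob_space M \<and> subalgebra M F \<and>
     (\<lambda>(t, \<omega>). X t \<omega>) \<in> borel_measurable (restrict_space borel unit_cube \<Otimes>\<^sub>M F) \<and>
     (\<forall>t\<in>unit_cube. integrable M (\<lambda>\<omega>. (X t \<omega>)\<^sup>2)) \<and>
     (\<forall>t\<in>unit_cube. ((\<lambda>s. rms M (\<lambda>\<omega>. X s \<omega> - X t \<omega>)) \<longlongrightarrow> 0) (at t within unit_cube))"

definition holder_field ::
  "'a measure \<Rightarrow> (real ^ 'd \<Rightarrow> 'a \<Rightarrow> real) \<Rightarrow> real \<Rightarrow> real \<Rightarrow> bool" where
  "holder_field M X \<beta> K \<longleftrightarrow>
     (\<forall>t s. t \<in> unit_cube \<longrightarrow> t + s \<in> unit_cube \<longrightarrow>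
        (rms M (\<lambda>\<omega>. X (t + s) \<omega> - X t \<omega>))\<^sup>2 \<le> K * norm s powr \<beta>)"

text \<open>The product \<open>s * u\<close> of vectors is coordinatewise.\<close>
definition local_holder_field ::
  "'a measure \<Rightarrow> (real ^ 'd \<Rightarrow> 'a \<Rightarrow> real) \<Rightarrow> real \<Rightarrow> (real ^ 'd) set \<Rightarrow> (real ^ 'd \<Rightarrow> real) \<Rightarrow> bool" where
  "local_holder_field M X \<alpha> A V \<longleftrightarrow>
     continuous_on A V \<and> (\<forall>t\<in>A. V t > 0) \<and>
     (\<forall>t s. t \<in> A \<longrightarrow> t + s \<in> A \<longrightarrow>
        (\<exists>u\<in>unit_cube. (rms M (\<lambda>\<omega>. X (t + s) \<omega> - X t \<omega>))\<^sup>2 \<le> V (t + s * u) * norm s powr \<alpha>))"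

definition perm_invariant_on :: "(real ^ 'd) set \<Rightarrow> (real ^ 'd \<Rightarrow> real) \<Rightarrow> bool" where
  "perm_invariant_on A c \<longleftrightarrow>
     (\<forall>p t. bij p \<longrightarrow> t \<in> A \<longrightarrow> (\<chi> m. t $ p m) \<in> A \<longrightarrow> c (\<chi> m. t $ p m) = c t)"

definition locally_stationary_field ::
  "'a measure \<Rightarrow> (real ^ 'd \<Rightarrow> 'a \<Rightarrow> real) \<Rightarrow> real \<Rightarrow> (real ^ 'd) set \<Rightarrow> (real ^ 'd \<Rightarrow> real) \<Rightarrow> bool" where
  "locally_stationary_field M X \<alpha> A c \<longleftrightarrow>
     continuous_on A c \<and> (\<forall>t\<in>A. c t > 0) \<and> perm_invariant_on A c \<and>
     (\<forall>\<epsilon>>0. \<exists>\<delta>>0. \<forall>t s. t \<in> A \<longrightarrow> t + s \<in> A \<longrightarrow> 0 < norm s \<longrightarrow> norm s < \<delta> \<longrightarrow>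
        \<bar>(rms M (\<lambda>\<omega>. X (t + s) \<omega> - X t \<omega>))\<^sup>2 / (c t * norm s powr \<alpha>) - 1\<bar> < \<epsilon>)"

text \<open>
  Invariance of \<open>c\<close> is required on the whole punctured cube: a point and its permutation
  need not lie in a common hyperrectangle avoiding the origin.
\<close>
definition CB_field ::
  "'a measure \<Rightarrow> (real ^ 'd \<Rightarrow> 'a \<Rightarrow> real) \<Rightarrow> real \<Rightarrow>
     (real ^ 'd \<Rightarrow> real) \<Rightarrow> (real ^ 'd \<Rightarrow> real) \<Rightarrow> bool" where
  "CB_field M X \<alpha> c V \<longleftrightarrow>
     continuous_on (unit_cube - {0}) c \<and> (\<forall>t\<in>unit_cube - {0}. c t > 0) \<and>
     perm_invariant_on (unit_cube - {0}) c \<and>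
     continuous_on (unit_cube - {0}) V \<and> (\<forall>t\<in>unit_cube - {0}. V t > 0) \<and>
     (\<forall>a b. cbox a b \<subseteq> unit_cube - {0} \<longrightarrow>
        local_holder_field M X \<alpha> (cbox a b) V \<and> locally_stationary_field M X \<alpha> (cbox a b) c)"

definition shifting_condition :: "(real ^ 'd \<Rightarrow> real) \<Rightarrow> real \<Rightarrow> real \<Rightarrow> bool" where
  "shifting_condition f CL CU \<longleftrightarrow>
     0 < CL \<and> CL < CU \<and> (\<forall>t\<in>unit_cube - {0}. f t > 0) \<and>
     (\<exists>C>0. \<exists>a>0. \<forall>s\<in>cbox 0 (\<chi> m. a) - {0}. \<forall>v\<in>cbox 0 (\<chi> m. a) - {0}.
        CL \<le> norm s / norm v \<longrightarrow> norm s / norm v \<le> CU \<longrightarrow> f s \<le> C * f v)"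

definition positive_density :: "(real \<Rightarrow> real) \<Rightarrow> bool" where
  "positive_density h \<longleftrightarrow>
     continuous_on {0..1} h \<and> (\<forall>x\<in>{0..1}. h x > 0) \<and> integral {0..1} h = 1"

definition cum :: "(real \<Rightarrow> real) \<Rightarrow> real \<Rightarrow> real" where
  "cum h t = integral {0..t} h"

definition quant :: "(real \<Rightarrow> real) \<Rightarrow> real \<Rightarrow> real" where
  "quant h = inv_into {0..1} (cum h)"

definition cum_vec :: "(real \<Rightarrow> real) \<Rightarrow> real ^ 'd \<Rightarrow> real ^ 'd" where
  "cum_vec h t = (\<chi> m. cum h (t $ m))"

definition quant_vec :: "(real \<Rightarrow> real) \<Rightarrow> real ^ 'd \<Rightarrow> real ^ 'd" where
  "quant_vec h t = (\<chi> m. quant h (t $ m))"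

definition grid_pt :: "(real \<Rightarrow> real) \<Rightarrow> nat \<Rightarrow> nat \<Rightarrow> real" where
  "grid_pt h n i = (THE t. t \<in> {0..1} \<and> integral {0..t} h = real i / real n)"

definition strata_idx :: "nat \<Rightarrow> ('d \<Rightarrow> nat) set" where
  "strata_idx n = {i. \<forall>m. i m < n}"

definition stratum :: "(real \<Rightarrow> real) \<Rightarrow> nat \<Rightarrow> ('d \<Rightarrow> nat) \<Rightarrow> (real ^ 'd) set" where
  "stratum h n i = cbox (\<chi> m. grid_pt h n (i m)) (\<chi> m. grid_pt h n (i m + 1))"

text \<open>
  The points are mutually independent, and the sigma-algebra generated by all of them jointly
  is independent of the sigma-algebra \<open>F\<close> of the field. They lie in their strata for every
  outcome, since the field is only given on the unit cube.
\<close>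
definition stratified_sample ::
  "'a measure \<Rightarrow> 'a measure \<Rightarrow> (real \<Rightarrow> real) \<Rightarrow> nat \<Rightarrow> (('d \<Rightarrow> nat) \<Rightarrow> 'a \<Rightarrow> real ^ 'd) \<Rightarrow> bool" where
  "stratified_sample M F h n \<eta> \<longleftrightarrow>
     (\<forall>i\<in>strata_idx n. \<eta> i \<in> measurable M (restrict_space borel (stratum h n i)) \<and>
        distr M lborel (\<eta> i) = uniform_measure lborel (stratum h n i)) \<and>
     prob_space.indep_vars M (\<lambda>_. borel) \<eta> (strata_idx n) \<and>
     prob_space.indep_set M (sets F)
       (sets (vimage_algebra (space M)
          (\<lambda>\<omega>. \<lambda>i\<in>strata_idx n. \<eta> i \<omega>) (Pi\<^sub>M (strata_idx n) (\<lambda>_. borel))))"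

definition field_integral :: "(real ^ 'd \<Rightarrow> 'a \<Rightarrow> real) \<Rightarrow> 'a \<Rightarrow> real" where
  "field_integral X \<omega> = (LINT t:unit_cube|lborel. X t \<omega>)"

definition quadrature ::
  "(real \<Rightarrow> real) \<Rightarrow> nat \<Rightarrow> (('d \<Rightarrow> nat) \<Rightarrow> 'a \<Rightarrow> real ^ 'd) \<Rightarrow> (real ^ 'd \<Rightarrow> 'a \<Rightarrow> real) \<Rightarrow> 'a \<Rightarrow> real" where
  "quadrature h n \<eta> X \<omega> =
     (\<Sum>i\<in>strata_idx n. X (\<eta> i \<omega>) \<omega> * measure lborel (stratum h n i))"

definition b_const :: "real \<Rightarrow> real ^ 'd \<Rightarrow> real" where
  "b_const \<alpha> u = 1 / 2 *
     (LINT t:unit_cube|lborel. (LINT v:unit_cube|lborel. norm (u * (t - v)) powr \<alpha>))"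

end

theory Submission
  imports Defs
begin

text \<open>
  Conditionally on the field the summands of the error are independent and centred, so the mean
  square error is exactly the sum over all strata of half the integral of the variogram
  \<open>\<gamma> x y = E (X y - X x)\<^sup>2\<close> over the squared stratum. Multiplied by \<open>n\<^sup>d\<^sup>+\<^sup>\<alpha>\<close>, the part of this sum
  coming from the strata away from the origin is the integral of a function that is constant on
  each stratum. By local stationarity this function converges pointwise to the integrand of the
  claim, and by the local Hoelder and shifting conditions it is dominated by a multiple of
  \<open>R (H t)\<close> plus a constant, so dominated convergence applies. The stratum at the origin is
  negligible by the global Hoelder condition because \<open>\<alpha> - d < \<beta>\<close>.
\<close>

section \<open>Independent errors\<close>

text \<open>Two facts separate probability from analysis. The variance of the value at a uniform
  point is half the mean squared difference of two independent copies, and Tonelli exchanges these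
  copies with the expectation over the field. So only the two-point function \<gamma> survives, and
  what follows is deterministic. The obstacle is that \<open>c\<close> and \<open>V\<close> may be
  unbounded near the origin. Every stratum but the one of index 0 is a hyperrectangle avoiding 0, so
  the local conditions hold on it. Yet the Hoelder condition evaluates \<open>V\<close> at an
  uncontrolled point \<open>z\<close> of the stratum, while dominated convergence needs a bound in
  terms of the integration variable \<open>t\<close>. The map \<open>cum_vec h\<close> turns strata
  into cubes of side 1/n, in which the norms of the images of \<open>z\<close> and \<open>t\<close>
  differ at most by the factor sqrt (3 + d); this is the comparison that the shifting condition
  allows. That condition speaks only of a neighbourhood of 0; elsewhere \<open>V\<close> is bounded
  by compactness, which is the origin of the additive constant in the majorant.\<close>

lemma (in prob_space) expectation_square_sum_indep:
  fixes Z :: "'i \<Rightarrow> 'a \<Rightarrow> real"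
  assumes I: "finite I" and indep: "indep_vars (\<lambda>_. borel) Z I"
    and sq: "\<And>i. i \<in> I \<Longrightarrow> integrable M (\<lambda>x. (Z i x)\<^sup>2)"
    and zero: "\<And>i. i \<in> I \<Longrightarrow> expectation (Z i) = 0"
  shows "integrable M (\<lambda>x. (\<Sum>i\<in>I. Z i x)\<^sup>2)"
    and "expectation (\<lambda>x. (\<Sum>i\<in>I. Z i x)\<^sup>2) = (\<Sum>i\<in>I. expectation (\<lambda>x. (Z i x)\<^sup>2))"
proof -
  have rv: "random_variable borel (Z i)" if "i \<in> I" for i
    using indep that by (auto simp: indep_vars_def)
  have int: "integrable M (Z i)" if "i \<in> I" for i
    using square_integrable_imp_integrable[OF rv[OF that] sq[OF that]] .
  have pr: "integrable M (\<lambda>x. Z i x * Z j x)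
      \<and> expectation (\<lambda>x. Z i x * Z j x) = (if i = j then expectation (\<lambda>x. (Z i x)\<^sup>2) else 0)"
    if "i \<in> I" "j \<in> I" for i j
  proof (cases "i = j")
    case True
    then show ?thesis using sq[OF that(1)] by (simp add: power2_eq_square)
  next
    case False
    \<comment> \<open>Mixed terms factorise by pairwise independence and vanish because the factors
      are centred; only the diagonal contributes.\<close>
    have sub: "finite {i, j}" "indep_vars (\<lambda>_. borel) Z {i, j}"
      using indep_vars_subset[OF indep, of "{i, j}"] that by auto
    show ?thesis
      using indep_vars_lebesgue_integral[OF sub] indep_vars_integrable[OF sub] int that zero False
      by auto
  qed
  have eq: "(\<Sum>i\<in>I. Z i x)\<^sup>2 = (\<Sum>i\<in>I. \<Sum>j\<in>I. Z i x * Z j x)" for x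
    by (simp add: power2_eq_square sum_product)
  show "integrable M (\<lambda>x. (\<Sum>i\<in>I. Z i x)\<^sup>2)"
    unfolding eq using pr by (intro Bochner_Integration.integrable_sum) auto
  have "expectation (\<lambda>x. (\<Sum>i\<in>I. Z i x)\<^sup>2) = (\<Sum>i\<in>I. \<Sum>j\<in>I. expectation (\<lambda>x. Z i x * Z j x))"
    unfolding eq using pr
    by (subst Bochner_Integration.integral_sum, auto intro!: sum.cong Bochner_Integration.integral_sum)
  also have "\<dots> = (\<Sum>i\<in>I. \<Sum>j\<in>I. if i = j then expectation (\<lambda>x. (Z i x)\<^sup>2) else 0)"
    using pr by (intro sum.cong) auto
  also have "\<dots> = (\<Sum>i\<in>I. expectation (\<lambda>x. (Z i x)\<^sup>2))"
    using I by (simp add: sum.delta)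
  finally show "expectation (\<lambda>x. (\<Sum>i\<in>I. Z i x)\<^sup>2) = (\<Sum>i\<in>I. expectation (\<lambda>x. (Z i x)\<^sup>2))" .
qed

text \<open>Expanding the square gives twice the second moment minus twice the squared mean. The
  double integral is taken in \<open>ennreal\<close> so that the order of integration can later be
  exchanged without integrability conditions.\<close>

lemma (in prob_space) nn_integral_square_diff:
  fixes f :: "'a \<Rightarrow> real"
  assumes [measurable]: "f \<in> borel_measurable M" and sq: "integrable M (\<lambda>x. (f x)\<^sup>2)"
  shows "(\<integral>\<^sup>+x. \<integral>\<^sup>+y. ennreal ((f x - f y)\<^sup>2) \<partial>M \<partial>M) = 2 * ennreal (variance f)"
proof -
  have int: "integrable M f" by (rule square_integrable_imp_integrable[OF _ sq]) simp
  have inner: "(\<integral>\<^sup>+y. ennreal ((f x - f y)\<^sup>2) \<partial>M)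
      = ennreal ((f x)\<^sup>2 - 2 * f x * expectation f + expectation (\<lambda>y. (f y)\<^sup>2))" for x
  proof -
    have "integrable M (\<lambda>y. (f x - f y)\<^sup>2)" using int sq by (simp add: power2_diff)
    then have "(\<integral>\<^sup>+y. ennreal ((f x - f y)\<^sup>2) \<partial>M) = ennreal (\<integral>y. (f x - f y)\<^sup>2 \<partial>M)"
      by (intro nn_integral_eq_integral) auto
    also have "(\<integral>y. (f x - f y)\<^sup>2 \<partial>M) = (f x)\<^sup>2 - 2 * f x * expectation f + expectation (\<lambda>y. (f y)\<^sup>2)"
      using int sq by (simp add: power2_diff prob_space mult_ac)
    finally show ?thesis .
  qed
  have nonneg: "0 \<le> (f x)\<^sup>2 - 2 * f x * expectation f + expectation (\<lambda>y. (f y)\<^sup>2)" for x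
  proof -
    have "0 \<le> (\<integral>y. (f x - f y)\<^sup>2 \<partial>M)" by simp
    also have "\<dots> = (f x)\<^sup>2 - 2 * f x * expectation f + expectation (\<lambda>y. (f y)\<^sup>2)"
      using int sq by (simp add: power2_diff prob_space mult_ac)
    finally show ?thesis .
  qed
  show ?thesis
    unfolding inner using int sq nonneg
    by (subst nn_integral_eq_integral)
      (auto simp: variance_eq prob_space power2_eq_square algebra_simps
        ennreal_mult'[symmetric] simp flip: ennreal_numeral)
qed

text \<open>Freezing: the identity map from \<open>M\<close> into \<open>F\<close> carries all of
  \<open>F\<close>, and its joint law with \<open>Y\<close> is a product, so the first argument may
  be held fixed while \<open>Y\<close> is averaged. The outer measure is the law of this identity
  map, that is, the restriction of \<open>M\<close> to \<open>F\<close>.\<close>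

lemma (in prob_space) nn_integral_indep_subalgebra:
  assumes F: "subalgebra M F" and Y: "Y \<in> measurable M N"
    and indep: "indep_set (sets F) (sets (vimage_algebra (space M) Y N))"
    and [measurable]: "f \<in> borel_measurable (F \<Otimes>\<^sub>M N)"
  shows "(\<integral>\<^sup>+\<omega>. f (\<omega>, Y \<omega>) \<partial>M) = (\<integral>\<^sup>+\<omega>. \<integral>\<^sup>+\<omega>'. f (\<omega>, Y \<omega>') \<partial>M \<partial>restr_to_subalg M F)"
proof -
  have sp: "space F = space M" using F by (simp add: subalgebra_def)
  have id[measurable]: "(\<lambda>\<omega>. \<omega>) \<in> measurable M F"
    using F by (auto simp: subalgebra_def measurable_def)
  note Y[measurable]
  interpret N: prob_space "distr M N Y" by (rule prob_space_distr) fact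
  interpret Q: prob_space "distr M F (\<lambda>\<omega>. \<omega>)" by (rule prob_space_distr) fact
  \<comment> \<open>Checked on rectangles, where it is independence of an event of \<open>F\<close>
    and a preimage under \<open>Y\<close>.\<close>
  have eq: "distr M F (\<lambda>\<omega>. \<omega>) \<Otimes>\<^sub>M distr M N Y = distr M (F \<Otimes>\<^sub>M N) (\<lambda>\<omega>. (\<omega>, Y \<omega>))"
  proof (rule pair_measure_eqI)
    fix A B assume "A \<in> sets (distr M F (\<lambda>\<omega>. \<omega>))" "B \<in> sets (distr M N Y)"
    then have A: "A \<in> sets F" and B: "B \<in> sets N" by auto
    have A': "A \<inter> space M = A" "A \<in> sets M"
      using A F sets.sets_into_space[of A F] sp by (auto simp: subalgebra_def)
    have "Y -` B \<inter> space M \<in> sets (vimage_algebra (space M) Y N)"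
      using B by (rule in_vimage_algebra)
    from indep_setD[OF indep A this]
    have "prob (A \<inter> (Y -` B \<inter> space M)) = prob A * prob (Y -` B \<inter> space M)" .
    moreover have "(\<lambda>\<omega>. (\<omega>, Y \<omega>)) -` (A \<times> B) \<inter> space M = A \<inter> (Y -` B \<inter> space M)"
      using A' by auto
    ultimately show "emeasure (distr M F (\<lambda>\<omega>. \<omega>)) A * emeasure (distr M N Y) B
        = emeasure (distr M (F \<Otimes>\<^sub>M N) (\<lambda>\<omega>. (\<omega>, Y \<omega>))) (A \<times> B)"
      using A B A' by (simp add: emeasure_distr emeasure_eq_measure ennreal_mult)
  qed (simp_all add: N.sigma_finite_measure_axioms Q.sigma_finite_measure_axioms cong: sets_pair_measure_cong)
  have rF: "distr M F (\<lambda>\<omega>. \<omega>) = restr_to_subalg M F"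
  proof (rule measure_eqI)
    show "sets (distr M F (\<lambda>\<omega>. \<omega>)) = sets (restr_to_subalg M F)"
      by (simp add: sets_restr_to_subalg[OF F])
    fix A assume "A \<in> sets (distr M F (\<lambda>\<omega>. \<omega>))"
    then have A: "A \<in> sets F" by simp
    then have "A \<inter> space M = A" using sets.sets_into_space sp by fastforce
    then show "emeasure (distr M F (\<lambda>\<omega>. \<omega>)) A = emeasure (restr_to_subalg M F) A"
      using A by (simp add: emeasure_distr emeasure_restr_to_subalg[OF F])
  qed
  have "(\<integral>\<^sup>+\<omega>. f (\<omega>, Y \<omega>) \<partial>M) = (\<integral>\<^sup>+z. f z \<partial>distr M (F \<Otimes>\<^sub>M N) (\<lambda>\<omega>. (\<omega>, Y \<omega>)))"
    by (subst nn_integral_distr) auto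
  also have "\<dots> = (\<integral>\<^sup>+\<omega>. \<integral>\<^sup>+e. f (\<omega>, e) \<partial>distr M N Y \<partial>distr M F (\<lambda>\<omega>. \<omega>))"
    unfolding eq[symmetric] by (subst N.nn_integral_fst[symmetric]) auto
  also have "\<dots> = (\<integral>\<^sup>+\<omega>. \<integral>\<^sup>+\<omega>'. f (\<omega>, Y \<omega>') \<partial>M \<partial>distr M F (\<lambda>\<omega>. \<omega>))"
    by (intro nn_integral_cong nn_integral_distr) (auto simp: sp)
  finally show ?thesis unfolding rF .
qed

text \<open>Given the field, the summands are independent with mean zero. Each conditional variance
  is written as half a double integral, so that Tonelli can move the expectation over the field to
  the innermost place.\<close>

lemma (in prob_space) nn_integral_stratified_error:
  fixes X :: "'b::{second_countable_topology,t2_space} \<Rightarrow> 'a \<Rightarrow> real" and w :: "'i \<Rightarrow> real"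
    and \<eta> :: "'i \<Rightarrow> 'a \<Rightarrow> 'b"
  defines "U \<equiv> \<lambda>i. distr M borel (\<eta> i)"
  assumes F: "subalgebra M F" and I: "finite I"
    and X: "(\<lambda>(t, \<omega>). X t \<omega>) \<in> borel_measurable (borel \<Otimes>\<^sub>M F)"
    and indep: "indep_vars (\<lambda>_. borel) \<eta> I"
    and indepF: "indep_set (sets F) (sets (vimage_algebra (space M)
          (\<lambda>\<omega>. \<lambda>i\<in>I. \<eta> i \<omega>) (Pi\<^sub>M I (\<lambda>_. borel))))"
    and sq: "AE \<omega> in restr_to_subalg M F. \<forall>i\<in>I. integrable (U i) (\<lambda>t. (X t \<omega>)\<^sup>2)"
  shows "(\<integral>\<^sup>+\<omega>. ennreal ((\<Sum>i\<in>I. w i * ((\<integral>t. X t \<omega> \<partial>U i) - X (\<eta> i \<omega>) \<omega>))\<^sup>2) \<partial>M)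
     = (\<Sum>i\<in>I. ennreal ((w i)\<^sup>2 / 2) *
         (\<integral>\<^sup>+x. \<integral>\<^sup>+y. \<integral>\<^sup>+\<omega>. ennreal ((X x \<omega> - X y \<omega>)\<^sup>2) \<partial>M \<partial>U i \<partial>U i))"
proof -
  let ?Q = "restr_to_subalg M F" let ?N = "Pi\<^sub>M I (\<lambda>_. borel :: 'b measure)"
  let ?Y = "\<lambda>\<omega>. \<lambda>i\<in>I. \<eta> i \<omega>"
  have sp: "space F = space M" using F by (simp add: subalgebra_def)
  have rv: "\<eta> i \<in> borel_measurable M" if "i \<in> I" for i
    using indep that by (auto simp: indep_vars_def)
  have setsQ[measurable_cong]: "sets ?Q = sets F" by (rule sets_restr_to_subalg[OF F])
  interpret Q: prob_space ?Q by (rule prob_space_restr_to_subalg[OF F]) unfold_locales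
  have XF[measurable]: "(\<lambda>(t, \<omega>). X t \<omega>) \<in> borel_measurable (borel \<Otimes>\<^sub>M F)" by (rule X)
  have XQ[measurable]: "(\<lambda>(t, \<omega>). X t \<omega>) \<in> borel_measurable (borel \<Otimes>\<^sub>M ?Q)"
    using X measurable_cong_sets[OF sets_pair_measure_cong[OF refl setsQ] refl] by blast
  have XsF: "(\<lambda>\<omega>. X t \<omega>) \<in> borel_measurable F" for t
    using measurable_compose[OF measurable_Pair1' XF, of t] by simp
  have Xt: "(\<lambda>t. X t \<omega>) \<in> borel_measurable borel" if "\<omega> \<in> space M" for \<omega>
    using measurable_compose[OF measurable_Pair2' XF, of \<omega>] that sp by simp
  have prob_U: "prob_space (U i)" if "i \<in> I" for i
    unfolding U_def using rv[OF that] by (rule prob_space_distr)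
  have sets_U[measurable_cong]: "sets (U i) = sets borel" for i by (simp add: U_def)
  define f where "f = (\<lambda>(\<omega>, e). ennreal ((\<Sum>i\<in>I. w i * ((\<integral>t. X t \<omega> \<partial>U i) - X (e i) \<omega>))\<^sup>2))"
  have Imeas: "(\<lambda>\<omega>. \<integral>t. X t \<omega> \<partial>U i) \<in> borel_measurable F" if "i \<in> I" for i
  proof -
    interpret Ui: prob_space "U i" by (rule prob_U[OF that])
    have "(\<lambda>(\<omega>, t). X t \<omega>) \<in> borel_measurable (F \<Otimes>\<^sub>M borel)"
      using measurable_compose[OF measurable_pair_swap' X] by (simp add: case_prod_beta)
    then have "(\<lambda>(\<omega>, t). X t \<omega>) \<in> borel_measurable (F \<Otimes>\<^sub>M U i)"
      using measurable_cong_sets[OF sets_pair_measure_cong[OF refl sets_U] refl] by blast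
    then show ?thesis by (rule Ui.borel_measurable_lebesgue_integral)
  qed
  have fm: "f \<in> borel_measurable (F \<Otimes>\<^sub>M ?N)"
  proof -
    have "(\<lambda>z. (\<integral>t. X t (fst z) \<partial>U i)) \<in> borel_measurable (F \<Otimes>\<^sub>M ?N)" if "i \<in> I" for i
      by (rule measurable_compose[OF measurable_fst Imeas[OF that]])
    moreover have "(\<lambda>z. X (snd z i) (fst z)) \<in> borel_measurable (F \<Otimes>\<^sub>M ?N)" if "i \<in> I" for i
    proof -
      have "(\<lambda>z. (snd z i, fst z)) \<in> measurable (F \<Otimes>\<^sub>M ?N) (borel \<Otimes>\<^sub>M F)"
        using that by measurable
      from measurable_compose[OF this X] show ?thesis by simp
    qed
    ultimately show ?thesis unfolding f_def case_prod_beta by measurable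
  qed
  have Ym: "?Y \<in> measurable M ?N" using rv by (intro measurable_restrict) auto
  \<comment> \<open>Here \<open>\<omega>\<close> is fixed, so only the points
    \<open>\<eta> i\<close> are random, and \<open>U i\<close> is the law of each of them.\<close>
  have fixed: "(\<integral>\<^sup>+\<omega>'. f (\<omega>, ?Y \<omega>') \<partial>M)
      = (\<Sum>i\<in>I. ennreal ((w i)\<^sup>2 / 2) * (\<integral>\<^sup>+x. \<integral>\<^sup>+y. ennreal ((X x \<omega> - X y \<omega>)\<^sup>2) \<partial>U i \<partial>U i))"
    if \<omega>: "\<omega> \<in> space M" and int: "\<forall>i\<in>I. integrable (U i) (\<lambda>t. (X t \<omega>)\<^sup>2)" for \<omega>
  proof -
    note Xm[measurable] = Xt[OF \<omega>]
    define Z where "Z i \<omega>' = w i * ((\<integral>t. X t \<omega> \<partial>U i) - X (\<eta> i \<omega>') \<omega>)" for i \<omega>'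
    have iZ: "indep_vars (\<lambda>_. borel) Z I"
      unfolding Z_def
      by (rule indep_vars_compose2[OF indep, where Y = "\<lambda>i t. w i * ((\<integral>t. X t \<omega> \<partial>U i) - X t \<omega>)"]) measurable
    have Zsq: "integrable M (\<lambda>x. (Z i x)\<^sup>2) \<and> expectation (Z i) = 0 \<and>
        ennreal (expectation (\<lambda>x. (Z i x)\<^sup>2))
        = ennreal ((w i)\<^sup>2 / 2) * (\<integral>\<^sup>+x. \<integral>\<^sup>+y. ennreal ((X x \<omega> - X y \<omega>)\<^sup>2) \<partial>U i \<partial>U i)" if i: "i \<in> I" for i
    proof -
      interpret Ui: prob_space "U i" by (rule prob_U[OF i])
      have m[measurable]: "(\<lambda>t. X t \<omega>) \<in> borel_measurable (U i)" by simp
      have sqi: "integrable (U i) (\<lambda>t. (X t \<omega>)\<^sup>2)" using int i by blast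
      have ii: "integrable (U i) (\<lambda>t. X t \<omega>)" by (rule Ui.square_integrable_imp_integrable[OF m sqi])
      let ?\<mu> = "\<integral>t. X t \<omega> \<partial>U i"
      have e: "(w i * (?\<mu> - X t \<omega>))\<^sup>2 = (w i)\<^sup>2 * (X t \<omega> - ?\<mu>)\<^sup>2" for t
        by (simp add: power_mult_distrib power2_commute)
      have var: "integrable (U i) (\<lambda>t. (X t \<omega> - ?\<mu>)\<^sup>2)"
        using sqi ii by (simp add: power2_diff)
      have 1: "integrable (U i) (\<lambda>t. (w i * (?\<mu> - X t \<omega>))\<^sup>2)"
        unfolding e using var by simp
      have A: "integrable M (\<lambda>x. (Z i x)\<^sup>2)"
        using 1 unfolding Z_def unfolding U_def by (subst (asm) integrable_distr_eq) (auto simp: rv[OF i])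
      have "expectation (Z i) = (\<integral>t. w i * (?\<mu> - X t \<omega>) \<partial>U i)"
        unfolding Z_def U_def by (subst (2) integral_distr) (auto simp: rv[OF i])
      also have "\<dots> = 0" using ii by (simp add: Ui.prob_space)
      finally have B: "expectation (Z i) = 0" .
      have "expectation (\<lambda>x. (Z i x)\<^sup>2) = (\<integral>t. (w i * (?\<mu> - X t \<omega>))\<^sup>2 \<partial>U i)"
        unfolding Z_def U_def by (subst (2) integral_distr) (auto simp: rv[OF i])
      also have "\<dots> = (w i)\<^sup>2 * Ui.variance (\<lambda>t. X t \<omega>)" unfolding e by simp
      finally have "ennreal (expectation (\<lambda>x. (Z i x)\<^sup>2)) = ennreal ((w i)\<^sup>2 / 2) * (2 * ennreal (Ui.variance (\<lambda>t. X t \<omega>)))"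
        by (simp add: ennreal_mult'[symmetric] flip: ennreal_numeral)
      then show ?thesis using A B Ui.nn_integral_square_diff[OF m sqi] by simp
    qed
    have "(\<integral>\<^sup>+\<omega>'. f (\<omega>, ?Y \<omega>') \<partial>M) = (\<integral>\<^sup>+\<omega>'. ennreal ((\<Sum>i\<in>I. Z i \<omega>')\<^sup>2) \<partial>M)"
      unfolding f_def Z_def by (intro nn_integral_cong) (auto intro!: arg_cong[where f=ennreal] arg_cong[where f="\<lambda>x. x\<^sup>2"] sum.cong)
    also have "\<dots> = ennreal (expectation (\<lambda>x. (\<Sum>i\<in>I. Z i x)\<^sup>2))"
      using expectation_square_sum_indep(1)[OF I iZ] Zsq by (intro nn_integral_eq_integral) auto
    also have "\<dots> = ennreal (\<Sum>i\<in>I. expectation (\<lambda>x. (Z i x)\<^sup>2))"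
      using expectation_square_sum_indep(2)[OF I iZ] Zsq by simp
    also have "\<dots> = (\<Sum>i\<in>I. ennreal (expectation (\<lambda>x. (Z i x)\<^sup>2)))"
      by (subst sum_ennreal) auto
    also have "\<dots> = (\<Sum>i\<in>I. ennreal ((w i)\<^sup>2 / 2) * (\<integral>\<^sup>+x. \<integral>\<^sup>+y. ennreal ((X x \<omega> - X y \<omega>)\<^sup>2) \<partial>U i \<partial>U i))"
      using Zsq by (intro sum.cong) auto
    finally show ?thesis .
  qed
  have "(\<integral>\<^sup>+\<omega>. ennreal ((\<Sum>i\<in>I. w i * ((\<integral>t. X t \<omega> \<partial>U i) - X (\<eta> i \<omega>) \<omega>))\<^sup>2) \<partial>M)
      = (\<integral>\<^sup>+\<omega>. f (\<omega>, ?Y \<omega>) \<partial>M)"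
    unfolding f_def by (intro nn_integral_cong) (auto intro!: arg_cong[where f=ennreal] arg_cong[where f="\<lambda>x. x\<^sup>2"] sum.cong)
  also have "\<dots> = (\<integral>\<^sup>+\<omega>. \<integral>\<^sup>+\<omega>'. f (\<omega>, ?Y \<omega>') \<partial>M \<partial>?Q)"
    by (rule nn_integral_indep_subalgebra[OF F Ym indepF fm])
  also have "\<dots> = (\<integral>\<^sup>+\<omega>. (\<Sum>i\<in>I. ennreal ((w i)\<^sup>2 / 2) *
        (\<integral>\<^sup>+x. \<integral>\<^sup>+y. ennreal ((X x \<omega> - X y \<omega>)\<^sup>2) \<partial>U i \<partial>U i)) \<partial>?Q)"
  proof (rule nn_integral_cong_AE, rule AE_mp[OF sq], rule AE_I2, rule impI)
    fix \<omega>
    assume "\<omega> \<in> space ?Q" and "\<forall>i\<in>I. integrable (U i) (\<lambda>t. (X t \<omega>)\<^sup>2)"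
    then show "(\<integral>\<^sup>+\<omega>'. f (\<omega>, ?Y \<omega>') \<partial>M) = (\<Sum>i\<in>I. ennreal ((w i)\<^sup>2 / 2) *
        (\<integral>\<^sup>+x. \<integral>\<^sup>+y. ennreal ((X x \<omega> - X y \<omega>)\<^sup>2) \<partial>U i \<partial>U i))"
      by (intro fixed) (simp_all add: space_restr_to_subalg)
  qed
  also have "\<dots> = (\<Sum>i\<in>I. ennreal ((w i)\<^sup>2 / 2) *
        (\<integral>\<^sup>+x. \<integral>\<^sup>+y. \<integral>\<^sup>+\<omega>. ennreal ((X x \<omega> - X y \<omega>)\<^sup>2) \<partial>M \<partial>U i \<partial>U i))"
  proof -
    have m3: "(\<lambda>z. ennreal ((X (fst (fst z)) (snd z) - X (snd (fst z)) (snd z))\<^sup>2))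
      \<in> borel_measurable ((borel \<Otimes>\<^sub>M borel) \<Otimes>\<^sub>M ?Q)"
    proof -
      have "(\<lambda>z. (fst (fst z), snd z)) \<in> measurable ((borel \<Otimes>\<^sub>M borel) \<Otimes>\<^sub>M ?Q) (borel \<Otimes>\<^sub>M ?Q)"
        "(\<lambda>z. (snd (fst z), snd z)) \<in> measurable ((borel \<Otimes>\<^sub>M borel) \<Otimes>\<^sub>M ?Q) (borel \<Otimes>\<^sub>M ?Q)"
        by measurable
      from measurable_compose[OF this(1) XQ] measurable_compose[OF this(2) XQ] show ?thesis
        by simp
    qed
    \<comment> \<open>Tonelli for two copies of \<open>U i\<close> and the restriction of
      \<open>M\<close> to \<open>F\<close>. The restriction is replaced by \<open>M\<close> at the
      end, since for fixed points the integrand is \<open>F\<close>-measurable.\<close>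
    have main: "(\<integral>\<^sup>+\<omega>. \<integral>\<^sup>+x. \<integral>\<^sup>+y. ennreal ((X x \<omega> - X y \<omega>)\<^sup>2) \<partial>U i \<partial>U i \<partial>?Q)
        = (\<integral>\<^sup>+x. \<integral>\<^sup>+y. \<integral>\<^sup>+\<omega>. ennreal ((X x \<omega> - X y \<omega>)\<^sup>2) \<partial>M \<partial>U i \<partial>U i)"
      and main2: "(\<lambda>\<omega>. \<integral>\<^sup>+x. \<integral>\<^sup>+y. ennreal ((X x \<omega> - X y \<omega>)\<^sup>2) \<partial>U i \<partial>U i) \<in> borel_measurable ?Q"
      if i: "i \<in> I" for i
    proof -
      interpret Ui: prob_space "U i" by (rule prob_U[OF i])
      interpret UU: pair_prob_space "U i" "U i" ..
      interpret UQ: pair_prob_space "U i \<Otimes>\<^sub>M U i" ?Q ..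
      have sets3: "sets ((U i \<Otimes>\<^sub>M U i) \<Otimes>\<^sub>M ?Q) = sets ((borel \<Otimes>\<^sub>M borel) \<Otimes>\<^sub>M ?Q)"
        by (intro sets_pair_measure_cong sets_U refl)
      have m3': "(\<lambda>(z,\<omega>). ennreal ((X (fst z) \<omega> - X (snd z) \<omega>)\<^sup>2)) \<in> borel_measurable ((U i \<Otimes>\<^sub>M U i) \<Otimes>\<^sub>M ?Q)"
        using m3 measurable_cong_sets[OF sets3 refl] unfolding case_prod_beta by blast
      have m2: "(\<lambda>(x,y). ennreal ((X x \<omega> - X y \<omega>)\<^sup>2)) \<in> borel_measurable (U i \<Otimes>\<^sub>M U i)"
        if "\<omega> \<in> space ?Q" for \<omega>
      proof -
        have [measurable]: "(\<lambda>t. X t \<omega>) \<in> borel_measurable borel"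
          using Xt that by (simp add: space_restr_to_subalg)
        show ?thesis by measurable
      qed
      have fstm: "(\<lambda>z. \<integral>\<^sup>+\<omega>. ennreal ((X (fst z) \<omega> - X (snd z) \<omega>)\<^sup>2) \<partial>?Q) \<in> borel_measurable (U i \<Otimes>\<^sub>M U i)"
        using Q.borel_measurable_nn_integral_fst[OF m3'] by simp
      have in_eq: "(\<integral>\<^sup>+z. ennreal ((X (fst z) \<omega> - X (snd z) \<omega>)\<^sup>2) \<partial>(U i \<Otimes>\<^sub>M U i))
         = (\<integral>\<^sup>+x. \<integral>\<^sup>+y. ennreal ((X x \<omega> - X y \<omega>)\<^sup>2) \<partial>U i \<partial>U i)" if "\<omega> \<in> space ?Q" for \<omega>
        using Ui.nn_integral_fst[OF m2[OF that]] unfolding case_prod_beta by simp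
      have "(\<integral>\<^sup>+\<omega>. \<integral>\<^sup>+x. \<integral>\<^sup>+y. ennreal ((X x \<omega> - X y \<omega>)\<^sup>2) \<partial>U i \<partial>U i \<partial>?Q)
        = (\<integral>\<^sup>+\<omega>. \<integral>\<^sup>+z. ennreal ((X (fst z) \<omega> - X (snd z) \<omega>)\<^sup>2) \<partial>(U i \<Otimes>\<^sub>M U i) \<partial>?Q)"
        by (intro nn_integral_cong) (simp add: in_eq)
      also have "\<dots> = (\<integral>\<^sup>+z. \<integral>\<^sup>+\<omega>. ennreal ((X (fst z) \<omega> - X (snd z) \<omega>)\<^sup>2) \<partial>?Q \<partial>(U i \<Otimes>\<^sub>M U i))"
        using UQ.Fubini[OF m3'] by simp
      also have "\<dots> = (\<integral>\<^sup>+x. \<integral>\<^sup>+y. \<integral>\<^sup>+\<omega>. ennreal ((X x \<omega> - X y \<omega>)\<^sup>2) \<partial>?Q \<partial>U i \<partial>U i)"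
        using Ui.nn_integral_fst[OF fstm] by simp
      also have "\<dots> = (\<integral>\<^sup>+x. \<integral>\<^sup>+y. \<integral>\<^sup>+\<omega>. ennreal ((X x \<omega> - X y \<omega>)\<^sup>2) \<partial>M \<partial>U i \<partial>U i)"
      proof -
        have "(\<integral>\<^sup>+\<omega>. ennreal ((X x \<omega> - X y \<omega>)\<^sup>2) \<partial>?Q) = (\<integral>\<^sup>+\<omega>. ennreal ((X x \<omega> - X y \<omega>)\<^sup>2) \<partial>M)" for x y
          using XsF[of x] XsF[of y] by (intro nn_integral_subalgebra2[OF F]) measurable
        then show ?thesis by simp
      qed
      finally show "(\<integral>\<^sup>+\<omega>. \<integral>\<^sup>+x. \<integral>\<^sup>+y. ennreal ((X x \<omega> - X y \<omega>)\<^sup>2) \<partial>U i \<partial>U i \<partial>?Q)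
        = (\<integral>\<^sup>+x. \<integral>\<^sup>+y. \<integral>\<^sup>+\<omega>. ennreal ((X x \<omega> - X y \<omega>)\<^sup>2) \<partial>M \<partial>U i \<partial>U i)" .
      have "(\<lambda>\<omega>. \<integral>\<^sup>+z. ennreal ((X (fst z) \<omega> - X (snd z) \<omega>)\<^sup>2) \<partial>(U i \<Otimes>\<^sub>M U i)) \<in> borel_measurable ?Q"
      proof (rule UU.borel_measurable_nn_integral)
        show "(\<lambda>(\<omega>, z). ennreal ((X (fst z) \<omega> - X (snd z) \<omega>)\<^sup>2))
          \<in> borel_measurable (?Q \<Otimes>\<^sub>M (U i \<Otimes>\<^sub>M U i))"
          using measurable_compose[OF measurable_pair_swap' m3'] by (simp add: case_prod_beta)
      qed
      then show "(\<lambda>\<omega>. \<integral>\<^sup>+x. \<integral>\<^sup>+y. ennreal ((X x \<omega> - X y \<omega>)\<^sup>2) \<partial>U i \<partial>U i) \<in> borel_measurable ?Q"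
        by (subst measurable_cong[OF in_eq[symmetric]]) auto
    qed
    show ?thesis
      using main2 by (subst nn_integral_sum) (auto simp: nn_integral_cmult main)
  qed
  finally show ?thesis .
qed

section \<open>The one-dimensional grid\<close>

locale grid_density =
  fixes h :: "real \<Rightarrow> real"
  assumes density: "positive_density h"
begin

lemma h_continuous: "continuous_on {0..1} h"
  and h_pos: "x \<in> {0..1} \<Longrightarrow> 0 < h x"
  using density by (auto simp: positive_density_def)

lemma cum_0 [simp]: "cum h 0 = 0" and cum_1 [simp]: "cum h 1 = 1"
  using density by (auto simp: positive_density_def cum_def)

lemma cum_has_derivative:
  assumes "x \<in> {0..1}"
  shows "(cum h has_real_derivative h x) (at x within {0..1})"
  using integral_has_real_derivative[OF h_continuous assms] by (simp add: cum_def[abs_def])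

lemma cum_continuous: "continuous_on {0..1} (cum h)"
  using cum_has_derivative by (rule DERIV_continuous_on)

lemma cum_mvt:
  assumes "0 \<le> a" "a \<le> b" "b \<le> 1"
  obtains \<xi> where "\<xi> \<in> {a..b}" "cum h b - cum h a = h \<xi> * (b - a)"
proof -
  have "(cum h has_derivative (\<lambda>y. h x * y)) (at x within {a..b})" if "x \<in> {a..b}" for x
    using cum_has_derivative[of x] that assms
    by (auto simp: has_field_derivative_def intro: has_derivative_subset)
  then have "\<exists>\<xi>\<in>{a..b}. cum h b - cum h a = (\<lambda>y. h \<xi> * y) (b - a)"
    using assms by (intro mvt_very_simple) auto
  then show ?thesis using that by auto
qed

lemma h_bounds: obtains l u where "0 < l" "l \<le> u" "\<And>x. x \<in> {0..1} \<Longrightarrow> l \<le> h x \<and> h x \<le> u"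
proof -
  obtain x where x: "x \<in> {0..1}" "\<And>y. y \<in> {0..1} \<Longrightarrow> h x \<le> h y"
    using continuous_attains_inf[OF _ _ h_continuous] by auto
  obtain z where z: "z \<in> {0..1}" "\<And>y. y \<in> {0..1} \<Longrightarrow> h y \<le> h z"
    using continuous_attains_sup[OF _ _ h_continuous] by auto
  show ?thesis using that[of "h x" "h z"] x z h_pos by auto
qed

lemma cum_strict_mono:
  assumes "0 \<le> a" "a < b" "b \<le> 1"
  shows "cum h a < cum h b"
proof -
  obtain \<xi> where "\<xi> \<in> {a..b}" "cum h b - cum h a = h \<xi> * (b - a)"
    using cum_mvt[of a b] assms by auto
  moreover from this have "0 < h \<xi> * (b - a)" using assms by (intro mult_pos_pos h_pos) auto
  ultimately show ?thesis by linarith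
qed

lemma cum_less_iff: "a \<in> {0..1} \<Longrightarrow> b \<in> {0..1} \<Longrightarrow> cum h a < cum h b \<longleftrightarrow> a < b"
  using cum_strict_mono[of a b] cum_strict_mono[of b a] by (cases a b rule: linorder_cases) auto

lemma cum_le_iff: "a \<in> {0..1} \<Longrightarrow> b \<in> {0..1} \<Longrightarrow> cum h a \<le> cum h b \<longleftrightarrow> a \<le> b"
  using cum_less_iff[of b a] by linarith

lemma cum_inj: "inj_on (cum h) {0..1}"
  by (intro inj_onI) (metis antisym cum_le_iff order_refl)

lemma cum_range: "x \<in> {0..1} \<Longrightarrow> cum h x \<in> {0..1}"
  using cum_le_iff[of 0 x] cum_le_iff[of x 1] by auto

text \<open>Mean value theorem from 0, with an upper bound of \<open>h\<close> as constant. It is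
  used backwards: a coordinate of \<open>cum_vec h z\<close> bounded below keeps \<open>z\<close>
  away from the origin.\<close>

lemma cum_lipschitz:
  obtains L where "0 < L" "\<And>a. a \<in> {0..1} \<Longrightarrow> cum h a \<le> L * a"
proof -
  obtain l u where lu: "0 < l" "l \<le> u" "\<And>x. x \<in> {0..1} \<Longrightarrow> l \<le> h x \<and> h x \<le> u"
    using h_bounds by blast
  have "cum h a \<le> u * a" if a: "a \<in> {0..1}" for a
  proof -
    obtain \<xi> where \<xi>: "\<xi> \<in> {0..a}" "cum h a - cum h 0 = h \<xi> * (a - 0)"
      using cum_mvt[of 0 a] a by auto
    then have "h \<xi> \<le> u" using lu(3)[of \<xi>] a by auto
    then show ?thesis using \<xi> a by (auto intro: mult_right_mono)
  qed
  then show ?thesis using that[of u] lu by auto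
qed

lemma quant_cum: "x \<in> {0..1} \<Longrightarrow> quant h (cum h x) = x"
  unfolding quant_def using cum_inj by (rule inv_into_f_f)

lemma grid_pt_props:
  assumes "i \<le> n" "0 < n"
  shows "grid_pt h n i \<in> {0..1}" and "cum h (grid_pt h n i) = i / n"
proof -
  have "\<exists>t\<ge>0. t \<le> 1 \<and> cum h t = i / n"
    using assms by (intro IVT') (auto intro: cum_continuous)
  then obtain t where t: "t \<in> {0..1}" "cum h t = i / n" by auto
  have "grid_pt h n i = t"
    unfolding grid_pt_def cum_def[symmetric]
    using t cum_inj by (intro the_equality) (auto simp: inj_on_def)
  with t show "grid_pt h n i \<in> {0..1}" and "cum h (grid_pt h n i) = i / n" by auto
qed

lemma grid_pt_le_iff: "i \<le> n \<Longrightarrow> 0 < n \<Longrightarrow> t \<in> {0..1} \<Longrightarrow> grid_pt h n i \<le> t \<longleftrightarrow> i / n \<le> cum h t"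
  using cum_le_iff[of "grid_pt h n i" t] grid_pt_props[of i n] by simp

lemma le_grid_pt_iff: "i \<le> n \<Longrightarrow> 0 < n \<Longrightarrow> t \<in> {0..1} \<Longrightarrow> t \<le> grid_pt h n i \<longleftrightarrow> cum h t \<le> i / n"
  using cum_le_iff[of t "grid_pt h n i"] grid_pt_props[of i n] by simp

text \<open>The mean value theorem for the increment 1/n of \<open>cum h\<close> over one interval.
  Both the uniform bound on the scaled widths and their limit come from this equation.\<close>

lemma grid_width:
  assumes "i < n"
  obtains \<xi> where "\<xi> \<in> {grid_pt h n i..grid_pt h n (i + 1)}"
    "real n * (grid_pt h n (i + 1) - grid_pt h n i) = 1 / h \<xi>"
proof -
  have i: "i \<le> n" "i + 1 \<le> n" "0 < n" using assms by auto
  note g = grid_pt_props[OF i(1,3)] grid_pt_props[OF i(2,3)]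
  have "grid_pt h n i \<le> grid_pt h n (i + 1)"
    using grid_pt_le_iff[OF i(1,3) g(3)] g(4) i by (simp add: divide_right_mono)
  then obtain \<xi> where \<xi>: "\<xi> \<in> {grid_pt h n i..grid_pt h n (i + 1)}"
    "cum h (grid_pt h n (i + 1)) - cum h (grid_pt h n i) = h \<xi> * (grid_pt h n (i + 1) - grid_pt h n i)"
    using cum_mvt[of "grid_pt h n i" "grid_pt h n (i + 1)"] g by auto
  have "h \<xi> > 0" using h_pos[of \<xi>] \<xi> g by auto
  then have "real n * (grid_pt h n (i + 1) - grid_pt h n i) = 1 / h \<xi>"
    using \<xi>(2) g(2,4) i by (simp add: field_simps)
  with \<xi> that show ?thesis by blast
qed

lemma grid_pt_mono:
  assumes "i < n" shows "grid_pt h n i < grid_pt h n (i + 1)"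
proof -
  have i: "i \<le> n" "i + 1 \<le> n" "0 < n" using assms by auto
  note g = grid_pt_props[OF i(1,3)] grid_pt_props[OF i(2,3)]
  have "cum h (grid_pt h n i) < cum h (grid_pt h n (i + 1))"
    unfolding g using i by (simp add: divide_strict_right_mono)
  then show ?thesis using cum_less_iff g by blast
qed

text \<open>Since \<open>cum h\<close> sends the grid points to the multiples of 1/n, the floor
  finds the half-open interval containing \<open>t\<close>. At \<open>t = 1\<close> the value would
  be \<open>n\<close>, which is no index; hence the restriction to the open interval below.\<close>

definition cell_idx :: "nat \<Rightarrow> real \<Rightarrow> nat" where
  "cell_idx n t = nat \<lfloor>real n * cum h t\<rfloor>"

lemma cell_idx_less: "0 < n \<Longrightarrow> t \<in> {0<..<1} \<Longrightarrow> cell_idx n t < n"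
proof -
  assume n: "0 < n" and t: "t \<in> {0<..<1}"
  then have "cum h t < 1" "0 \<le> cum h t" using cum_less_iff[of t 1] cum_range[of t] by auto
  then have "real n * cum h t < real n" "0 \<le> real n * cum h t" using n by auto
  then show "cell_idx n t < n" unfolding cell_idx_def using n
    by (subst nat_less_iff) (auto simp: floor_less_iff)
qed

lemma cell_idx_eq_iff:
  assumes "t \<in> {0<..<1}" "i < n"
  shows "cell_idx n t = i \<longleftrightarrow> grid_pt h n i \<le> t \<and> t < grid_pt h n (i + 1)"
proof -
  have n: "0 < n" and t: "t \<in> {0..1}" using assms by auto
  have c: "0 \<le> cum h t" using cum_range[OF t] by auto
  have "cell_idx n t = i \<longleftrightarrow> \<lfloor>real n * cum h t\<rfloor> = int i"
    unfolding cell_idx_def using c by (auto simp: nat_eq_iff)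
  also have "\<dots> \<longleftrightarrow> i / n \<le> cum h t \<and> cum h t < (i + 1) / n"
    using n by (simp add: floor_eq_iff field_simps)
  also have "\<dots> \<longleftrightarrow> grid_pt h n i \<le> t \<and> t < grid_pt h n (i + 1)"
    using grid_pt_le_iff[of i n t] le_grid_pt_iff[of "i+1" n t] grid_pt_le_iff[of "i+1" n t] assms t by auto
  finally show ?thesis .
qed

lemma grid_convergence:
  assumes t: "t \<in> {0<..<1}"
  shows "(\<lambda>n. grid_pt h n (cell_idx n t)) \<longlonglongrightarrow> t"
    and "(\<lambda>n. grid_pt h n (cell_idx n t + 1)) \<longlonglongrightarrow> t"
    and "(\<lambda>n. real n * (grid_pt h n (cell_idx n t + 1) - grid_pt h n (cell_idx n t))) \<longlonglongrightarrow> 1 / h t"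
proof -
  let ?a = "\<lambda>n. grid_pt h n (cell_idx n t)" and ?b = "\<lambda>n. grid_pt h n (cell_idx n t + 1)"
  obtain l u where lu: "0 < l" "l \<le> u" "\<And>x. x \<in> {0..1} \<Longrightarrow> l \<le> h x \<and> h x \<le> u"
    using h_bounds by blast
  have t1: "t \<in> {0..1}" using t by auto
  have between: "?a n \<le> t \<and> t \<le> ?b n \<and> ?a n \<in> {0..1} \<and> ?b n \<in> {0..1}" if n: "0 < n" for n
    using cell_idx_eq_iff[OF t cell_idx_less[OF n t]] cell_idx_less[OF n t] n
      grid_pt_props(1)[of "cell_idx n t" n] grid_pt_props(1)[of "cell_idx n t + 1" n] by auto
  have ex: "\<exists>\<xi>\<in>{?a n..?b n}. real n * (?b n - ?a n) = 1 / h \<xi>" if n: "0 < n" for n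
    using grid_width[OF cell_idx_less[OF n t]] by metis
  \<comment> \<open>As \<open>l\<close> is a positive lower bound of \<open>h\<close>, the scaled
    width is at most \<open>1 / l\<close>, and the cell around \<open>t\<close> has length of order
    1/n.\<close>
  have small: "?b n - ?a n \<le> (1 / l) / real n" if n: "0 < n" for n
  proof -
    obtain \<xi> where \<xi>: "\<xi> \<in> {?a n..?b n}" "real n * (?b n - ?a n) = 1 / h \<xi>" using ex[OF n] by blast
    have "\<xi> \<in> {0..1}" using \<xi> between[OF n] by auto
    then have "1 / h \<xi> \<le> 1 / l" using lu by (intro divide_left_mono) (auto simp: h_pos)
    then have "real n * (?b n - ?a n) \<le> 1 / l" unfolding \<xi>(2) .
    then show ?thesis by (subst pos_le_divide_eq) (use n in \<open>auto simp: mult.commute\<close>)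
  qed
  have lim0: "(\<lambda>n. (1 / l) / real n) \<longlonglongrightarrow> 0" by (rule lim_const_over_n)
  have a_bd: "t - (1 / l) / real n \<le> ?a n \<and> ?b n \<le> t + (1 / l) / real n" if n: "0 < n" for n
    using between[OF n] small[OF n] by linarith
  show a: "?a \<longlonglongrightarrow> t"
  proof (rule real_tendsto_sandwich[of "\<lambda>n. t - (1 / l) / real n" _ _ "\<lambda>_. t"])
    show "\<forall>\<^sub>F n in sequentially. t - (1 / l) / real n \<le> ?a n"
      using a_bd by (intro eventually_sequentiallyI[of 1]) auto
    show "\<forall>\<^sub>F n in sequentially. ?a n \<le> t"
      using between by (intro eventually_sequentiallyI[of 1]) auto
    show "(\<lambda>n. t - (1 / l) / real n) \<longlonglongrightarrow> t" using tendsto_diff[OF tendsto_const lim0, of t] by simp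
  qed simp
  show b: "?b \<longlonglongrightarrow> t"
  proof (rule real_tendsto_sandwich[of "\<lambda>_. t" _ _ "\<lambda>n. t + (1 / l) / real n"])
    show "\<forall>\<^sub>F n in sequentially. ?b n \<le> t + (1 / l) / real n"
      using a_bd by (intro eventually_sequentiallyI[of 1]) auto
    show "\<forall>\<^sub>F n in sequentially. t \<le> ?b n"
      using between by (intro eventually_sequentiallyI[of 1]) auto
    show "(\<lambda>n. t + (1 / l) / real n) \<longlonglongrightarrow> t" using tendsto_add[OF tendsto_const lim0, of t] by simp
  qed simp
  \<comment> \<open>The mean value points are squeezed between the ends of the shrinking cell, so
    continuity of \<open>h\<close> at \<open>t\<close> identifies the limit of the scaled
    widths.\<close>
  obtain \<xi> where \<xi>: "\<And>n. 0 < n \<Longrightarrow> \<xi> n \<in> {?a n..?b n} \<and> real n * (?b n - ?a n) = 1 / h (\<xi> n)"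
    using ex by metis
  have \<xi>lim: "\<xi> \<longlonglongrightarrow> t"
    using \<xi> by (intro real_tendsto_sandwich[OF _ _ a b] eventually_sequentiallyI[of 1]) auto
  have "(\<lambda>n. h (\<xi> n)) \<longlonglongrightarrow> h t"
  proof (rule continuous_on_tendsto_compose[OF h_continuous \<xi>lim t1])
    show "\<forall>\<^sub>F n in sequentially. \<xi> n \<in> {0..1}"
    proof (rule eventually_sequentiallyI[of 1])
      fix n :: nat assume "1 \<le> n"
      then have "0 < n" by simp
      from \<xi>[OF this] between[OF this] show "\<xi> n \<in> {0..1}" by auto
    qed
  qed
  then have "(\<lambda>n. 1 / h (\<xi> n)) \<longlonglongrightarrow> 1 / h t"
    using h_pos[OF t1] by (intro tendsto_divide) auto
  then show "(\<lambda>n. real n * (?b n - ?a n)) \<longlonglongrightarrow> 1 / h t"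
    by (rule Lim_transform_eventually) (use \<xi> in \<open>intro eventually_sequentiallyI[of 1], auto\<close>)
qed

end

section \<open>Uniform distributions on the strata\<close>

lemma vec_times_measurable [measurable (raw)]:
  fixes f g :: "'x \<Rightarrow> real ^ 'd"
  assumes "f \<in> borel_measurable N" "g \<in> borel_measurable N"
  shows "(\<lambda>x. f x * g x) \<in> borel_measurable N"
proof -
  have "continuous_on UNIV (\<lambda>z. fst z * snd z :: real ^ 'd)"
    unfolding times_vec_def by (intro continuous_on_vec_lambda continuous_intros)
  then have "(\<lambda>z. fst z * snd z :: real ^ 'd) \<in> borel_measurable borel"
    by (rule borel_measurable_continuous_onI)
  then have "(\<lambda>z. fst z * snd z :: real ^ 'd) \<in> borel_measurable (borel \<Otimes>\<^sub>M borel)"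
    by (simp add: borel_prod)
  from measurable_compose[OF measurable_Pair[OF assms] this] show ?thesis by simp
qed

lemma norm_le_card:
  fixes x :: "real ^ 'd" and b :: real
  assumes "\<And>m. \<bar>x $ m\<bar> \<le> b"
  shows "norm x \<le> CARD('d) * b"
proof -
  have "norm x \<le> (\<Sum>m\<in>UNIV. \<bar>x $ m\<bar>)" by (rule norm_le_l1_cart)
  also have "\<dots> \<le> CARD('d) * b" using assms sum_bounded_above[of UNIV "\<lambda>m. \<bar>x $ m\<bar>" b] by simp
  finally show ?thesis .
qed

text \<open>Differences of points of the cube have coordinates at most 1 in modulus. With scaled
  widths as \<open>D\<close>, this crude diameter bound is the source of the dominating
  constants.\<close>

lemma norm_scaled_diff_bound:
  fixes D u v :: "real ^ 'd"
  assumes "u \<in> unit_cube" "v \<in> unit_cube" and D: "\<And>m. \<bar>D $ m\<bar> \<le> e"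
  shows "norm (D * (u - v)) \<le> real CARD('d) * e"
proof (rule norm_le_card)
  fix m
  have "0 \<le> u $ m" "u $ m \<le> 1" "0 \<le> v $ m" "v $ m \<le> 1" using assms by (auto simp: mem_box_cart)
  then have "\<bar>u $ m - v $ m\<bar> \<le> 1" by (simp add: abs_le_iff)
  then have "\<bar>D $ m\<bar> * \<bar>u $ m - v $ m\<bar> \<le> e * 1"
    using D[of m] by (intro mult_mono) auto
  then show "\<bar>(D * (u - v)) $ m\<bar> \<le> e" by (simp add: abs_mult)
qed

text \<open>Lebesgue measure on the cube, kept as a probability measure on the full Borel algebra:
  integrands are plain Borel functions on the whole space, and the domain is the same for every
  stratum.\<close>

definition cube_measure :: "(real ^ 'd) measure" where
  "cube_measure = density lborel (indicator unit_cube)"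

lemma sets_cube_measure [simp, measurable_cong]: "sets cube_measure = sets borel"
  by (simp add: cube_measure_def)

lemma space_cube_measure [simp]: "space cube_measure = UNIV"
  by (simp add: cube_measure_def)

lemma emeasure_unit_cube [simp]: "emeasure lborel (unit_cube :: (real ^ 'd) set) = 1"
proof -
  have "measure lborel (unit_cube :: (real ^ 'd) set) = 1"
    by (subst content_cbox_cart) (auto simp: cbox_interval interval_eq_empty_cart less_eq_vec_def)
  then show ?thesis
    using emeasure_lborel_cbox_finite[of 0 "1 :: real ^ 'd"]
    by (subst emeasure_eq_ennreal_measure) auto
qed

interpretation cube: prob_space "cube_measure :: (real ^ 'd) measure"
  by (rule prob_spaceI) (simp add: cube_measure_def emeasure_density)

lemma integral_cube_measure:
  fixes f :: "real ^ 'd \<Rightarrow> real"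
  assumes "f \<in> borel_measurable borel"
  shows "(\<integral>x. f x \<partial>cube_measure) = (LINT x:unit_cube|lborel. f x)"
  using assms integral_density[of f lborel "indicator unit_cube"]
  by (simp add: cube_measure_def set_lebesgue_integral_def ennreal_indicator)

lemma integrable_cube_measure:
  fixes f :: "real ^ 'd \<Rightarrow> real"
  assumes "f \<in> borel_measurable borel"
  shows "integrable cube_measure f \<longleftrightarrow> set_integrable lborel unit_cube f"
  using assms integrable_density[of f lborel "indicator unit_cube"]
  by (simp add: cube_measure_def set_integrable_def ennreal_indicator)

lemma AE_cube_measure: "(AE x in cube_measure. P x) \<longleftrightarrow> (AE x in lborel. x \<in> unit_cube \<longrightarrow> P x)"
  unfolding cube_measure_def by (subst AE_density) (auto simp: indicator_def)

lemma AE_cbox_box: "AE x in lborel. x \<in> cbox a b \<longleftrightarrow> x \<in> box a (b :: 'n::euclidean_space)"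
proof -
  have "cbox a b - box a b \<in> null_sets lborel"
    using negligible_frontier_interval[of a b]
    by (simp add: negligible_iff_null_sets null_sets_completion_iff)
  then have "AE x in lborel. x \<notin> cbox a b - box a b" by (rule AE_not_in)
  then show ?thesis by eventually_elim (auto simp: box_subset_cbox[THEN subsetD])
qed

lemma cbox_translate_scale:
  fixes p w :: "real ^ 'd"
  assumes w: "\<And>m. 0 < w $ m"
  shows "p + w * u \<in> cbox p (p + w) \<longleftrightarrow> u \<in> unit_cube"
  using w by (auto simp: mem_box_cart zero_le_mult_iff not_less mult_le_cancel_left1
      dest: less_le_trans intro: less_imp_le)

lemma inner_times_Basis:
  fixes w u :: "real ^ 'd"
  assumes "b \<in> Basis"
  shows "(w * u) \<bullet> b = (w \<bullet> b) * (u \<bullet> b)"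
  using assms by (auto simp: Basis_vec_def inner_axis)

text \<open>An affine map scales Lebesgue measure by its Jacobian \<kappa>, which the normalisation
  cancels. This lets all strata be integrated over one fixed cube.\<close>

lemma uniform_measure_cbox:
  fixes p w :: "real ^ 'd"
  assumes w: "\<And>m. 0 < w $ m"
  shows "uniform_measure lborel (cbox p (p + w)) = distr cube_measure borel (\<lambda>u. p + w * u)"
    and "0 < measure lborel (cbox p (p + w))"
proof -
  let ?D = "cbox p (p + w)" and ?T = "\<lambda>u. p + w * u"
  define \<kappa> where "\<kappa> = (\<Prod>j\<in>Basis. \<bar>w \<bullet> j\<bar>)"
  have wB: "w \<bullet> j > 0" if "j \<in> Basis" for j
    using that w by (auto simp: Basis_vec_def inner_axis)
  then have wB0: "w \<bullet> j \<noteq> 0" if "j \<in> Basis" for j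
    using that by (metis less_irrefl)
  have \<kappa>: "0 < \<kappa>" unfolding \<kappa>_def using wB0 by (intro prod_pos) auto
  \<comment> \<open>The coordinatewise affine map in the basis form that
    \<open>lborel_affine_euclidean\<close> expects.\<close>
  have T: "?T u = p + (\<Sum>j\<in>Basis. ((w \<bullet> j) * (u \<bullet> j)) *\<^sub>R j)" for u
    by (rule euclidean_eqI) (simp add: inner_add_left inner_sum_left_Basis inner_times_Basis)
  have lb: "lborel = density (distr lborel borel ?T) (\<lambda>_. ennreal \<kappa>)"
    unfolding T \<kappa>_def using wB0 by (intro lborel_affine_euclidean) auto
  have Tm[measurable]: "?T \<in> borel_measurable borel"
    unfolding T by measurable
  have main: "emeasure lborel (?D \<inter> A) = ennreal \<kappa> * emeasure lborel (unit_cube \<inter> ?T -` A)"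
    if [measurable]: "A \<in> sets borel" for A
  proof -
    have "emeasure lborel (?D \<inter> A) = ennreal \<kappa> * emeasure lborel (?T -` (?D \<inter> A))"
      by (subst lb) (simp add: emeasure_density nn_integral_cmult emeasure_distr)
    also have "?T -` (?D \<inter> A) = unit_cube \<inter> ?T -` A"
      using cbox_translate_scale[OF w, of p] by auto
    finally show ?thesis .
  qed
  have D: "emeasure lborel ?D = ennreal \<kappa>" using main[of UNIV] by simp
  then show "0 < measure lborel ?D" using \<kappa> by (simp add: measure_def)
  show "uniform_measure lborel ?D = distr cube_measure borel ?T"
  proof (rule measure_eqI)
    fix A assume "A \<in> sets (uniform_measure lborel ?D)"
    then have A[measurable]: "A \<in> sets borel" by simp
    have "emeasure (uniform_measure lborel ?D) A = emeasure lborel (unit_cube \<inter> ?T -` A)"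
      using \<kappa> by (simp add: main D ennreal_mult_divide_eq mult.commute[of "ennreal \<kappa>"])
    also have "\<dots> = emeasure (distr cube_measure borel ?T) A"
      by (simp add: emeasure_distr cube_measure_def emeasure_density measurable_sets_borel[OF Tm A]
          nn_integral_indicator flip: indicator_inter_arith)
    finally show "emeasure (uniform_measure lborel ?D) A = emeasure (distr cube_measure borel ?T) A" .
  qed simp
qed

section \<open>Strata as a partition of the cube up to null sets\<close>

context grid_density
begin

definition corner :: "nat \<Rightarrow> ('d::finite \<Rightarrow> nat) \<Rightarrow> real ^ 'd" where
  "corner n i = (\<chi> m. grid_pt h n (i m))"

definition width :: "nat \<Rightarrow> ('d::finite \<Rightarrow> nat) \<Rightarrow> real ^ 'd" where
  "width n i = (\<chi> m. grid_pt h n (i m + 1) - grid_pt h n (i m))"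

definition cell :: "nat \<Rightarrow> real ^ 'd \<Rightarrow> 'd \<Rightarrow> nat" where
  "cell n t = (\<lambda>m. cell_idx n (t $ m))"

lemma stratum_eq: "stratum h n i = cbox (corner n i) (corner n i + width n i)"
  by (simp add: stratum_def corner_def width_def vec_eq_iff plus_vec_def)

lemma width_pos: "i \<in> strata_idx n \<Longrightarrow> 0 < width n i $ m"
  using grid_pt_mono by (auto simp: width_def strata_idx_def)

lemma finite_strata_idx [simp]: "finite (strata_idx n :: ('d::finite \<Rightarrow> nat) set)"
proof -
  have "strata_idx n = (PiE UNIV (\<lambda>_. {..<n}) :: ('d \<Rightarrow> nat) set)"
    by (auto simp: strata_idx_def PiE_def extensional_def)
  then show ?thesis by (simp add: finite_PiE)
qed

lemma stratum_subset: "i \<in> strata_idx n \<Longrightarrow> stratum h n i \<subseteq> unit_cube"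
proof
  fix t assume i: "i \<in> strata_idx n" and t: "t \<in> stratum h n i"
  have "0 \<le> t $ m \<and> t $ m \<le> 1" for m
  proof -
    have "i m < n" using i by (simp add: strata_idx_def)
    then have "grid_pt h n (i m) \<in> {0..1}" "grid_pt h n (i m + 1) \<in> {0..1}"
      by (auto intro!: grid_pt_props(1) simp del: atLeastAtMost_iff)
    then show ?thesis using t by (auto simp: stratum_def mem_box_cart dest!: spec[of _ m])
  qed
  then show "t \<in> unit_cube" by (simp add: mem_box_cart)
qed

lemma cell_in_strata_idx: "0 < n \<Longrightarrow> t \<in> box 0 1 \<Longrightarrow> cell n t \<in> strata_idx n"
  by (auto simp: cell_def strata_idx_def mem_box_cart intro!: cell_idx_less)

lemma cell_eq_iff:
  assumes "t \<in> box 0 1" "i \<in> strata_idx n"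
  shows "cell n t = i \<longleftrightarrow> (\<forall>m. grid_pt h n (i m) \<le> t $ m \<and> t $ m < grid_pt h n (i m + 1))"
  using assms cell_idx_eq_iff[of "t $ m" "i m" n for m]
  by (auto simp: cell_def strata_idx_def fun_eq_iff mem_box_cart)

lemma in_stratum_cell:
  assumes "t \<in> box 0 1" "0 < n"
  shows "t \<in> stratum h n (cell n t)"
  using cell_eq_iff[OF assms(1) cell_in_strata_idx[OF assms(2,1)]]
  by (auto simp: stratum_def mem_box_cart intro: less_imp_le)

text \<open>The closed strata overlap in their faces. These are finitely many null sets, and off
  them \<open>cell\<close> names the only stratum containing the point.\<close>

lemma AE_stratum_cell:
  assumes n: "0 < n"
  shows "AE t in lborel. \<forall>i\<in>strata_idx n. t \<in> stratum h n i \<longleftrightarrow> t \<in> box 0 1 \<and> cell n t = (i :: 'd::finite \<Rightarrow> nat)"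
proof -
  have "AE t in lborel. t \<in> stratum h n i \<longleftrightarrow> t \<in> box 0 1 \<and> cell n t = i" if i: "i \<in> strata_idx n" for i :: "'d \<Rightarrow> nat"
    using AE_cbox_box[of "\<chi> m. grid_pt h n (i m)" "\<chi> m. grid_pt h n (i m + 1)"]
      AE_cbox_box[of 0 "1 :: real ^ 'd"]
  proof eventually_elim
    case (elim t)
    show ?case
    proof
      assume t: "t \<in> stratum h n i"
      then have "t \<in> box 0 1" using elim(2) stratum_subset[OF i] by auto
      moreover have "t \<in> box (\<chi> m. grid_pt h n (i m)) (\<chi> m. grid_pt h n (i m + 1))"
        using t elim(1) by (simp add: stratum_def)
      ultimately show "t \<in> box 0 1 \<and> cell n t = i"
        by (subst cell_eq_iff[OF _ i]) (auto simp: mem_box_cart intro: less_imp_le)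
    qed (use in_stratum_cell[OF _ n] in auto)
  qed
  then show ?thesis by (intro AE_finite_allI) auto
qed

text \<open>Turns a sum over strata into one integral over a fixed domain, whose integrand depends
  on the stratum through \<open>cell n t\<close>. This is the form to which dominated convergence
  applies.\<close>

lemma sum_strata_integral:
  fixes g :: "('d::finite \<Rightarrow> nat) \<Rightarrow> real ^ 'd \<Rightarrow> real"
  assumes n: "0 < n" and int: "\<And>i. i \<in> strata_idx n \<Longrightarrow> set_integrable lborel (stratum h n i) (g i)"
    and m: "(\<lambda>t. indicator (box 0 1) t *\<^sub>R g (cell n t) t) \<in> borel_measurable lborel"
  shows "(\<Sum>i\<in>strata_idx n. LINT t:stratum h n i|lborel. g i t) = (LINT t:box 0 1|lborel. g (cell n t) t)"
proof -
  have "(\<Sum>i\<in>strata_idx n. LINT t:stratum h n i|lborel. g i t)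
      = (LINT t|lborel. (\<Sum>i\<in>strata_idx n. indicator (stratum h n i) t *\<^sub>R g i t))"
    unfolding set_lebesgue_integral_def using int
    by (intro Bochner_Integration.integral_sum[symmetric]) (auto simp: set_integrable_def)
  also have "\<dots> = (LINT t|lborel. indicator (box 0 1) t *\<^sub>R g (cell n t) t)"
  proof (rule integral_cong_AE)
    show "(\<lambda>t. \<Sum>i\<in>strata_idx n. indicator (stratum h n i) t *\<^sub>R g i t) \<in> borel_measurable lborel"
      using int by (intro borel_measurable_sum) (auto simp: set_integrable_def)
    show "(\<lambda>t. indicator (box 0 1) t *\<^sub>R g (cell n t) t) \<in> borel_measurable lborel"
      by (rule m)
    show "AE t in lborel. (\<Sum>i\<in>strata_idx n. indicator (stratum h n i) t *\<^sub>R g i t)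
        = indicator (box 0 1) t *\<^sub>R g (cell n t) t"
      using AE_stratum_cell[OF n, where 'd = 'd]
    proof eventually_elim
      case (elim t)
      have "(\<Sum>i\<in>strata_idx n. indicator (stratum h n i) t *\<^sub>R g i t)
          = (\<Sum>i\<in>strata_idx n. if i = cell n t then indicator (box 0 1) t *\<^sub>R g (cell n t) t else 0)"
        using elim by (intro sum.cong) (auto simp: indicator_def)
      also have "\<dots> = indicator (box 0 1) t *\<^sub>R g (cell n t) t"
        using cell_in_strata_idx[OF n, of t] by (auto simp: sum.delta indicator_def)
      finally show ?case .
    qed
  qed
  finally show ?thesis by (simp add: set_lebesgue_integral_def)
qed

text \<open>On the open cube \<open>cell n\<close> takes finitely many values, each on the trace of
  a half-open box, so every function of it is simple. Outside, \<open>cell n t\<close> need not be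
  an index, whence the indicator.\<close>

lemma cell_measurable:
  fixes a :: "('d::finite \<Rightarrow> nat) \<Rightarrow> real"
  assumes n: "0 < n"
  shows "(\<lambda>t. indicator (box 0 1) t * a (cell n t)) \<in> borel_measurable borel"
proof -
  let ?S = "\<lambda>i. {t :: real ^ 'd. \<forall>m\<in>UNIV. grid_pt h n (i m) \<le> t $ m \<and> t $ m < grid_pt h n (i m + 1)}"
  have "indicator (box 0 1) t * a (cell n t)
      = (\<Sum>i\<in>strata_idx n. indicator (box 0 1) t * indicator (?S i) t * a i)" for t
  proof (cases "t \<in> box 0 1")
    case True
    have "(\<Sum>i\<in>strata_idx n. indicator (box 0 1) t * indicator (?S i) t * a i)
        = (\<Sum>i\<in>strata_idx n. if i = cell n t then a (cell n t) else 0)"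
      using True cell_eq_iff[OF True, of _ n] by (intro sum.cong) (auto simp: indicator_def)
    then show ?thesis using cell_in_strata_idx[OF n True] True by (simp add: sum.delta)
  qed simp
  moreover have "(\<lambda>t. \<Sum>i\<in>strata_idx n. indicator (box 0 1) t * indicator (?S i) t * a i) \<in> borel_measurable borel"
  proof -
    have [measurable]: "(\<lambda>t :: real ^ 'd. t $ m) \<in> borel_measurable borel" for m
      by (intro borel_measurable_continuous_onI continuous_intros)
    show ?thesis by measurable
  qed
  ultimately show ?thesis by presburger
qed

lemma uniform_stratum:
  assumes "i \<in> strata_idx n"
  shows "uniform_measure lborel (stratum h n i) = distr cube_measure borel (\<lambda>u. corner n i + width n i * u)"
    and "0 < measure lborel (stratum h n i)"
  unfolding stratum_eq by (rule uniform_measure_cbox[OF width_pos[OF assms]])+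

end

section \<open>The exact mean square error\<close>

locale holder_random_field =
  fixes M F :: "'a measure" and X :: "real ^ 'd \<Rightarrow> 'a \<Rightarrow> real" and \<beta> K :: real
  assumes field: "random_field M F X" and holder: "holder_field M X \<beta> K"
    and \<beta>_pos: "0 < \<beta>" and K_pos: "0 < K"
begin

sublocale prob_space M
  using field by (simp add: random_field_def)

text \<open>The values of \<open>X\<close> outside the cube need not even be measurable, hence the extension by zero.\<close>

definition X0 :: "real ^ 'd \<Rightarrow> 'a \<Rightarrow> real" where
  "X0 t \<omega> = indicator unit_cube t * X t \<omega>"

definition variogram :: "real ^ 'd \<Rightarrow> real ^ 'd \<Rightarrow> real" where
  "variogram x y = expectation (\<lambda>\<omega>. (X0 y \<omega> - X0 x \<omega>)\<^sup>2)"

lemma subalg: "subalgebra M F"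
  using field by (simp add: random_field_def)

lemma space_F: "space F = space M"
  using subalg by (simp add: subalgebra_def)

lemma X0_eq: "t \<in> unit_cube \<Longrightarrow> X0 t \<omega> = X t \<omega>"
  by (simp add: X0_def)

lemma X0_measurable: "(\<lambda>(t, \<omega>). X0 t \<omega>) \<in> borel_measurable (borel \<Otimes>\<^sub>M F)"
proof -
  have X: "(\<lambda>(t, \<omega>). X t \<omega>) \<in> borel_measurable (restrict_space borel unit_cube \<Otimes>\<^sub>M F)"
    using field by (simp add: random_field_def)
  \<comment> \<open>Points outside the cube are sent to 0, a point of the cube, so that the
    measurability on the restricted space can be composed with this map; the indicator then discards
    the values obtained there.\<close>
  have r: "(\<lambda>t. if t \<in> unit_cube then t else 0 :: real ^ 'd) \<in> measurable borel (restrict_space borel unit_cube)"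
    by (rule measurable_restrict_space2) (auto simp: mem_box_cart)
  have "(\<lambda>z. (if fst z \<in> unit_cube then fst z else 0 :: real ^ 'd, snd z)) \<in> measurable (borel \<Otimes>\<^sub>M F) (restrict_space borel unit_cube \<Otimes>\<^sub>M F)"
    by (rule measurable_Pair[OF measurable_compose[OF measurable_fst r] measurable_snd])
  from measurable_compose[OF this X]
  have "(\<lambda>z. indicator unit_cube (fst z) * X (if fst z \<in> unit_cube then fst z else 0) (snd z)) \<in> borel_measurable (borel \<Otimes>\<^sub>M F)"
    by simp
  also have "(\<lambda>z. indicator unit_cube (fst z) * X (if fst z \<in> unit_cube then fst z else 0) (snd z)) = (\<lambda>(t, \<omega>). X0 t \<omega>)"
    by (auto simp: X0_def indicator_def fun_eq_iff)
  finally show ?thesis .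
qed

lemma X0_measurable_F [measurable]: "(\<lambda>\<omega>. X0 t \<omega>) \<in> borel_measurable F"
  using measurable_compose[OF measurable_Pair1' X0_measurable, of t] by simp

lemma X0_measurable_M [measurable]: "(\<lambda>\<omega>. X0 t \<omega>) \<in> borel_measurable M"
  using measurable_from_subalg[OF subalg X0_measurable_F] .

lemma X0_measurable_t: "\<omega> \<in> space M \<Longrightarrow> (\<lambda>t. X0 t \<omega>) \<in> borel_measurable borel"
  using measurable_compose[OF measurable_Pair2' X0_measurable, of \<omega>] by (simp add: space_F)

lemma X0_square_integrable: "integrable M (\<lambda>\<omega>. (X0 t \<omega>)\<^sup>2)"
  using field by (cases "t \<in> unit_cube") (auto simp: X0_def random_field_def)

lemma X0_diff_square_integrable: "integrable M (\<lambda>\<omega>. (X0 y \<omega> - X0 x \<omega>)\<^sup>2)"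
proof (rule Bochner_Integration.integrable_bound)
  show "integrable M (\<lambda>\<omega>. 2 * (X0 y \<omega>)\<^sup>2 + 2 * (X0 x \<omega>)\<^sup>2)"
    using X0_square_integrable by auto
  have "(a - b)\<^sup>2 \<le> 2 * a\<^sup>2 + 2 * b\<^sup>2" for a b :: real
    using zero_le_power2[of "a + b"] by (simp add: power2_sum power2_diff)
  then show "AE \<omega> in M. norm ((X0 y \<omega> - X0 x \<omega>)\<^sup>2) \<le> norm (2 * (X0 y \<omega>)\<^sup>2 + 2 * (X0 x \<omega>)\<^sup>2)"
    by auto
qed measurable

lemma variogram_nonneg: "0 \<le> variogram x y"
  by (simp add: variogram_def)

lemma variogram_refl [simp]: "variogram x x = 0"
  by (simp add: variogram_def)

lemma nn_integral_variogram: "(\<integral>\<^sup>+\<omega>. ennreal ((X0 x \<omega> - X0 y \<omega>)\<^sup>2) \<partial>M) = ennreal (variogram x y)"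
  unfolding variogram_def
  using X0_diff_square_integrable[of x y] by (subst nn_integral_eq_integral) (auto simp: power2_commute)

lemma variogram_eq_rms:
  assumes "t \<in> unit_cube" "t + s \<in> unit_cube"
  shows "variogram t (t + s) = (rms M (\<lambda>\<omega>. X (t + s) \<omega> - X t \<omega>))\<^sup>2"
  using assms by (simp add: variogram_def rms_def X0_eq)

lemma variogram_holder:
  assumes "x \<in> unit_cube" "y \<in> unit_cube"
  shows "variogram x y \<le> K * norm (y - x) powr \<beta>"
  using holder[unfolded holder_field_def, rule_format, of x "y - x"] assms
    variogram_eq_rms[of x "y - x"] by simp

lemma norm_unit_cube_le: "t \<in> unit_cube \<Longrightarrow> norm (t :: real ^ 'd) \<le> CARD('d)"
  using norm_le_card[of t 1] by (simp add: mem_box_cart)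

text \<open>The global Hoelder condition compares \<open>X0 t\<close> with the single variable
  \<open>X0 0\<close>, and the cube is bounded. The uniform bound gives almost sure square
  integrability of the paths and boundedness of the variogram.\<close>

lemma X0_second_moment_bounded:
  obtains C where "0 \<le> C" "\<And>t. expectation (\<lambda>\<omega>. (X0 t \<omega>)\<^sup>2) \<le> C"
proof
  let ?C = "2 * (K * real CARD('d) powr \<beta>) + 2 * expectation (\<lambda>\<omega>. (X0 0 \<omega>)\<^sup>2)"
  show C: "0 \<le> ?C" using K_pos by simp
  fix t
  show "expectation (\<lambda>\<omega>. (X0 t \<omega>)\<^sup>2) \<le> ?C"
  proof (cases "t \<in> unit_cube")
    case True
    \<comment> \<open>Equivalent to \<open>(a - 2 * b)\<^sup>2 \<ge> 0\<close>.\<close>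
    have "a\<^sup>2 \<le> 2 * (a - b)\<^sup>2 + 2 * b\<^sup>2" for a b :: real
      using zero_le_power2[of "a - 2 * b"] by (simp add: power2_diff algebra_simps)
    then have "expectation (\<lambda>\<omega>. (X0 t \<omega>)\<^sup>2) \<le> expectation (\<lambda>\<omega>. 2 * (X0 t \<omega> - X0 0 \<omega>)\<^sup>2 + 2 * (X0 0 \<omega>)\<^sup>2)"
      using X0_diff_square_integrable X0_square_integrable by (intro integral_mono) auto
    also have "\<dots> = 2 * variogram 0 t + 2 * expectation (\<lambda>\<omega>. (X0 0 \<omega>)\<^sup>2)"
      using X0_diff_square_integrable X0_square_integrable by (simp add: variogram_def)
    also have "variogram 0 t \<le> K * norm t powr \<beta>"
      using variogram_holder[of 0 t] True by (simp add: mem_box_cart)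
    also have "K * norm t powr \<beta> \<le> K * real CARD('d) powr \<beta>"
      using norm_unit_cube_le[OF True] K_pos \<beta>_pos by (intro mult_left_mono powr_mono2) auto
    finally show ?thesis by simp
  next
    case False
    then show ?thesis using C by (simp add: X0_def)
  qed
qed

lemma variogram_bounded:
  obtains B where "\<And>x y. variogram x y \<le> B"
proof -
  obtain C where C: "0 \<le> C" "\<And>t. expectation (\<lambda>\<omega>. (X0 t \<omega>)\<^sup>2) \<le> C"
    using X0_second_moment_bounded by blast
  have "variogram x y \<le> 4 * C" for x y
  proof -
    have "(a - b)\<^sup>2 \<le> 2 * a\<^sup>2 + 2 * b\<^sup>2" for a b :: real
      using zero_le_power2[of "a + b"] by (simp add: power2_sum power2_diff)
    then have "variogram x y \<le> expectation (\<lambda>\<omega>. 2 * (X0 y \<omega>)\<^sup>2 + 2 * (X0 x \<omega>)\<^sup>2)"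
      unfolding variogram_def
      using X0_diff_square_integrable X0_square_integrable by (intro integral_mono) auto
    also have "\<dots> = 2 * expectation (\<lambda>\<omega>. (X0 y \<omega>)\<^sup>2) + 2 * expectation (\<lambda>\<omega>. (X0 x \<omega>)\<^sup>2)"
      using X0_square_integrable by simp
    also have "\<dots> \<le> 4 * C" using C(2)[of x] C(2)[of y] by simp
    finally show ?thesis .
  qed
  then show ?thesis using that by blast
qed

lemma prob_space_Q: "prob_space (restr_to_subalg M F)"
  by (rule prob_space_restr_to_subalg[OF subalg]) unfold_locales

lemma X0_measurable_Q: "(\<lambda>(t, \<omega>). X0 t \<omega>) \<in> borel_measurable (borel \<Otimes>\<^sub>M restr_to_subalg M F)"
  using X0_measurable
    measurable_cong_sets[OF sets_pair_measure_cong[OF refl sets_restr_to_subalg[OF subalg]] refl] by blast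

text \<open>Joint measurability of the field is given with respect to \<open>F\<close>, so the
  variogram is computed over the restriction of \<open>M\<close> to \<open>F\<close>, where the
  integral has the same value.\<close>

lemma variogram_measurable: "(\<lambda>(x, y). variogram x y) \<in> borel_measurable (borel \<Otimes>\<^sub>M borel)"
proof -
  interpret Q: prob_space "restr_to_subalg M F" by (rule prob_space_Q)
  have "(\<lambda>z. (fst (fst z), snd z)) \<in> measurable ((borel \<Otimes>\<^sub>M borel) \<Otimes>\<^sub>M restr_to_subalg M F) (borel \<Otimes>\<^sub>M restr_to_subalg M F)"
    "(\<lambda>z. (snd (fst z), snd z)) \<in> measurable ((borel \<Otimes>\<^sub>M borel) \<Otimes>\<^sub>M restr_to_subalg M F) (borel \<Otimes>\<^sub>M restr_to_subalg M F)"
    by measurable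
  note [measurable] = measurable_compose[OF this(1) X0_measurable_Q, unfolded case_prod_beta fst_conv snd_conv]
    measurable_compose[OF this(2) X0_measurable_Q, unfolded case_prod_beta fst_conv snd_conv]
  have "(\<lambda>(z, \<omega>). (X0 (snd z) \<omega> - X0 (fst z) \<omega>)\<^sup>2) \<in> borel_measurable ((borel \<Otimes>\<^sub>M borel) \<Otimes>\<^sub>M restr_to_subalg M F)"
    unfolding case_prod_beta by (intro borel_measurable_power borel_measurable_diff) measurable
  from Q.borel_measurable_lebesgue_integral[OF this]
  have "(\<lambda>z. \<integral>\<omega>. (X0 (snd z) \<omega> - X0 (fst z) \<omega>)\<^sup>2 \<partial>restr_to_subalg M F) \<in> borel_measurable (borel \<Otimes>\<^sub>M borel)" .
  moreover have "(\<integral>\<omega>. (X0 y \<omega> - X0 x \<omega>)\<^sup>2 \<partial>restr_to_subalg M F) = variogram x y" for x y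
    unfolding variogram_def by (rule integral_subalgebra2[OF subalg]) measurable
  ultimately show ?thesis by (simp add: case_prod_beta)
qed

text \<open>Tonelli: the mean of the path integral of \<open>(X0 t \<omega>)\<^sup>2\<close> is at
  most the uniform second moment bound, so almost every path integral is finite.\<close>

lemma AE_square_integrable_cube: "AE \<omega> in restr_to_subalg M F. integrable cube_measure (\<lambda>t. (X0 t \<omega>)\<^sup>2)"
proof -
  let ?Q = "restr_to_subalg M F"
  interpret Q: prob_space ?Q by (rule prob_space_Q)
  interpret QC: pair_prob_space "cube_measure :: (real ^ 'd) measure" ?Q ..
  obtain C where C: "0 \<le> C" "\<And>t. expectation (\<lambda>\<omega>. (X0 t \<omega>)\<^sup>2) \<le> C"
    using X0_second_moment_bounded by blast
  have "(\<lambda>(t, \<omega>). X0 t \<omega>) \<in> borel_measurable (cube_measure \<Otimes>\<^sub>M ?Q)"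
    using X0_measurable_Q measurable_cong_sets[OF sets_pair_measure_cong[OF sets_cube_measure refl] refl]
    by blast
  then have m: "(\<lambda>(t, \<omega>). ennreal ((X0 t \<omega>)\<^sup>2)) \<in> borel_measurable (cube_measure \<Otimes>\<^sub>M ?Q)"
    by (simp add: case_prod_beta)
  have eq: "(\<integral>\<^sup>+\<omega>. ennreal ((X0 t \<omega>)\<^sup>2) \<partial>?Q) \<le> ennreal C" for t
  proof -
    have "(\<integral>\<^sup>+\<omega>. ennreal ((X0 t \<omega>)\<^sup>2) \<partial>?Q) = (\<integral>\<^sup>+\<omega>. ennreal ((X0 t \<omega>)\<^sup>2) \<partial>M)"
      by (rule nn_integral_subalgebra2[OF subalg]) measurable
    also have "\<dots> = ennreal (expectation (\<lambda>\<omega>. (X0 t \<omega>)\<^sup>2))"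
      using X0_square_integrable by (intro nn_integral_eq_integral) auto
    finally show ?thesis using C by (simp add: ennreal_leI)
  qed
  have "(\<integral>\<^sup>+\<omega>. \<integral>\<^sup>+t. ennreal ((X0 t \<omega>)\<^sup>2) \<partial>cube_measure \<partial>?Q)
      = (\<integral>\<^sup>+t. \<integral>\<^sup>+\<omega>. ennreal ((X0 t \<omega>)\<^sup>2) \<partial>?Q \<partial>cube_measure)"
    using QC.Fubini[OF m] by simp
  also have "\<dots> \<le> (\<integral>\<^sup>+t. ennreal C \<partial>(cube_measure :: (real ^ 'd) measure))"
    using eq by (intro nn_integral_mono)
  also have "\<dots> < \<infinity>" using cube.emeasure_space_1[where 'd = 'd] by (simp add: less_top[symmetric])
  finally have fin: "(\<integral>\<^sup>+\<omega>. \<integral>\<^sup>+t. ennreal ((X0 t \<omega>)\<^sup>2) \<partial>cube_measure \<partial>?Q) \<noteq> \<infinity>" by simp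
  have m2: "(\<lambda>\<omega>. \<integral>\<^sup>+t. ennreal ((X0 t \<omega>)\<^sup>2) \<partial>cube_measure) \<in> borel_measurable ?Q"
  proof (rule cube.borel_measurable_nn_integral)
    show "(\<lambda>(\<omega>, t). ennreal ((X0 t \<omega>)\<^sup>2)) \<in> borel_measurable (?Q \<Otimes>\<^sub>M cube_measure)"
      using measurable_compose[OF measurable_pair_swap' m] by (simp add: case_prod_beta)
  qed
  have "AE \<omega> in ?Q. (\<integral>\<^sup>+t. ennreal ((X0 t \<omega>)\<^sup>2) \<partial>cube_measure) \<noteq> \<infinity>"
    by (rule nn_integral_PInf_AE[OF m2 fin])
  then show ?thesis
  proof (rule AE_mp, intro AE_I2 impI)
    fix \<omega> assume "\<omega> \<in> space ?Q" and "(\<integral>\<^sup>+t. ennreal ((X0 t \<omega>)\<^sup>2) \<partial>cube_measure) \<noteq> \<infinity>"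
    then show "integrable cube_measure (\<lambda>t. (X0 t \<omega>)\<^sup>2)"
      using X0_measurable_t[of \<omega>] by (intro integrableI_bounded) (auto simp: space_restr_to_subalg less_top)
  qed
qed

text \<open>Combines the conditional variance formula with the fact that each sampling point has the
  law of an affine image of a uniform point of the cube. The squared volume comes from the
  quadrature weights, the factor 1/2 from the variance.\<close>

lemma stratified_error:
  assumes "grid_density h" and n: "0 < n" and sample: "stratified_sample M F h n \<eta>"
  shows "(rms M (\<lambda>\<omega>. field_integral X \<omega> - quadrature h n \<eta> X \<omega>))\<^sup>2
    = (\<Sum>i\<in>strata_idx n. (measure lborel (stratum h n i))\<^sup>2 / 2 *
        (\<integral>u. \<integral>v. variogram (grid_density.corner h n i + grid_density.width h n i * u)
                          (grid_density.corner h n i + grid_density.width h n i * v)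
           \<partial>cube_measure \<partial>cube_measure))"
proof -
  interpret grid_density h by fact
  let ?I = "strata_idx n :: ('d \<Rightarrow> nat) set"
  define vol where "vol i = measure lborel (stratum h n i)" for i :: "'d \<Rightarrow> nat"
  define U where "U i = distr M borel (\<eta> i)" for i
  let ?T = "\<lambda>i u. corner n i + width n i * u"
  have eta: "\<eta> i \<in> measurable M (restrict_space borel (stratum h n i))" and
    eta_distr: "distr M lborel (\<eta> i) = uniform_measure lborel (stratum h n i)" if "i \<in> ?I" for i
    using sample that by (auto simp: stratified_sample_def)
  have eta_m: "\<eta> i \<in> borel_measurable M" and eta_in: "\<omega> \<in> space M \<Longrightarrow> \<eta> i \<omega> \<in> stratum h n i"
    if "i \<in> ?I" for i \<omega>
    using eta[OF that] by (auto simp: measurable_restrict_space2_iff)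
  have eta_X0: "X0 (\<eta> i \<omega>) \<omega> = X (\<eta> i \<omega>) \<omega>" if "i \<in> ?I" "\<omega> \<in> space M" for i \<omega>
    using eta_in[OF that] stratum_subset[OF that(1)] by (intro X0_eq) blast
  have vol_pos: "0 < vol i" if "i \<in> ?I" for i
    unfolding vol_def using uniform_stratum(2)[OF that] .
  have em: "emeasure lborel (stratum h n i) = ennreal (vol i)" for i
    unfolding vol_def stratum_eq using emeasure_lborel_cbox_finite[of "corner n i"]
    by (subst emeasure_eq_ennreal_measure) (auto simp: less_top)
  \<comment> \<open>\<open>lborel\<close> and \<open>borel\<close> have the same sets, so the law
    prescribed for the sample can be read as a law on \<open>borel\<close>.\<close>
  have U1: "U i = uniform_measure lborel (stratum h n i)" if "i \<in> ?I" for i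
    using eta_distr[OF that] distr_cong[OF refl sets_lborel[symmetric] refl, of M "\<eta> i"] by (simp add: U_def)
  have U2: "U i = distr cube_measure borel (?T i)" if "i \<in> ?I" for i
    using U1[OF that] uniform_stratum(1)[OF that] by simp
  have str_b: "stratum h n i \<in> sets borel" for i :: "'d \<Rightarrow> nat" by (simp add: stratum_eq)
  note [measurable] = str_b
  have U3: "U i = density lborel (\<lambda>t. ennreal (indicator (stratum h n i) t / vol i))" if i: "i \<in> ?I" for i
    unfolding U1[OF i] uniform_measure_def em
  proof (rule density_cong)
    show "AE t in lborel. indicator (stratum h n i) t / ennreal (vol i) = ennreal (indicator (stratum h n i) t / vol i)"
      using vol_pos[OF i] by (simp add: divide_ennreal[symmetric] ennreal_indicator)
  qed measurable
  \<comment> \<open>Weight times mean over a stratum is the integral over it, so the weighted means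
    add up to the field integral.\<close>
  have meanU: "vol i * (\<integral>t. f t \<partial>U i) = (LINT t:stratum h n i|lborel. f t)"
    if "i \<in> ?I" "f \<in> borel_measurable borel" for i and f :: "real ^ 'd \<Rightarrow> real"
    using that vol_pos[OF that(1)] unfolding U3[OF that(1)]
    by (subst integral_real_density) (auto simp: set_lebesgue_integral_def)
  have intU: "integrable (U i) f" if "i \<in> ?I" "f \<in> borel_measurable borel" "integrable cube_measure f"
    for i and f :: "real ^ 'd \<Rightarrow> real"
  proof -
    have "set_integrable lborel (stratum h n i) f"
      using that(3) stratum_subset[OF that(1)] unfolding integrable_cube_measure[OF that(2)]
      by (elim set_integrable_subset) simp_all
    then have "integrable lborel (\<lambda>t. inverse (vol i) *\<^sub>R (indicator (stratum h n i) t *\<^sub>R f t))"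
      unfolding set_integrable_def by (rule integrable_scaleR_right)
    then show ?thesis
      unfolding U3[OF that(1)] using that(2) vol_pos[OF that(1)]
      by (subst integrable_real_density) (auto simp: divide_inverse mult_ac)
  qed
  define err where "err \<omega> = (\<Sum>i\<in>?I. vol i * ((\<integral>t. X0 t \<omega> \<partial>U i) - X0 (\<eta> i \<omega>) \<omega>))" for \<omega>
  have sqQ: "AE \<omega> in restr_to_subalg M F. \<forall>i\<in>?I. integrable (U i) (\<lambda>t. (X0 t \<omega>)\<^sup>2)"
    using AE_square_integrable_cube
  proof (rule AE_mp, intro AE_I2 impI ballI)
    fix \<omega> i assume "\<omega> \<in> space (restr_to_subalg M F)" "integrable cube_measure (\<lambda>t. (X0 t \<omega>)\<^sup>2)" "i \<in> ?I"
    then show "integrable (U i) (\<lambda>t. (X0 t \<omega>)\<^sup>2)"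
      using X0_measurable_t[of \<omega>] by (intro intU) (auto simp: space_restr_to_subalg)
  qed
  have field_int: "field_integral X \<omega> = (\<integral>t. X0 t \<omega> \<partial>lborel)" for \<omega>
    by (simp add: field_integral_def set_lebesgue_integral_def X0_def)
  \<comment> \<open>Splitting the integral over the strata uses an integrable path, so the identity
    is shown outside a null set. The measurability facts below are what the passage to expectations
    then requires.\<close>
  have err_eq: "AE \<omega> in M. field_integral X \<omega> - quadrature h n \<eta> X \<omega> = err \<omega>"
    using AE_restr_to_subalg[OF subalg AE_square_integrable_cube]
  proof (rule AE_mp, intro AE_I2 impI)
    fix \<omega> assume \<omega>: "\<omega> \<in> space M" and sq: "integrable cube_measure (\<lambda>t. (X0 t \<omega>)\<^sup>2)"
    have m[measurable]: "(\<lambda>t. X0 t \<omega>) \<in> borel_measurable borel" by (rule X0_measurable_t[OF \<omega>])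
    have int: "integrable cube_measure (\<lambda>t. X0 t \<omega>)"
      by (rule cube.square_integrable_imp_integrable[OF _ sq]) simp
    have si: "set_integrable lborel (stratum h n i) (\<lambda>t. X0 t \<omega>)" if "i \<in> ?I" for i
      using int stratum_subset[OF that] unfolding integrable_cube_measure[OF m]
      by (elim set_integrable_subset) simp_all
    have "(\<Sum>i\<in>?I. vol i * (\<integral>t. X0 t \<omega> \<partial>U i)) = (\<Sum>i\<in>?I. LINT t:stratum h n i|lborel. X0 t \<omega>)"
      by (intro sum.cong meanU m refl)
    also have "\<dots> = (LINT t:box 0 1|lborel. X0 t \<omega>)"
      by (rule sum_strata_integral[OF n si]) simp_all
    also have "\<dots> = (\<integral>t. X0 t \<omega> \<partial>lborel)"
      unfolding set_lebesgue_integral_def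
    proof (rule integral_cong_AE)
      show "AE t in lborel. indicator (box 0 1) t *\<^sub>R X0 t \<omega> = X0 t \<omega>"
        using AE_cbox_box[of 0 "1 :: real ^ 'd"] by eventually_elim (auto simp: X0_def indicator_def)
    qed simp_all
    finally have 1: "(\<Sum>i\<in>?I. vol i * (\<integral>t. X0 t \<omega> \<partial>U i)) = field_integral X \<omega>"
      by (simp add: field_int)
    have 2: "quadrature h n \<eta> X \<omega> = (\<Sum>i\<in>?I. vol i * X0 (\<eta> i \<omega>) \<omega>)"
      unfolding quadrature_def vol_def
      by (intro sum.cong) (auto simp: eta_X0 \<omega>)
    show "field_integral X \<omega> - quadrature h n \<eta> X \<omega> = err \<omega>"
      unfolding err_def 1[symmetric] 2 by (simp add: right_diff_distrib sum_subtractf)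
  qed
  have FM: "f \<in> borel_measurable M" if "f \<in> borel_measurable F" for f :: "'a \<Rightarrow> real"
    using measurable_from_subalg[OF subalg that] .
  have swap: "(\<lambda>(\<omega>, t). X0 t \<omega>) \<in> borel_measurable (F \<Otimes>\<^sub>M borel)"
    using measurable_compose[OF measurable_pair_swap' X0_measurable] by (simp add: case_prod_beta)
  have meas_int: "(\<lambda>\<omega>. \<integral>t. X0 t \<omega> \<partial>N) \<in> borel_measurable M" if "sigma_finite_measure N" "sets N = sets borel" for N
  proof -
    have "(\<lambda>(\<omega>, t). X0 t \<omega>) \<in> borel_measurable (F \<Otimes>\<^sub>M N)"
      using swap measurable_cong_sets[OF sets_pair_measure_cong[OF refl that(2)] refl] by blast
    then show ?thesis by (intro FM sigma_finite_measure.borel_measurable_lebesgue_integral[OF that(1)])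
  qed
  have meas_eta: "(\<lambda>\<omega>. X0 (\<eta> i \<omega>) \<omega>) \<in> borel_measurable M" if "i \<in> ?I" for i
  proof -
    have "(\<lambda>\<omega>. \<omega>) \<in> measurable M F"
      using subalg by (auto simp: subalgebra_def measurable_def)
    then have "(\<lambda>\<omega>. (\<eta> i \<omega>, \<omega>)) \<in> measurable M (borel \<Otimes>\<^sub>M F)"
      using eta_m[OF that] by simp
    from measurable_compose[OF this X0_measurable] show ?thesis by simp
  qed
  have probU: "prob_space (U i)" if "i \<in> ?I" for i
    unfolding U_def by (rule prob_space_distr[OF eta_m[OF that]])
  have err_m: "err \<in> borel_measurable M"
    unfolding err_def[abs_def]
    using meas_eta meas_int[OF prob_space_imp_sigma_finite[OF probU]] by (intro borel_measurable_sum) (simp add: U_def)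
  have quad_m: "(\<lambda>\<omega>. field_integral X \<omega> - quadrature h n \<eta> X \<omega>) \<in> borel_measurable M"
  proof -
    have "quadrature h n \<eta> X \<in> borel_measurable M"
    proof (subst measurable_cong)
      show "quadrature h n \<eta> X \<omega> = (\<Sum>i\<in>?I. X0 (\<eta> i \<omega>) \<omega> * vol i)" if "\<omega> \<in> space M" for \<omega>
        unfolding quadrature_def vol_def
        by (intro sum.cong) (auto simp: eta_X0 that)
    qed (use meas_eta in measurable)
    moreover have "field_integral X \<in> borel_measurable M"
      unfolding field_int[abs_def] by (rule meas_int) (simp_all add: lborel.sigma_finite_measure_axioms)
    ultimately show ?thesis by simp
  qed
  obtain B where B: "\<And>x y. variogram x y \<le> B" using variogram_bounded by blast
  \<comment> \<open>The innermost expectation becomes the variogram, and both copies of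
    \<open>U i\<close> are pulled back to the cube. The bound \<open>B\<close> provides the
    integrability needed to leave \<open>ennreal\<close>.\<close>
  have J: "(\<integral>\<^sup>+x. \<integral>\<^sup>+y. \<integral>\<^sup>+\<omega>. ennreal ((X0 x \<omega> - X0 y \<omega>)\<^sup>2) \<partial>M \<partial>U i \<partial>U i)
      = ennreal (\<integral>u. \<integral>v. variogram (?T i u) (?T i v) \<partial>cube_measure \<partial>cube_measure)" if i: "i \<in> ?I" for i
  proof -
    have Tm[measurable]: "?T i \<in> borel_measurable borel" by measurable
    have vm[measurable]: "(\<lambda>z. variogram (?T i (fst z)) (?T i (snd z))) \<in> borel_measurable (borel \<Otimes>\<^sub>M borel)"
    proof -
      have "(\<lambda>z. (?T i (fst z), ?T i (snd z))) \<in> measurable (borel \<Otimes>\<^sub>M borel) (borel \<Otimes>\<^sub>M borel)"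
        by measurable
      from measurable_compose[OF this variogram_measurable] show ?thesis by simp
    qed
    have vc: "(\<lambda>(u, v). variogram (?T i u) (?T i v)) \<in> borel_measurable (cube_measure \<Otimes>\<^sub>M cube_measure)"
      using vm measurable_cong_sets[OF sets_pair_measure_cong[OF sets_cube_measure sets_cube_measure] refl]
      unfolding case_prod_beta by blast
    have vy: "(\<lambda>y. ennreal (variogram x y)) \<in> borel_measurable borel" for x
      using measurable_compose[OF measurable_Pair1' variogram_measurable, of x] by simp
    have vxe: "(\<lambda>x. \<integral>\<^sup>+v. ennreal (variogram x (?T i v)) \<partial>cube_measure) \<in> borel_measurable borel"
    proof (rule cube.borel_measurable_nn_integral)
      have "(\<lambda>z. (fst z, ?T i (snd z))) \<in> measurable (borel \<Otimes>\<^sub>M borel) (borel \<Otimes>\<^sub>M borel)"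
        by measurable
      from measurable_compose[OF this variogram_measurable]
      have "(\<lambda>z. ennreal (variogram (fst z) (?T i (snd z)))) \<in> borel_measurable (borel \<Otimes>\<^sub>M borel)" by simp
      then show "(\<lambda>(x, v). ennreal (variogram x (?T i v))) \<in> borel_measurable (borel \<Otimes>\<^sub>M cube_measure)"
        using measurable_cong_sets[OF sets_pair_measure_cong[OF refl sets_cube_measure] refl]
        unfolding case_prod_beta by blast
    qed
    have vv: "(\<lambda>v. variogram (?T i u) (?T i v)) \<in> borel_measurable cube_measure" for u
      using measurable_compose[OF Tm measurable_compose[OF measurable_Pair1' variogram_measurable, of "?T i u"]] by simp
    have vi: "integrable cube_measure (\<lambda>v. variogram (?T i u) (?T i v))" for u
      using B variogram_nonneg vv by (intro cube.integrable_const_bound[of _ B]) auto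
    have "(\<integral>\<^sup>+x. \<integral>\<^sup>+y. \<integral>\<^sup>+\<omega>. ennreal ((X0 x \<omega> - X0 y \<omega>)\<^sup>2) \<partial>M \<partial>U i \<partial>U i)
        = (\<integral>\<^sup>+x. \<integral>\<^sup>+y. ennreal (variogram x y) \<partial>U i \<partial>U i)"
      by (simp add: nn_integral_variogram)
    also have "\<dots> = (\<integral>\<^sup>+x. \<integral>\<^sup>+v. ennreal (variogram x (?T i v)) \<partial>cube_measure \<partial>U i)"
      unfolding U2[OF i] by (intro nn_integral_cong nn_integral_distr) (auto simp: vy)
    also have "\<dots> = (\<integral>\<^sup>+u. \<integral>\<^sup>+v. ennreal (variogram (?T i u) (?T i v)) \<partial>cube_measure \<partial>cube_measure)"
      unfolding U2[OF i] by (intro nn_integral_distr) (use vxe in auto)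
    also have "\<dots> = (\<integral>\<^sup>+u. ennreal (\<integral>v. variogram (?T i u) (?T i v) \<partial>cube_measure) \<partial>cube_measure)"
      using vi variogram_nonneg by (intro nn_integral_cong nn_integral_eq_integral) auto
    also have "\<dots> = ennreal (\<integral>u. \<integral>v. variogram (?T i u) (?T i v) \<partial>cube_measure \<partial>cube_measure)"
    proof (rule nn_integral_eq_integral)
      show "integrable cube_measure (\<lambda>u. \<integral>v. variogram (?T i u) (?T i v) \<partial>cube_measure)"
      proof (rule cube.integrable_const_bound[of _ B])
        show "AE u in cube_measure. norm (\<integral>v. variogram (?T i u) (?T i v) \<partial>cube_measure) \<le> B"
        proof (rule AE_I2)
          fix u :: "real ^ 'd"
          have "(\<integral>v. variogram (?T i u) (?T i v) \<partial>cube_measure) \<le> B"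
            using B by (intro cube.integral_le_const[OF vi]) auto
          then show "norm (\<integral>v. variogram (?T i u) (?T i v) \<partial>cube_measure) \<le> B"
            by (simp add: variogram_nonneg)
        qed
        show "(\<lambda>u. \<integral>v. variogram (?T i u) (?T i v) \<partial>cube_measure) \<in> borel_measurable cube_measure"
          by (rule cube.borel_measurable_lebesgue_integral[OF vc])
      qed
    qed (simp add: variogram_nonneg)
    finally show ?thesis .
  qed
  have "(rms M (\<lambda>\<omega>. field_integral X \<omega> - quadrature h n \<eta> X \<omega>))\<^sup>2
      = expectation (\<lambda>\<omega>. (field_integral X \<omega> - quadrature h n \<eta> X \<omega>)\<^sup>2)"
    by (simp add: rms_def)
  also have "\<dots> = expectation (\<lambda>\<omega>. (err \<omega>)\<^sup>2)"
    using err_eq quad_m err_m by (intro integral_cong_AE) auto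
  also have "\<dots> = enn2real (\<integral>\<^sup>+\<omega>. ennreal ((err \<omega>)\<^sup>2) \<partial>M)"
    using err_m by (intro integral_eq_nn_integral) auto
  also have "(\<integral>\<^sup>+\<omega>. ennreal ((err \<omega>)\<^sup>2) \<partial>M) = (\<Sum>i\<in>?I. ennreal ((vol i)\<^sup>2 / 2) *
         (\<integral>\<^sup>+x. \<integral>\<^sup>+y. \<integral>\<^sup>+\<omega>. ennreal ((X0 x \<omega> - X0 y \<omega>)\<^sup>2) \<partial>M \<partial>U i \<partial>U i))"
    unfolding err_def U_def
    using sample sqQ unfolding U_def
    by (intro nn_integral_stratified_error[OF subalg _ X0_measurable]) (auto simp: stratified_sample_def)
  also have "\<dots> = (\<Sum>i\<in>?I. ennreal ((vol i)\<^sup>2 / 2 * (\<integral>u. \<integral>v. variogram (?T i u) (?T i v) \<partial>cube_measure \<partial>cube_measure)))"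
    by (intro sum.cong refl) (simp add: J ennreal_mult'[symmetric])
  also have "enn2real \<dots> = (\<Sum>i\<in>?I. (vol i)\<^sup>2 / 2 * (\<integral>u. \<integral>v. variogram (?T i u) (?T i v) \<partial>cube_measure \<partial>cube_measure))"
  proof -
    have "0 \<le> (vol i)\<^sup>2 / 2 * (\<integral>u. \<integral>v. variogram (?T i u) (?T i v) \<partial>cube_measure \<partial>cube_measure)" for i
      by (intro mult_nonneg_nonneg Bochner_Integration.integral_nonneg variogram_nonneg) auto
    then show ?thesis by (subst sum_ennreal) (auto intro!: enn2real_ennreal sum_nonneg simp del: times_divide_eq_left)
  qed
  finally show ?thesis unfolding vol_def .
qed

end

section \<open>Domination and pointwise convergence\<close>

text \<open>The constant comes from \<open>(i + 1)\<^sup>2 \<le> 3 i\<^sup>2 + 1\<close> and \<open>1 \<le> \<Sum>i\<^sup>2\<close>; it is the reason for the range of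
  the shifting condition.\<close>

lemma norm_ratio_grid_cell:
  fixes s v :: "real ^ 'd" and i :: "'d \<Rightarrow> nat" and n :: nat
  assumes n: "0 < n" and i: "i \<noteq> (\<lambda>_. 0)"
    and s: "\<And>m. real (i m) / n \<le> s $ m" "\<And>m. s $ m \<le> (real (i m) + 1) / n"
    and v: "\<And>m. real (i m) / n \<le> v $ m" "\<And>m. v $ m \<le> (real (i m) + 1) / n"
  shows "norm s \<le> sqrt (3 + real CARD('d)) * norm v"
proof -
  obtain k where k: "i k \<noteq> 0" using i by auto
  have "1 \<le> (real (i k))\<^sup>2" using k by simp
  also have "\<dots> \<le> (\<Sum>m\<in>UNIV. (real (i m))\<^sup>2)" by (intro member_le_sum) auto
  finally have ge1: "1 \<le> (\<Sum>m\<in>UNIV. (real (i m))\<^sup>2)" .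
  have sq: "(real (i m) + 1)\<^sup>2 \<le> 3 * (real (i m))\<^sup>2 + 1" for m
  proof -
    have "real (i m) \<le> (real (i m))\<^sup>2"
      by (cases "i m") (auto simp: power2_eq_square field_simps)
    then show ?thesis by (simp add: power2_sum)
  qed
  have s0: "0 \<le> s $ m" for m by (rule order_trans[OF _ s(1)]) simp
  have "(norm s)\<^sup>2 = (\<Sum>m\<in>UNIV. (s $ m)\<^sup>2)"
    by (simp add: norm_vec_def L2_set_def sum_nonneg)
  also have "\<dots> \<le> (\<Sum>m\<in>UNIV. (real (i m) + 1)\<^sup>2 / (real n)\<^sup>2)"
    using power_mono[OF s(2) s0, of _ 2] by (intro sum_mono) (simp add: power_divide)
  also have "\<dots> = (\<Sum>m\<in>UNIV. (real (i m) + 1)\<^sup>2) / (real n)\<^sup>2" by (simp add: sum_divide_distrib)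
  also have "\<dots> \<le> ((3 + real CARD('d)) * (\<Sum>m\<in>UNIV. (real (i m))\<^sup>2)) / (real n)\<^sup>2"
  proof (intro divide_right_mono)
    have "(\<Sum>m\<in>UNIV. (real (i m) + 1)\<^sup>2) \<le> (\<Sum>m\<in>UNIV. 3 * (real (i m))\<^sup>2 + 1)"
      by (intro sum_mono sq)
    also have "\<dots> = 3 * (\<Sum>m\<in>UNIV. (real (i m))\<^sup>2) + real CARD('d)"
      by (simp add: sum.distrib sum_distrib_left)
    also have "\<dots> \<le> (3 + real CARD('d)) * (\<Sum>m\<in>UNIV. (real (i m))\<^sup>2)"
      using mult_left_mono[OF ge1, of "real CARD('d)"] by (simp add: algebra_simps)
    finally show "(\<Sum>m\<in>UNIV. (real (i m) + 1)\<^sup>2) \<le> (3 + real CARD('d)) * (\<Sum>m\<in>UNIV. (real (i m))\<^sup>2)" .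
  qed simp
  also have "\<dots> = (3 + real CARD('d)) * (\<Sum>m\<in>UNIV. (real (i m) / n)\<^sup>2)"
    by (simp add: sum_divide_distrib[symmetric] power_divide)
  also have "\<dots> \<le> (3 + real CARD('d)) * (\<Sum>m\<in>UNIV. (v $ m)\<^sup>2)"
    by (intro mult_left_mono sum_mono power_mono v) auto
  also have "\<dots> = (3 + real CARD('d)) * (norm v)\<^sup>2"
    by (simp add: norm_vec_def L2_set_def sum_nonneg)
  finally have "sqrt ((norm s)\<^sup>2) \<le> sqrt ((3 + real CARD('d)) * (norm v)\<^sup>2)"
    by (rule real_sqrt_le_mono)
  then show ?thesis by (simp add: real_sqrt_mult)
qed

section \<open>Strata in the coordinates of the distribution function, their size and their
  limits\<close>

context grid_density
begin

lemma cum_vec_unit_cube: "t \<in> unit_cube \<Longrightarrow> cum_vec h t \<in> unit_cube"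
  using cum_range by (auto simp: mem_box_cart cum_vec_def)

lemma quant_vec_cum_vec: "t \<in> unit_cube \<Longrightarrow> quant_vec h (cum_vec h t) = t"
  using quant_cum by (auto simp: mem_box_cart cum_vec_def quant_vec_def vec_eq_iff)

text \<open>In the coordinates of \<open>cum_vec h\<close> the strata are cells of the regular grid
  of mesh 1/n, whatever the density; this is the setting of
  \<open>norm_ratio_grid_cell\<close>.\<close>

lemma cum_vec_stratum:
  assumes n: "0 < n" and i: "i \<in> strata_idx n" and t: "t \<in> stratum h n i"
  shows "real (i m) / n \<le> cum_vec h t $ m" "cum_vec h t $ m \<le> (real (i m) + 1) / n"
proof -
  have tm: "t $ m \<in> {0..1}" using stratum_subset[OF i] t by (auto simp: mem_box_cart subset_iff)
  have im: "i m \<le> n" "i m + 1 \<le> n" using i by (auto simp: strata_idx_def Suc_le_eq intro: less_imp_le)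
  have "grid_pt h n (i m) \<le> t $ m" "t $ m \<le> grid_pt h n (i m + 1)"
    using t by (auto simp: stratum_def mem_box_cart)
  then show "real (i m) / n \<le> cum_vec h t $ m" "cum_vec h t $ m \<le> (real (i m) + 1) / n"
    using grid_pt_le_iff[OF im(1) n tm] le_grid_pt_iff[OF im(2) n tm] by (simp_all add: cum_vec_def add.commute)
qed

lemma cum_vec_stratum_nonzero:
  assumes "0 < n" "i \<in> strata_idx n" "t \<in> stratum h n i" "i \<noteq> (\<lambda>_. 0)"
  shows "cum_vec h t \<noteq> 0"
proof -
  obtain k where "i k \<noteq> 0" using assms(4) by auto
  then have "0 < real (i k) / n" using assms(1) by simp
  also have "\<dots> \<le> cum_vec h t $ k" by (rule cum_vec_stratum[OF assms(1-3)])
  finally show ?thesis by (metis less_irrefl zero_index)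
qed

text \<open>A nonzero index makes some coordinate of \<open>cum_vec h t\<close> positive, while
  \<open>cum_vec h 0\<close> is 0. Thus every stratum but the first is a hyperrectangle on which the
  local conditions are available.\<close>

lemma stratum_avoids_zero:
  assumes "0 < n" "i \<in> strata_idx n" "i \<noteq> (\<lambda>_. 0)"
  shows "stratum h n i \<subseteq> unit_cube - {0}"
  using stratum_subset[OF assms(2)] cum_vec_stratum_nonzero[OF assms(1,2) _ assms(3), of 0]
  by (auto simp: cum_vec_def vec_eq_iff)

lemma corner_scale_in_stratum:
  assumes "i \<in> strata_idx n" "u \<in> unit_cube"
  shows "corner n i + width n i * u \<in> stratum h n i"
  unfolding stratum_eq using assms cbox_translate_scale[OF width_pos[OF assms(1)]] by blast

lemma width_upper_bound:
  obtains b where "0 < b" "\<And>n (i :: 'd::finite \<Rightarrow> nat) m. i \<in> strata_idx n \<Longrightarrow> real n * width n i $ m \<le> b"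
proof -
  obtain l u where lu: "0 < l" "l \<le> u" "\<And>x. x \<in> {0..1} \<Longrightarrow> l \<le> h x \<and> h x \<le> u"
    using h_bounds by blast
  have "real n * width n i $ m \<le> 1 / l" if "i \<in> strata_idx n" for n m and i :: "'d \<Rightarrow> nat"
  proof -
    have im: "i m < n" using that by (simp add: strata_idx_def)
    then obtain \<xi> where \<xi>: "\<xi> \<in> {grid_pt h n (i m)..grid_pt h n (i m + 1)}"
      "real n * (grid_pt h n (i m + 1) - grid_pt h n (i m)) = 1 / h \<xi>"
      using grid_width by blast
    have "\<xi> \<in> {0..1}"
      using \<xi>(1) grid_pt_props(1)[of "i m" n] grid_pt_props(1)[of "i m + 1" n] im by auto
    then have "1 / h \<xi> \<le> 1 / l" using lu h_pos by (intro divide_left_mono) auto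
    then show ?thesis using \<xi>(2) by (simp add: width_def)
  qed
  then show ?thesis using that[of "1 / l"] lu by auto
qed

lemma volume_stratum: "i \<in> strata_idx n \<Longrightarrow> measure lborel (stratum h n i) = (\<Prod>m\<in>UNIV. width n i $ m)"
  unfolding stratum_eq using width_pos[of i n]
  by (subst content_cbox_cart) (auto simp: interval_ne_empty_cart intro: less_imp_le)

text \<open>Coordinatewise consequences of \<open>grid_convergence\<close>. The third limit is the
  vector D_1(t) of the claim, the fourth is the product of its coordinates.\<close>

lemma cell_convergence:
  assumes t: "t \<in> box 0 (1 :: real ^ 'd)"
  shows "(\<lambda>n. corner n (cell n t)) \<longlonglongrightarrow> t"
    and "(\<lambda>n. width n (cell n t)) \<longlonglongrightarrow> 0"
    and "(\<lambda>n. real n *\<^sub>R width n (cell n t)) \<longlonglongrightarrow> (\<chi> m. 1 / h (t $ m))"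
    and "(\<lambda>n. real n ^ CARD('d) * measure lborel (stratum h n (cell n t))) \<longlonglongrightarrow> (\<Prod>m\<in>UNIV. inverse (h (t $ m)))"
proof -
  have tm: "t $ m \<in> {0<..<1}" for m using t by (simp add: mem_box_cart)
  note lim = grid_convergence[OF tm]
  show "(\<lambda>n. corner n (cell n t)) \<longlonglongrightarrow> t"
    by (rule vec_tendstoI) (simp add: corner_def cell_def lim)
  show "(\<lambda>n. width n (cell n t)) \<longlonglongrightarrow> 0"
  proof (rule vec_tendstoI)
    fix m
    show "(\<lambda>n. width n (cell n t) $ m) \<longlonglongrightarrow> 0 $ m"
      using tendsto_diff[OF grid_convergence(2)[OF tm[of m]] grid_convergence(1)[OF tm[of m]]]
      by (simp add: width_def cell_def)
  qed
  show w: "(\<lambda>n. real n *\<^sub>R width n (cell n t)) \<longlonglongrightarrow> (\<chi> m. 1 / h (t $ m))"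
    by (rule vec_tendstoI) (use lim(3) in \<open>simp add: width_def cell_def\<close>)
  have "(\<lambda>n. \<Prod>m\<in>UNIV. real n * width n (cell n t) $ m) \<longlonglongrightarrow> (\<Prod>m\<in>UNIV. inverse (h (t $ m)))"
    by (intro tendsto_prod) (use lim(3) in \<open>simp add: width_def cell_def inverse_eq_divide\<close>)
  then show "(\<lambda>n. real n ^ CARD('d) * measure lborel (stratum h n (cell n t))) \<longlonglongrightarrow> (\<Prod>m\<in>UNIV. inverse (h (t $ m)))"
  proof (rule Lim_transform_eventually)
    show "\<forall>\<^sub>F n in sequentially. (\<Prod>m\<in>UNIV. real n * width n (cell n t) $ m)
        = real n ^ CARD('d) * measure lborel (stratum h n (cell n t))"
      using cell_in_strata_idx[OF _ t]
      by (intro eventually_sequentiallyI[of 1]) (simp add: volume_stratum prod.distrib)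
  qed
qed

end

text \<open>After the exact error formula only the variogram matters, so the asymptotics are proved
  for an abstract two-point function \<gamma>, without probability. The intermediate point of the
  local Hoelder condition is merely asked to lie in the same hyperrectangle.\<close>

locale variogram_asymptotics = grid_density h for h +
  fixes \<gamma> :: "real ^ 'd \<Rightarrow> real ^ 'd \<Rightarrow> real" and c V R :: "real ^ 'd \<Rightarrow> real" and \<alpha> \<beta> K B :: real
  assumes \<beta>_pos: "0 < \<beta>" and \<beta>_less: "\<beta> < \<alpha>" and \<alpha>_less: "\<alpha> - real CARD('d) < \<beta>"
    and \<gamma>_measurable: "(\<lambda>(x, y). \<gamma> x y) \<in> borel_measurable (borel \<Otimes>\<^sub>M borel)"
    and \<gamma>_nonneg: "0 \<le> \<gamma> x y" and \<gamma>_bounded: "\<gamma> x y \<le> B" and \<gamma>_refl: "\<gamma> x x = 0"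
    and \<gamma>_holder: "x \<in> unit_cube \<Longrightarrow> y \<in> unit_cube \<Longrightarrow> \<gamma> x y \<le> K * norm (y - x) powr \<beta>"
    and \<gamma>_local_holder: "cbox a b \<subseteq> unit_cube - {0} \<Longrightarrow> x \<in> cbox a b \<Longrightarrow> y \<in> cbox a b
      \<Longrightarrow> \<exists>z\<in>cbox a b. \<gamma> x y \<le> V z * norm (y - x) powr \<alpha>"
    and \<gamma>_stationary: "cbox a b \<subseteq> unit_cube - {0} \<Longrightarrow> 0 < \<epsilon> \<Longrightarrow>
      \<exists>\<delta>>0. \<forall>x\<in>cbox a b. \<forall>y\<in>cbox a b. 0 < norm (y - x) \<longrightarrow> norm (y - x) < \<delta>
        \<longrightarrow> \<bar>\<gamma> x y / (c x * norm (y - x) powr \<alpha>) - 1\<bar> < \<epsilon>"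
    and c_continuous: "continuous_on (unit_cube - {0}) c"
    and c_pos: "t \<in> unit_cube - {0} \<Longrightarrow> 0 < c t"
    and V_continuous: "continuous_on (unit_cube - {0}) V"
    and V_le_R: "t \<in> unit_cube - {0} \<Longrightarrow> V (quant_vec h t) \<le> R t"
    and shifting: "shifting_condition R (1 / sqrt (3 + real CARD('d))) (sqrt (3 + real CARD('d)))"
    and R_integrable: "(\<lambda>t. R (cum_vec h t)) absolutely_integrable_on unit_cube"
begin

lemma K_nonneg: "0 \<le> K"
proof -
  have "0 \<le> \<gamma> 0 1" by (rule \<gamma>_nonneg)
  also have "\<dots> \<le> K * norm (1 :: real ^ 'd) powr \<beta>"
    using \<gamma>_holder[of 0 1] by (simp add: mem_box_cart)
  finally show ?thesis by (simp add: zero_le_mult_iff)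
qed

lemma R_pos: "t \<in> unit_cube - {0} \<Longrightarrow> 0 < R t"
  using shifting by (auto simp: shifting_condition_def)

text \<open>Near the origin the shifting condition carries the value of \<open>R\<close> from the
  image of \<open>z\<close> to that of \<open>t\<close>; away from it \<open>V\<close> is bounded on
  a compact set. The sum of both bounds covers the two cases at once.\<close>

lemma V_dominated:
  obtains n\<^sub>0 C b where "0 < n\<^sub>0" "0 \<le> C" "0 \<le> b"
    "\<And>n i t z. n\<^sub>0 \<le> n \<Longrightarrow> i \<in> strata_idx n \<Longrightarrow> i \<noteq> (\<lambda>_. 0) \<Longrightarrow> t \<in> stratum h n i \<Longrightarrow> z \<in> stratum h n i
      \<Longrightarrow> V z \<le> C * R (cum_vec h t) + b"
proof -
  let ?q = "sqrt (3 + real CARD('d))"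
  obtain C a where C: "0 < C" and a: "0 < a" and shift:
    "\<And>s v. s \<in> cbox 0 (\<chi> m. a) - {0} \<Longrightarrow> v \<in> cbox 0 (\<chi> m. a) - {0} \<Longrightarrow> 1 / ?q \<le> norm s / norm v
      \<Longrightarrow> norm s / norm v \<le> ?q \<Longrightarrow> R s \<le> C * R v"
    using shifting unfolding shifting_condition_def by blast
  obtain L where L: "0 < L" "\<And>x. x \<in> {0..1} \<Longrightarrow> cum h x \<le> L * x" using cum_lipschitz by blast
  \<comment> \<open>If a coordinate of \<open>cum_vec h z\<close> is at least \<open>a / 2\<close>,
    then \<open>cum h x \<le> L * x\<close> makes that coordinate of \<open>z\<close> at least this
    \<open>r\<close>.\<close>
  define r where "r = a / (2 * L)"
  have r: "0 < r" using a L by (simp add: r_def)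
  let ?S = "{z \<in> unit_cube. r \<le> norm z} :: (real ^ 'd) set"
  have "compact ?S"
  proof -
    have "?S = unit_cube \<inter> {z. r \<le> norm z}" by auto
    moreover have "closed {z :: real ^ 'd. r \<le> norm z}" by (intro closed_Collect_le continuous_intros)
    ultimately show ?thesis by (simp add: compact_Int_closed)
  qed
  moreover have "continuous_on ?S V"
    by (rule continuous_on_subset[OF V_continuous]) (use r in auto)
  ultimately have "bounded (V ` ?S)"
    by (intro compact_imp_bounded compact_continuous_image)
  then obtain b where b: "0 < b" "\<And>z. z \<in> ?S \<Longrightarrow> \<bar>V z\<bar> \<le> b"
    unfolding bounded_pos by auto
  obtain n\<^sub>0 :: nat where n0: "2 / a < real n\<^sub>0" using reals_Archimedean2 by blast
  have n0_pos: "0 < n\<^sub>0" using n0 a by (metis divide_pos_pos gr0I less_trans of_nat_0 less_irrefl zero_less_numeral)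
  have main: "V z \<le> C * R (cum_vec h t) + b"
    if n: "n\<^sub>0 \<le> n" and i: "i \<in> strata_idx n" "i \<noteq> (\<lambda>_. 0)" and t: "t \<in> stratum h n i" and z: "z \<in> stratum h n i"
    for n i t z
  proof -
    have npos: "0 < n" using n0_pos n by simp
    have "2 / a < real n" using n0 n by linarith
    \<comment> \<open>The choice of \<open>n\<^sub>0\<close> makes the mesh at most
      \<open>a / 2\<close>: if the image of \<open>t\<close> leaves the cube of side
      \<open>a\<close>, that of \<open>z\<close> still has the same coordinate at least
      \<open>a / 2\<close>.\<close>
    then have na: "1 / n \<le> a / 2" using a npos by (simp add: field_simps)
    let ?s = "cum_vec h z" and ?v = "cum_vec h t"
    note sb = cum_vec_stratum[OF npos i(1) z] and vb = cum_vec_stratum[OF npos i(1) t]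
    have tz: "t \<in> unit_cube" "z \<in> unit_cube" using t z stratum_subset[OF i(1)] by auto
    have sv: "?s \<in> unit_cube - {0}" "?v \<in> unit_cube - {0}"
      using cum_vec_stratum_nonzero[OF npos i(1) z i(2)] cum_vec_stratum_nonzero[OF npos i(1) t i(2)]
        cum_vec_unit_cube tz by auto
    have Rv: "0 < R ?v" by (rule R_pos[OF sv(2)])
    show ?thesis
    proof (cases "?s \<in> cbox 0 (\<chi> m. a) \<and> ?v \<in> cbox 0 (\<chi> m. a)")
      case True
      have nz: "0 < norm ?s" "0 < norm ?v" using sv by auto
      have "R ?s \<le> C * R ?v"
      \<comment> \<open>The grid cell estimate is used in both directions, with the images of
        \<open>z\<close> and \<open>t\<close> exchanged.\<close>
      proof (rule shift)
        show "1 / ?q \<le> norm ?s / norm ?v"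
          using norm_ratio_grid_cell[OF npos i(2) vb sb] nz by (simp add: field_simps)
        show "norm ?s / norm ?v \<le> ?q"
          using norm_ratio_grid_cell[OF npos i(2) sb vb] nz by (simp add: field_simps)
      qed (use True sv in auto)
      moreover have "V z \<le> R ?s" using V_le_R[OF sv(1)] quant_vec_cum_vec[OF tz(2)] by simp
      ultimately show ?thesis using b by linarith
    next
      case False
      have "\<exists>m. a < ?s $ m \<or> a < ?v $ m"
      proof (rule ccontr)
        assume "\<not> (\<exists>m. a < ?s $ m \<or> a < ?v $ m)"
        then have "?s $ m \<le> a \<and> ?v $ m \<le> a" for m by (auto simp: not_less)
        then show "False" using False sv by (simp add: mem_box_cart)
      qed
      then obtain m where "a < ?s $ m \<or> a < ?v $ m" by blast
      moreover have "?v $ m \<le> ?s $ m + 1 / n"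
        using sb(1)[of m] vb(2)[of m] by (simp add: add_divide_distrib)
      ultimately have "a / 2 \<le> ?s $ m" using na a by linarith
      also have "?s $ m \<le> L * z $ m" using L(2)[of "z $ m"] tz by (simp add: cum_vec_def mem_box_cart)
      finally have "r \<le> z $ m" using L(1) by (simp add: r_def field_simps)
      also have "\<dots> \<le> norm z" using component_le_norm_cart[of z m] by linarith
      finally have "\<bar>V z\<bar> \<le> b" using b(2)[of z] tz by simp
      moreover have "0 \<le> C * R ?v" using C Rv by simp
      ultimately show ?thesis by linarith
    qed
  qed
  show ?thesis using that[of n\<^sub>0 C b] main n0_pos C b(1) by (simp add: less_imp_le)
qed

text \<open>The constants serve all \<open>n\<close>, \<open>i\<close>, \<open>u\<close>,
  \<open>v\<close> at once, and \<open>t\<close> is any point of the stratum. With \<open>t\<close>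
  as integration variable the right-hand side is an integrable majorant; with \<open>t\<close> fixed
  it is a constant bound in \<open>u\<close> and \<open>v\<close>.\<close>

definition variogram_dominated :: "nat \<Rightarrow> real \<Rightarrow> real \<Rightarrow> bool" where
  "variogram_dominated n\<^sub>0 C b \<longleftrightarrow> 0 < n\<^sub>0 \<and> 0 \<le> C \<and> 0 \<le> b \<and>
    (\<forall>n i t u v. n\<^sub>0 \<le> n \<longrightarrow> i \<in> strata_idx n \<longrightarrow> i \<noteq> (\<lambda>_. 0) \<longrightarrow> t \<in> stratum h n i
      \<longrightarrow> u \<in> unit_cube \<longrightarrow> v \<in> unit_cube
      \<longrightarrow> real n powr \<alpha> * \<gamma> (corner n i + width n i * u) (corner n i + width n i * v)
          \<le> C * R (cum_vec h t) + b)"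

lemma variogram_dominated_ex: obtains n\<^sub>0 C b where "variogram_dominated n\<^sub>0 C b"
proof -
  obtain n\<^sub>0 C b where 0: "0 < n\<^sub>0" "0 \<le> C" "0 \<le> b" and dom:
    "\<And>n i t z. n\<^sub>0 \<le> n \<Longrightarrow> i \<in> strata_idx n \<Longrightarrow> i \<noteq> (\<lambda>_. 0) \<Longrightarrow> t \<in> stratum h n i \<Longrightarrow> z \<in> stratum h n i
      \<Longrightarrow> V z \<le> C * R (cum_vec h t) + b"
    using V_dominated by blast
  obtain e where e: "0 < e" "\<And>n (i :: 'd \<Rightarrow> nat) m. i \<in> strata_idx n \<Longrightarrow> real n * width n i $ m \<le> e"
    using width_upper_bound by blast
  let ?k = "(real CARD('d) * e) powr \<alpha>"
  have main: "real n powr \<alpha> * \<gamma> (corner n i + width n i * u) (corner n i + width n i * v)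
          \<le> ?k * C * R (cum_vec h t) + ?k * b"
    if n: "n\<^sub>0 \<le> n" and i: "i \<in> strata_idx n" "i \<noteq> (\<lambda>_. 0)" and t: "t \<in> stratum h n i"
      and uv: "u \<in> unit_cube" "v \<in> unit_cube"
    for n i t u v
  proof -
    let ?x = "corner n i + width n i * u" and ?y = "corner n i + width n i * v"
    have npos: "0 < n" using 0(1) n by simp
    have xy: "?x \<in> stratum h n i" "?y \<in> stratum h n i" using corner_scale_in_stratum[OF i(1)] uv by auto
    obtain z where z: "z \<in> stratum h n i" "\<gamma> ?x ?y \<le> V z * norm (?y - ?x) powr \<alpha>"
      using \<gamma>_local_holder[of "corner n i" "corner n i + width n i" ?x ?y] xy
        stratum_avoids_zero[OF npos i] unfolding stratum_eq by blast
    have Vz: "V z \<le> C * R (cum_vec h t) + b" by (rule dom[OF n i t z(1)])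
    have t': "cum_vec h t \<in> unit_cube - {0}"
      using cum_vec_stratum_nonzero[OF npos i(1) t i(2)] cum_vec_unit_cube stratum_subset[OF i(1)] t by auto
    have dnn: "0 \<le> C * R (cum_vec h t) + b" using R_pos[OF t'] 0 by simp
    have nrm: "norm (real n *\<^sub>R (?y - ?x)) \<le> real CARD('d) * e"
    proof -
      have "norm ((real n *\<^sub>R width n i) * (v - u)) \<le> real CARD('d) * e"
      proof (rule norm_scaled_diff_bound[OF uv(2,1)])
        show "\<bar>(real n *\<^sub>R width n i) $ m\<bar> \<le> e" for m
          using e(2)[OF i(1), of m] width_pos[OF i(1), of m] by (simp add: abs_mult)
      qed
      also have "(real n *\<^sub>R width n i) * (v - u) = real n *\<^sub>R (?y - ?x)"
        by (simp add: vec_eq_iff algebra_simps)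
      finally show ?thesis .
    qed
    have "real n powr \<alpha> * \<gamma> ?x ?y \<le> real n powr \<alpha> * (V z * norm (?y - ?x) powr \<alpha>)"
      using z(2) by (intro mult_left_mono) auto
    \<comment> \<open>The factor \<open>n powr \<alpha>\<close> is absorbed into the norm: the
      scaled difference stays bounded because \<open>n\<close> times the widths does.\<close>
    also have "\<dots> = V z * norm (real n *\<^sub>R (?y - ?x)) powr \<alpha>"
      by (simp add: powr_mult)
    also have "\<dots> \<le> (C * R (cum_vec h t) + b) * ?k"
      using Vz dnn nrm \<beta>_pos \<beta>_less by (intro mult_mono powr_mono2) auto
    finally show ?thesis by (simp add: algebra_simps)
  qed
  have "variogram_dominated n\<^sub>0 (?k * C) (?k * b)"
    unfolding variogram_dominated_def using main 0 by simp
  then show ?thesis by (rule that)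
qed

text \<open>By local stationarity, \<gamma> divided by \<open>c\<close> times the power of the
  distance tends to 1. Multiplying by \<open>c\<close> and the power of the scaled distance, whose
  limits are known, gives the claim. The case \<open>u = v\<close> is separate because the quotient
  degenerates there, while both sides are 0.\<close>

lemma scaled_variogram_limit:
  assumes t: "t \<in> box 0 1" and uv: "u \<in> unit_cube" "v \<in> unit_cube"
  shows "(\<lambda>n. real n powr \<alpha> * \<gamma> (corner n (cell n t) + width n (cell n t) * u) (corner n (cell n t) + width n (cell n t) * v))
    \<longlonglongrightarrow> c t * norm ((\<chi> m. 1 / h (t $ m)) * (u - v)) powr \<alpha>"
proof (cases "u = v")
  case True
  then show ?thesis by (simp add: \<gamma>_refl)
next
  case False
  let ?p = "\<lambda>n. corner n (cell n t)" and ?w = "\<lambda>n. width n (cell n t)" and ?D = "(\<chi> m. 1 / h (t $ m)) :: real ^ 'd"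
  let ?x = "\<lambda>n. ?p n + ?w n * u" and ?y = "\<lambda>n. ?p n + ?w n * v"
  note lim = cell_convergence[OF t]
  have comp: "(\<lambda>n. f n * z) \<longlonglongrightarrow> l * z" if "f \<longlonglongrightarrow> l" for f and l z :: "real ^ 'd"
    using that by (intro vec_tendstoI) (auto intro!: tendsto_intros)
  have xl: "?x \<longlonglongrightarrow> t" and yl: "?y \<longlonglongrightarrow> t"
    using tendsto_add[OF lim(1) comp[OF lim(2)]] by simp_all
  have yx: "?y n - ?x n = ?w n * (v - u)" for n by (simp add: algebra_simps)
  have s0: "(\<lambda>n. norm (?y n - ?x n)) \<longlonglongrightarrow> 0"
    using tendsto_norm[OF tendsto_diff[OF yl xl]] by simp
  have vu: "\<exists>m. v $ m - u $ m \<noteq> 0" using False by (simp add: vec_eq_iff) metis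
  have spos: "0 < norm (?y n - ?x n)" if "0 < n" for n
  proof -
    obtain m where "v $ m - u $ m \<noteq> 0" using vu by blast
    then have "(?w n * (v - u)) $ m \<noteq> 0"
      using width_pos[OF cell_in_strata_idx[OF that t], of m] by simp
    then show ?thesis unfolding yx by (metis zero_index zero_less_norm_iff)
  qed
  \<comment> \<open>Local stationarity is uniform on a given hyperrectangle avoiding 0, so a fixed
    one with \<open>t\<close> in its interior is chosen; the two points eventually lie in
    it.\<close>
  let ?A = "cbox ((1 / 2) *\<^sub>R t) 1"
  have tpos: "0 < t $ m \<and> t $ m < 1" for m using t by (simp add: mem_box_cart)
  have A: "?A \<subseteq> unit_cube - {0}"
  proof
    fix z assume z: "z \<in> ?A"
    then have z': "t $ m / 2 \<le> z $ m \<and> z $ m \<le> 1" for m by (simp add: mem_box_cart)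
    have zp: "0 < z $ m" for m using z'[of m] tpos[of m] by linarith
    then have "z \<noteq> 0" by (metis less_irrefl zero_index)
    then show "z \<in> unit_cube - {0}" using zp z' by (auto simp: mem_box_cart intro: less_imp_le)
  qed
  have tA: "t \<in> box ((1 / 2) *\<^sub>R t) 1" using tpos by (simp add: mem_box_cart)
  have inA: "\<forall>\<^sub>F n in sequentially. f n \<in> ?A" if "f \<longlonglongrightarrow> t" for f
    using topological_tendstoD[OF that open_box tA] by eventually_elim (use box_subset_cbox in auto)
  have ratio: "(\<lambda>n. \<gamma> (?x n) (?y n) / (c (?x n) * norm (?y n - ?x n) powr \<alpha>)) \<longlonglongrightarrow> 1"
  proof (rule tendstoI)
    fix \<epsilon> :: real assume \<epsilon>: "0 < \<epsilon>"
    obtain \<delta> where \<delta>: "0 < \<delta>" "\<forall>x\<in>?A. \<forall>y\<in>?A. 0 < norm (y - x) \<longrightarrow> norm (y - x) < \<delta>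
        \<longrightarrow> \<bar>\<gamma> x y / (c x * norm (y - x) powr \<alpha>) - 1\<bar> < \<epsilon>"
      using \<gamma>_stationary[OF A \<epsilon>] by (elim exE conjE)
    show "\<forall>\<^sub>F n in sequentially. dist (\<gamma> (?x n) (?y n) / (c (?x n) * norm (?y n - ?x n) powr \<alpha>)) 1 < \<epsilon>"
      using inA[OF xl] inA[OF yl] order_tendstoD(2)[OF s0 \<delta>(1)] eventually_gt_at_top[of 0]
    proof eventually_elim
      case (elim n)
      show ?case using \<delta>(2)[rule_format, OF elim(1,2) spos[OF elim(4)] elim(3)] by (simp only: dist_real_def)
    qed
  qed
  have cl: "(\<lambda>n. c (?x n)) \<longlonglongrightarrow> c t"
  proof (rule continuous_on_tendsto_compose[OF c_continuous xl])
    show "t \<in> unit_cube - {0}" using A tA box_subset_cbox by blast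
    show "\<forall>\<^sub>F n in sequentially. ?x n \<in> unit_cube - {0}"
      using inA[OF xl] by eventually_elim (use A in blast)
  qed
  \<comment> \<open>\<open>tendsto_powr\<close> asks for a base with nonzero limit. It holds here
    because \<open>u\<close> and \<open>v\<close> differ in some coordinate and \<open>h\<close> is
    positive.\<close>
  have Dnz: "?D * (v - u) \<noteq> 0"
  proof -
    obtain m where "v $ m - u $ m \<noteq> 0" using vu by blast
    moreover have "0 < h (t $ m)" using tpos[of m] by (intro h_pos) auto
    ultimately have "(?D * (v - u)) $ m \<noteq> 0" by simp
    then show ?thesis by (metis zero_index)
  qed
  have nl: "(\<lambda>n. norm ((real n *\<^sub>R ?w n) * (v - u)) powr \<alpha>) \<longlonglongrightarrow> norm (?D * (v - u)) powr \<alpha>"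
    using Dnz by (intro tendsto_powr tendsto_norm comp lim(3) tendsto_const) auto
  have "(\<lambda>n. (\<gamma> (?x n) (?y n) / (c (?x n) * norm (?y n - ?x n) powr \<alpha>)) * (c (?x n) * norm ((real n *\<^sub>R ?w n) * (v - u)) powr \<alpha>))
      \<longlonglongrightarrow> 1 * (c t * norm (?D * (v - u)) powr \<alpha>)"
    by (intro tendsto_mult ratio cl nl)
  moreover have "norm (?D * (v - u)) = norm (?D * (u - v))"
    using norm_minus_commute[of "?D * v" "?D * u"] by (simp add: algebra_simps)
  ultimately have L: "(\<lambda>n. (\<gamma> (?x n) (?y n) / (c (?x n) * norm (?y n - ?x n) powr \<alpha>)) * (c (?x n) * norm ((real n *\<^sub>R ?w n) * (v - u)) powr \<alpha>))
      \<longlonglongrightarrow> c t * norm (?D * (u - v)) powr \<alpha>" by simp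
  show ?thesis
  proof (rule Lim_transform_eventually[OF L])
    show "\<forall>\<^sub>F n in sequentially.
        (\<gamma> (?x n) (?y n) / (c (?x n) * norm (?y n - ?x n) powr \<alpha>)) * (c (?x n) * norm ((real n *\<^sub>R ?w n) * (v - u)) powr \<alpha>)
        = real n powr \<alpha> * \<gamma> (?x n) (?y n)"
      using inA[OF xl] eventually_gt_at_top[of 0]
    proof eventually_elim
      case (elim n)
      have "?x n \<in> unit_cube - {0}" using A elim(1) by (rule subsetD)
      from c_pos[OF this] have c0: "c (?x n) \<noteq> 0" by (rule less_imp_neq[THEN not_sym])
      have p0: "norm (?y n - ?x n) powr \<alpha> \<noteq> 0"
        unfolding powr_eq_0_iff using spos[OF elim(2)] by (rule less_imp_neq[THEN not_sym])
      have "(real n *\<^sub>R ?w n) * (v - u) = real n *\<^sub>R (?y n - ?x n)"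
        unfolding yx by (simp add: vec_eq_iff)
      then have eq: "norm ((real n *\<^sub>R ?w n) * (v - u)) powr \<alpha> = real n powr \<alpha> * norm (?y n - ?x n) powr \<alpha>"
        by (simp only: norm_scaleR) (simp add: powr_mult)
      have cancel: "g / (a * p) * (a * (q * p)) = q * g" if "a \<noteq> 0" "p \<noteq> 0" for g a p q :: real
        using that by simp
      show ?case unfolding eq by (rule cancel[OF c0 p0])
    qed
  qed
qed

end

section \<open>Passing to the limit\<close>

lemma cube_integral_measurable:
  fixes f :: "'x \<Rightarrow> real ^ 'd \<Rightarrow> real"
  assumes "(\<lambda>z. f (fst z) (snd z)) \<in> borel_measurable (N \<Otimes>\<^sub>M borel)"
  shows "(\<lambda>x. \<integral>v. f x v \<partial>cube_measure) \<in> borel_measurable N"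
proof (rule cube.borel_measurable_lebesgue_integral)
  show "(\<lambda>(x, v). f x v) \<in> borel_measurable (N \<Otimes>\<^sub>M cube_measure)"
    using assms measurable_cong_sets[OF sets_pair_measure_cong[OF refl sets_cube_measure] refl]
    unfolding case_prod_beta by blast
qed

lemma AE_in_unit_cube: "AE x in cube_measure. x \<in> unit_cube"
  unfolding AE_cube_measure by simp

lemma AE_in_unit_box: "AE x in cube_measure. x \<in> box 0 1"
  unfolding AE_cube_measure using AE_cbox_box[of 0 1] by eventually_elim simp

text \<open>Dominated convergence with a constant majorant valid from an index \<open>N\<close> on:
  the sequence is shifted by \<open>N\<close> and the limit is carried back.\<close>

lemma cube_bounded_convergence:
  fixes f :: "nat \<Rightarrow> real ^ 'd \<Rightarrow> real"
  assumes "\<And>n. f n \<in> borel_measurable borel" and "g \<in> borel_measurable borel"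
    and bound: "\<And>n u. N \<le> n \<Longrightarrow> u \<in> unit_cube \<Longrightarrow> \<bar>f n u\<bar> \<le> W"
    and lim: "\<And>u. u \<in> unit_cube \<Longrightarrow> (\<lambda>n. f n u) \<longlonglongrightarrow> g u"
  shows "(\<lambda>n. \<integral>u. f n u \<partial>cube_measure) \<longlonglongrightarrow> (\<integral>u. g u \<partial>cube_measure)"
proof -
  have "(\<lambda>n. \<integral>u. f (n + N) u \<partial>cube_measure) \<longlonglongrightarrow> (\<integral>u. g u \<partial>cube_measure)"
  proof (rule integral_dominated_convergence[where w = "\<lambda>_. W"])
    show "AE u in cube_measure. (\<lambda>n. f (n + N) u) \<longlonglongrightarrow> g u"
      using AE_in_unit_cube by eventually_elim (rule LIMSEQ_ignore_initial_segment[OF lim])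
    show "AE u in cube_measure. norm (f (n + N) u) \<le> W" for n
      using AE_in_unit_cube by eventually_elim (simp add: bound)
  qed (use assms in auto)
  then show ?thesis by (rule LIMSEQ_offset)
qed

lemma cube_integral_pos:
  fixes f :: "real ^ 'd \<Rightarrow> real"
  assumes "integrable cube_measure f" "AE x in cube_measure. 0 < f x"
  shows "0 < (\<integral>x. f x \<partial>cube_measure)"
  using cube.integral_less_AE_space[of "\<lambda>_. 0" f] assms cube.emeasure_space_1[where 'd = 'd] by simp

lemma b_const_eq_cube_integral:
  "b_const \<alpha> D = 1 / 2 * (\<integral>u. \<integral>v. norm (D * (u - v)) powr \<alpha> \<partial>cube_measure \<partial>cube_measure)"
proof -
  have inner: "(\<lambda>v. norm (D * (u - v)) powr \<alpha>) \<in> borel_measurable borel" for u by measurable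
  have outer: "(\<lambda>u. \<integral>v. norm (D * (u - v)) powr \<alpha> \<partial>cube_measure) \<in> borel_measurable borel"
    by (rule cube_integral_measurable) measurable
  show ?thesis
    unfolding b_const_def
    by (subst integral_cube_measure[OF outer]) (simp only: integral_cube_measure[OF inner])
qed

lemma b_const_measurable: "b_const \<alpha> \<in> borel_measurable (borel :: (real ^ 'd) measure)"
proof -
  have "(\<lambda>D :: real ^ 'd. \<integral>u. \<integral>v. norm (D * (u - v)) powr \<alpha> \<partial>cube_measure \<partial>cube_measure) \<in> borel_measurable borel"
    by (intro cube_integral_measurable) measurable
  then show ?thesis unfolding b_const_eq_cube_integral[abs_def] by measurable
qed

text \<open>With all coordinates of \<open>D\<close> positive, \<open>D * (u - v)\<close> vanishes
  only at \<open>v = u\<close>, a null set for each \<open>u\<close>. Positivity of the constant is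
  what makes the asymptotic quotient meaningful.\<close>

lemma b_const_pos:
  fixes D :: "real ^ 'd"
  assumes \<alpha>: "0 \<le> \<alpha>" and D: "\<And>m. 0 < D $ m"
  shows "0 < b_const \<alpha> D"
proof -
  define e where "e = Max (range (($) D))"
  have e: "\<bar>D $ m\<bar> \<le> e" for m unfolding e_def using D[of m] by (auto intro: Max_ge)
  let ?W = "(real CARD('d) * e) powr \<alpha>"
  have bnd: "norm (D * (u - v)) powr \<alpha> \<le> ?W" if "u \<in> unit_cube" "v \<in> unit_cube" for u v
    using norm_scaled_diff_bound[OF that e] \<alpha> by (intro powr_mono2) auto
  have i1: "integrable cube_measure (\<lambda>v. norm (D * (u - v)) powr \<alpha>)" if u: "u \<in> unit_cube" for u
  proof (rule cube.integrable_const_bound[of _ ?W])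
    show "AE v in cube_measure. norm (norm (D * (u - v)) powr \<alpha>) \<le> ?W"
      using AE_in_unit_cube by eventually_elim (simp add: bnd u)
  qed measurable
  have p1: "0 < (\<integral>v. norm (D * (u - v)) powr \<alpha> \<partial>cube_measure)" if u: "u \<in> unit_cube" for u
  proof (rule cube_integral_pos[OF i1[OF u]])
    have "AE v in lborel. v \<noteq> u" by (rule AE_lborel_singleton)
    then have "AE v in cube_measure. v \<noteq> u" unfolding AE_cube_measure by eventually_elim simp
    then show "AE v in cube_measure. 0 < norm (D * (u - v)) powr \<alpha>"
    proof eventually_elim
      case (elim v)
      have "\<exists>m. u $ m \<noteq> v $ m"
      proof (rule ccontr)
        assume "\<not> (\<exists>m. u $ m \<noteq> v $ m)"
        then have "v = u" by (simp add: vec_eq_iff)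
        then show False using elim by simp
      qed
      then obtain m where "u $ m \<noteq> v $ m" by blast
      then have "(D * (u - v)) $ m \<noteq> 0" using D[of m] by simp
      then have "D * (u - v) \<noteq> 0" by force
      then show ?case by simp
    qed
  qed
  have p2: "(\<integral>v. norm (D * (u - v)) powr \<alpha> \<partial>cube_measure) \<le> ?W" if u: "u \<in> unit_cube" for u
  proof (rule cube.integral_le_const[OF i1[OF u]])
    show "AE v in cube_measure. norm (D * (u - v)) powr \<alpha> \<le> ?W"
      using AE_in_unit_cube by eventually_elim (simp add: bnd u)
  qed
  have "integrable cube_measure (\<lambda>u. \<integral>v. norm (D * (u - v)) powr \<alpha> \<partial>cube_measure)"
  proof (rule cube.integrable_const_bound[of _ ?W])
    show "AE u in cube_measure. norm (\<integral>v. norm (D * (u - v)) powr \<alpha> \<partial>cube_measure) \<le> ?W"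
      using AE_in_unit_cube
    proof eventually_elim
      case (elim u)
      show ?case using p1[OF elim] p2[OF elim] by simp
    qed
    have "(\<lambda>u. \<integral>v. norm (D * (u - v)) powr \<alpha> \<partial>cube_measure) \<in> borel_measurable borel"
      by (rule cube_integral_measurable) measurable
    then show "(\<lambda>u. \<integral>v. norm (D * (u - v)) powr \<alpha> \<partial>cube_measure) \<in> borel_measurable cube_measure"
      by simp
  qed
  then have "0 < (\<integral>u. \<integral>v. norm (D * (u - v)) powr \<alpha> \<partial>cube_measure \<partial>cube_measure)"
  proof (rule cube_integral_pos)
    show "AE u in cube_measure. 0 < (\<integral>v. norm (D * (u - v)) powr \<alpha> \<partial>cube_measure)"
      using AE_in_unit_cube by eventually_elim (rule p1)
  qed
  then show ?thesis unfolding b_const_eq_cube_integral by simp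
qed

context grid_density
begin

text \<open>One arbitrary coordinate is enough: once \<open>n\<close> times its positive value under
  \<open>cum h\<close> reaches 1, its index is not 0. So excluding the first stratum does not affect
  pointwise limits.\<close>

lemma eventually_cell_nonzero:
  assumes "t \<in> box 0 (1 :: real ^ 'd)"
  obtains n\<^sub>1 where "\<And>n. n\<^sub>1 \<le> n \<Longrightarrow> cell n t \<noteq> (\<lambda>_. 0)"
proof -
  fix m :: 'd
  have "t $ m \<in> {0..1}" "0 < t $ m" using assms by (auto simp: mem_box_cart intro: less_imp_le)
  then have c: "0 < cum h (t $ m)" using cum_less_iff[of 0 "t $ m"] by simp
  obtain n\<^sub>1 :: nat where n1: "1 / cum h (t $ m) < real n\<^sub>1" using reals_Archimedean2 by blast
  have "cell n t \<noteq> (\<lambda>_. 0)" if "n\<^sub>1 \<le> n" for n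
  proof
    assume "cell n t = (\<lambda>_. 0)"
    then have "cell_idx n (t $ m) = 0" by (simp add: cell_def fun_eq_iff)
    then have "real n * cum h (t $ m) < 1"
      unfolding cell_idx_def by (simp add: floor_le_iff)
    moreover have "1 / cum h (t $ m) < real n" using n1 that by linarith
    ultimately show False using c by (simp add: field_simps)
  qed
  then show ?thesis using that by blast
qed

end

section \<open>Cell averages, dominated convergence and the stratum at the origin\<close>

context variogram_asymptotics
begin

text \<open>The mean of \<gamma> over two independent uniform points of the stratum, pulled back to
  the cube so that the measure of integration does not depend on \<open>n\<close> and
  \<open>i\<close>.\<close>

definition cell_mean :: "nat \<Rightarrow> ('d \<Rightarrow> nat) \<Rightarrow> real" where
  "cell_mean n i = (\<integral>u. \<integral>v. \<gamma> (corner n i + width n i * u) (corner n i + width n i * v)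
     \<partial>cube_measure \<partial>cube_measure)"

lemma \<gamma>_cell_measurable:
  "(\<lambda>z. \<gamma> (p + w * fst z) (p + w * snd z)) \<in> borel_measurable (borel \<Otimes>\<^sub>M borel)"
proof -
  have "(\<lambda>z. (p + w * fst z, p + w * snd z)) \<in> measurable (borel \<Otimes>\<^sub>M borel) (borel \<Otimes>\<^sub>M borel)"
    by measurable
  from measurable_compose[OF this \<gamma>_measurable] show ?thesis by simp
qed

lemma \<gamma>_cell_measurable1:
  "(\<lambda>v. \<gamma> (p + w * u) (p + w * v)) \<in> borel_measurable borel"
  using measurable_compose[OF measurable_Pair1' \<gamma>_cell_measurable, of u] by simp

lemma cell_mean_nonneg: "0 \<le> cell_mean n i"
  unfolding cell_mean_def by (intro Bochner_Integration.integral_nonneg \<gamma>_nonneg)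

lemma cell_mean_le:
  assumes "\<And>u v. u \<in> unit_cube \<Longrightarrow> v \<in> unit_cube
      \<Longrightarrow> \<gamma> (corner n i + width n i * u) (corner n i + width n i * v) \<le> W"
  shows "cell_mean n i \<le> W"
proof -
  let ?g = "\<lambda>u v. \<gamma> (corner n i + width n i * u) (corner n i + width n i * v)"
  have i1: "integrable cube_measure (?g u)" for u
    using \<gamma>_cell_measurable1 \<gamma>_nonneg \<gamma>_bounded by (intro cube.integrable_const_bound[of _ B]) auto
  have le: "(\<integral>v. ?g u v \<partial>cube_measure) \<le> W" if u: "u \<in> unit_cube" for u
  proof (rule cube.integral_le_const[OF i1])
    show "AE v in cube_measure. ?g u v \<le> W"
      using AE_in_unit_cube by eventually_elim (rule assms[OF u])
  qed
  have leB: "(\<integral>v. ?g u v \<partial>cube_measure) \<le> B" for u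
    by (rule cube.integral_le_const[OF i1]) (simp add: \<gamma>_bounded)
  have "integrable cube_measure (\<lambda>u. \<integral>v. ?g u v \<partial>cube_measure)"
  proof (rule cube.integrable_const_bound[of _ B])
    show "AE u in cube_measure. norm (\<integral>v. ?g u v \<partial>cube_measure) \<le> B"
      using leB by (simp add: Bochner_Integration.integral_nonneg \<gamma>_nonneg)
    show "(\<lambda>u. \<integral>v. ?g u v \<partial>cube_measure) \<in> borel_measurable cube_measure"
      using cube_integral_measurable[OF \<gamma>_cell_measurable] by simp
  qed
  then show ?thesis unfolding cell_mean_def
  proof (rule cube.integral_le_const)
    show "AE u in cube_measure. (\<integral>v. ?g u v \<partial>cube_measure) \<le> W"
      using AE_in_unit_cube by eventually_elim (rule le)
  qed
qed

text \<open>Bounded convergence for the inner and then for the outer integral: with \<open>t\<close>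
  fixed, the majorant is constant in \<open>u\<close> and \<open>v\<close>. The factor 2 compensates
  the 1/2 in \<open>b_const\<close>.\<close>

lemma cell_mean_limit:
  assumes t: "t \<in> box 0 1"
  shows "(\<lambda>n. real n powr \<alpha> * cell_mean n (cell n t)) \<longlonglongrightarrow> 2 * c t * b_const \<alpha> (\<chi> m. 1 / h (t $ m))"
proof -
  let ?D = "(\<chi> m. 1 / h (t $ m)) :: real ^ 'd"
  let ?G = "\<lambda>n u v. real n powr \<alpha> * \<gamma> (corner n (cell n t) + width n (cell n t) * u) (corner n (cell n t) + width n (cell n t) * v)"
  let ?g = "\<lambda>u v. c t * norm (?D * (u - v)) powr \<alpha>"
  obtain n\<^sub>0 C b where dom: "variogram_dominated n\<^sub>0 C b" by (rule variogram_dominated_ex)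
  then have n0: "0 < n\<^sub>0" by (simp add: variogram_dominated_def)
  obtain n\<^sub>1 where n1: "\<And>n. n\<^sub>1 \<le> n \<Longrightarrow> cell n t \<noteq> (\<lambda>_. 0)"
    using eventually_cell_nonzero[OF t] by blast
  define N where "N = max n\<^sub>0 n\<^sub>1"
  let ?W = "C * R (cum_vec h t) + b"
  have G0: "0 \<le> ?G n u v" for n u v by (simp add: \<gamma>_nonneg)
  have GW: "?G n u v \<le> ?W" if "N \<le> n" "u \<in> unit_cube" "v \<in> unit_cube" for n u v
  proof -
    have n: "0 < n" "n\<^sub>0 \<le> n" "n\<^sub>1 \<le> n" using that n0 by (auto simp: N_def)
    have "cell n t \<in> strata_idx n" "t \<in> stratum h n (cell n t)"
      using cell_in_strata_idx[OF n(1) t] in_stratum_cell[OF t n(1)] .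
    with dom n(2) n1[OF n(3)] that(2,3) show ?thesis
      unfolding variogram_dominated_def by blast
  qed
  have Gm1: "?G n u \<in> borel_measurable borel" for n u
    using \<gamma>_cell_measurable1 by simp
  have Gm: "(\<lambda>u. \<integral>v. ?G n u v \<partial>cube_measure) \<in> borel_measurable borel" for n
    using cube_integral_measurable[OF \<gamma>_cell_measurable] by simp
  have gm: "(\<lambda>u. \<integral>v. ?g u v \<partial>cube_measure) \<in> borel_measurable borel"
    by (rule cube_integral_measurable) measurable
  have inner: "(\<lambda>n. \<integral>v. ?G n u v \<partial>cube_measure) \<longlonglongrightarrow> (\<integral>v. ?g u v \<partial>cube_measure)" if u: "u \<in> unit_cube" for u
  proof (rule cube_bounded_convergence[where N = N and W = ?W])
    show "\<bar>?G n u v\<bar> \<le> ?W" if "N \<le> n" "v \<in> unit_cube" for n v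
      using G0[of n u v] GW[OF that(1) u that(2)] by simp
    show "(\<lambda>n. ?G n u v) \<longlonglongrightarrow> ?g u v" if "v \<in> unit_cube" for v
      by (rule scaled_variogram_limit[OF t u that])
  qed (use Gm1 in measurable)
  have "(\<lambda>n. \<integral>u. \<integral>v. ?G n u v \<partial>cube_measure \<partial>cube_measure) \<longlonglongrightarrow> (\<integral>u. \<integral>v. ?g u v \<partial>cube_measure \<partial>cube_measure)"
  proof (rule cube_bounded_convergence[where N = N and W = ?W])
    show "\<bar>\<integral>v. ?G n u v \<partial>cube_measure\<bar> \<le> ?W" if n: "N \<le> n" and u: "u \<in> unit_cube" for n u
    proof -
      have "integrable cube_measure (?G n u)"
        using \<gamma>_cell_measurable1 \<gamma>_nonneg \<gamma>_bounded
        by (intro integrable_mult_right cube.integrable_const_bound[of _ B]) auto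
      then have "(\<integral>v. ?G n u v \<partial>cube_measure) \<le> ?W"
      proof (rule cube.integral_le_const)
        show "AE v in cube_measure. ?G n u v \<le> ?W"
          using AE_in_unit_cube by eventually_elim (rule GW[OF n u])
      qed
      moreover have "0 \<le> (\<integral>v. ?G n u v \<partial>cube_measure)" by (intro Bochner_Integration.integral_nonneg G0)
      ultimately show ?thesis by simp
    qed
  qed (rule Gm, rule gm, rule inner)
  then have "(\<lambda>n. real n powr \<alpha> * cell_mean n (cell n t)) \<longlonglongrightarrow> (\<integral>u. \<integral>v. ?g u v \<partial>cube_measure \<partial>cube_measure)"
    unfolding cell_mean_def by simp
  moreover have "(\<integral>u. \<integral>v. ?g u v \<partial>cube_measure \<partial>cube_measure) = 2 * c t * b_const \<alpha> ?D"
    unfolding b_const_eq_cube_integral by simp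
  ultimately show ?thesis by (simp only:)
qed

definition limit_density :: "real ^ 'd \<Rightarrow> real" where
  "limit_density t = c t * b_const \<alpha> (\<chi> m. 1 / h (t $ m)) * (\<Prod>m\<in>UNIV. inverse (h (t $ m)))"

text \<open>By \<open>stratified_error\<close> this is the mean square error when \<gamma> is the
  variogram of the field.\<close>

definition stratified_variance :: "nat \<Rightarrow> real" where
  "stratified_variance n = (\<Sum>i\<in>strata_idx n. (measure lborel (stratum h n i))\<^sup>2 / 2 * cell_mean n i)"

text \<open>The share of one stratum in the scaled variance, with one volume factor left out, since
  integration over the stratum restores it. The first stratum is set to 0 and treated apart, because
  the local conditions do not reach it.\<close>

definition cell_density :: "nat \<Rightarrow> ('d \<Rightarrow> nat) \<Rightarrow> real" where
  "cell_density n i = (if i = (\<lambda>_. 0) then 0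
     else (real n ^ CARD('d) * measure lborel (stratum h n i)) * (real n powr \<alpha> * cell_mean n i) / 2)"

lemma limit_density_pos: "t \<in> box 0 1 \<Longrightarrow> 0 < limit_density t"
proof -
  assume t: "t \<in> box 0 1"
  then have hp: "0 < h (t $ m)" for m by (intro h_pos) (auto simp: mem_box_cart intro: less_imp_le)
  have "t \<in> unit_cube" using t box_subset_cbox by blast
  moreover have "t \<noteq> 0" using t by (auto simp: mem_box_cart)
  ultimately have "0 < c t" by (intro c_pos) simp
  moreover have "0 < b_const \<alpha> (\<chi> m. 1 / h (t $ m))"
    using hp \<beta>_pos \<beta>_less by (intro b_const_pos) auto
  moreover have "0 < (\<Prod>m\<in>UNIV. inverse (h (t $ m)))" using hp by (intro prod_pos) auto
  ultimately show ?thesis unfolding limit_density_def by (intro mult_pos_pos)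
qed

lemma limit_density_measurable:
  "(\<lambda>t. indicator unit_cube t * limit_density t) \<in> borel_measurable borel"
proof -
  have comp: "continuous_on unit_cube (\<lambda>t. h (t $ m))" for m :: 'd
    by (rule continuous_on_compose2[OF h_continuous])
      (auto simp: mem_box_cart intro!: continuous_intros)
  have hnz: "h (t $ m) \<noteq> 0" if "t \<in> unit_cube" for t and m :: 'd
    using that h_pos[of "t $ m"] by (auto simp: mem_box_cart)
  have "continuous_on unit_cube (\<lambda>t. (\<chi> m. 1 / h (t $ m)) :: real ^ 'd)"
    using hnz by (intro continuous_on_vec_lambda continuous_on_divide continuous_on_const comp) auto
  then have D: "(\<lambda>t. indicator unit_cube t *\<^sub>R (\<chi> m. 1 / h (t $ m)) :: real ^ 'd) \<in> borel_measurable borel"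
    by (intro borel_measurable_continuous_on_indicator) auto
  have P: "(\<lambda>t. indicator unit_cube t *\<^sub>R (\<Prod>m\<in>UNIV. inverse (h (t $ (m :: 'd))))) \<in> borel_measurable borel"
    using hnz by (intro borel_measurable_continuous_on_indicator continuous_on_prod continuous_on_inverse comp) auto
  have C: "(\<lambda>t. indicator (unit_cube - {0}) t *\<^sub>R c t) \<in> borel_measurable borel"
    by (intro borel_measurable_continuous_on_indicator c_continuous) auto
  \<comment> \<open>Continuity of \<open>c\<close> is given only off the origin, so the point 0 is
    added as a separate summand; the other factors are extended by zero to be Borel on the whole
    space.\<close>
  have "(\<lambda>t. (indicator (unit_cube - {0}) t *\<^sub>R c t) * b_const \<alpha> (indicator unit_cube t *\<^sub>R (\<chi> m. 1 / h (t $ m)))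
      * (indicator unit_cube t *\<^sub>R (\<Prod>m\<in>UNIV. inverse (h (t $ (m :: 'd))))) + indicator {0} t * limit_density 0)
      \<in> borel_measurable borel"
    by (intro borel_measurable_add borel_measurable_times C P measurable_compose[OF D b_const_measurable]) auto
  also have "(\<lambda>t. (indicator (unit_cube - {0}) t *\<^sub>R c t) * b_const \<alpha> (indicator unit_cube t *\<^sub>R (\<chi> m. 1 / h (t $ m)))
      * (indicator unit_cube t *\<^sub>R (\<Prod>m\<in>UNIV. inverse (h (t $ (m :: 'd))))) + indicator {0} t * limit_density 0)
      = (\<lambda>t. indicator unit_cube t * limit_density t)"
    by (auto simp: fun_eq_iff indicator_def limit_density_def mem_box_cart)
  finally show ?thesis .
qed

lemma cell_density_limit:
  assumes t: "t \<in> box 0 1"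
  shows "(\<lambda>n. cell_density n (cell n t)) \<longlonglongrightarrow> limit_density t"
proof -
  obtain n\<^sub>1 where n1: "\<And>n. n\<^sub>1 \<le> n \<Longrightarrow> cell n t \<noteq> (\<lambda>_. 0)"
    using eventually_cell_nonzero[OF t] by blast
  have "(\<lambda>n. (real n ^ CARD('d) * measure lborel (stratum h n (cell n t))) * (real n powr \<alpha> * cell_mean n (cell n t)) / 2)
      \<longlonglongrightarrow> (\<Prod>m\<in>UNIV. inverse (h (t $ m))) * (2 * c t * b_const \<alpha> (\<chi> m. 1 / h (t $ m))) / 2"
    by (intro tendsto_divide tendsto_mult cell_convergence(4)[OF t] cell_mean_limit[OF t] tendsto_const) auto
  moreover have "(\<Prod>m\<in>UNIV. inverse (h (t $ m))) * (2 * c t * b_const \<alpha> (\<chi> m. 1 / h (t $ m))) / 2 = limit_density t"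
    by (simp add: limit_density_def)
  ultimately have "(\<lambda>n. (real n ^ CARD('d) * measure lborel (stratum h n (cell n t))) * (real n powr \<alpha> * cell_mean n (cell n t)) / 2)
      \<longlonglongrightarrow> limit_density t" by (simp only:)
  then show ?thesis
    by (rule Lim_transform_eventually) (rule eventually_sequentiallyI[of n\<^sub>1], simp add: cell_density_def n1)
qed

lemma volume_stratum_bound:
  obtains e where "0 < e" "\<And>n (i :: 'd \<Rightarrow> nat). i \<in> strata_idx n \<Longrightarrow> real n ^ CARD('d) * measure lborel (stratum h n i) \<le> e"
    "\<And>n (i :: 'd \<Rightarrow> nat) m. i \<in> strata_idx n \<Longrightarrow> real n * width n i $ m \<le> e"
proof -
  obtain b where b: "0 < b" "\<And>n (i :: 'd \<Rightarrow> nat) m. i \<in> strata_idx n \<Longrightarrow> real n * width n i $ m \<le> b"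
    using width_upper_bound by blast
  have "real n ^ CARD('d) * measure lborel (stratum h n i) \<le> b ^ CARD('d)" if i: "i \<in> strata_idx n" for n and i :: "'d \<Rightarrow> nat"
  proof -
    have "real n ^ CARD('d) * measure lborel (stratum h n i) = (\<Prod>m\<in>UNIV. real n * width n i $ m)"
      by (simp add: volume_stratum[OF i] prod.distrib)
    also have "\<dots> \<le> (\<Prod>m\<in>(UNIV :: 'd set). b)"
    proof (intro prod_mono conjI)
      show "0 \<le> real n * width n i $ m" for m using width_pos[OF i, of m] by simp
      show "real n * width n i $ m \<le> b" for m by (rule b(2)[OF i])
    qed
    finally show ?thesis by simp
  qed
  then show ?thesis using that[of "max b (b ^ CARD('d))"] b by (auto simp: less_max_iff_disj le_max_iff_disj)
qed

text \<open>The dominating function is only Lebesgue measurable, so dominated convergence is applied on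
  the completed measure.\<close>

lemma cell_density_integral_limit:
  "(\<lambda>n. LINT t:box 0 1|lborel. cell_density n (cell n t)) \<longlonglongrightarrow> (LINT t:unit_cube|lborel. limit_density t)"
    and limit_density_integrable: "integrable cube_measure (\<lambda>t. indicator unit_cube t * limit_density t)"
proof -
  obtain n\<^sub>0 C b where dom: "variogram_dominated n\<^sub>0 C b" by (rule variogram_dominated_ex)
  then have n0: "0 < n\<^sub>0" and Cb: "0 \<le> C" "0 \<le> b" by (auto simp: variogram_dominated_def)
  obtain e where e: "0 < e" "\<And>n (i :: 'd \<Rightarrow> nat). i \<in> strata_idx n \<Longrightarrow> real n ^ CARD('d) * measure lborel (stratum h n i) \<le> e"
    using volume_stratum_bound by metis
  \<comment> \<open>Shifted by \<open>n\<^sub>0\<close>, so that the domination holds for every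
    term.\<close>
  let ?s = "\<lambda>n t. indicator (box 0 1) t * cell_density (n + n\<^sub>0) (cell (n + n\<^sub>0) t)"
  let ?f = "\<lambda>t. indicator (box 0 1) t * limit_density t"
  \<comment> \<open>\<open>e\<close> bounds the scaled volume,
    \<open>C * R (cum_vec h t) + b\<close> the scaled cell mean, and 1/2 is the factor in
    \<open>cell_density\<close>.\<close>
  let ?w = "\<lambda>t. indicator (box 0 1) t * (e / 2 * (C * R (cum_vec h t) + b))"
  have sm: "?s n \<in> borel_measurable lborel" for n
    using cell_measurable[of "n + n\<^sub>0" "cell_density (n + n\<^sub>0)"] n0 by simp
  have lim: "(\<lambda>n. ?s n t) \<longlonglongrightarrow> ?f t" for t
    using LIMSEQ_ignore_initial_segment[OF cell_density_limit, of t n\<^sub>0]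
    by (cases "t \<in> box 0 1") (auto intro!: tendsto_intros)
  have fm: "?f \<in> borel_measurable lborel"
    by (rule borel_measurable_LIMSEQ_real[OF lim sm])
  have wi: "integrable lebesgue ?w"
  proof -
    have "set_integrable lebesgue (box 0 1) (\<lambda>t. R (cum_vec h t))"
      by (rule set_integrable_subset[OF R_integrable]) (auto simp: box_subset_cbox)
    moreover have "set_integrable lebesgue (box 0 (1 :: real ^ 'd)) (\<lambda>_. b)"
      unfolding set_integrable_def
      by (intro integrable_scaleR_left integrable_real_indicator) (auto simp: emeasure_lborel_box_eq)
    ultimately have "set_integrable lebesgue (box 0 1) (\<lambda>t. e / 2 * (C * R (cum_vec h t) + b))"
      by (intro set_integrable_mult_right set_integral_add(1))
    then show ?thesis by (simp add: set_integrable_def)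
  qed
  have bound: "norm (?s n t) \<le> ?w t" for n t
  proof (cases "t \<in> box 0 1")
    case t: True
    let ?n = "n + n\<^sub>0" let ?i = "cell ?n t"
    have npos: "0 < ?n" using n0 by simp
    have i: "?i \<in> strata_idx ?n" "t \<in> stratum h ?n ?i"
      using cell_in_strata_idx[OF npos t] in_stratum_cell[OF t npos] .
    have tc: "t \<in> unit_cube" using t box_subset_cbox by blast
    \<comment> \<open>Positivity of \<open>R\<close> is known off 0. It makes the majorant
      nonnegative, which settles the cell of index 0, where \<open>cell_density\<close> is
      0.\<close>
    have "cum_vec h t \<noteq> 0"
    proof
      fix m :: 'd
      assume "cum_vec h t = 0"
      then have "cum h (t $ m) = 0" by (simp add: cum_vec_def vec_eq_iff)
      moreover have "0 < t $ m" "t $ m \<in> {0..1}" using t by (auto simp: mem_box_cart intro: less_imp_le)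
      ultimately show False using cum_less_iff[of 0 "t $ m"] by simp
    qed
    then have W0: "0 \<le> C * R (cum_vec h t) + b"
      using R_pos[of "cum_vec h t"] cum_vec_unit_cube[OF tc] Cb by simp
    have "norm (cell_density ?n ?i) \<le> e / 2 * (C * R (cum_vec h t) + b)"
    proof (cases "?i = (\<lambda>_. 0)")
      case True
      then show ?thesis using W0 e(1) by (simp add: cell_density_def)
    next
      case False
      have "cell_mean ?n ?i \<le> (C * R (cum_vec h t) + b) / real ?n powr \<alpha>"
      proof (rule cell_mean_le)
        fix u v :: "real ^ 'd" assume "u \<in> unit_cube" "v \<in> unit_cube"
        with dom False i le_add2[of n\<^sub>0 n] have "real ?n powr \<alpha> * \<gamma> (corner ?n ?i + width ?n ?i * u) (corner ?n ?i + width ?n ?i * v)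
          \<le> C * R (cum_vec h t) + b" unfolding variogram_dominated_def by blast
        then show "\<gamma> (corner ?n ?i + width ?n ?i * u) (corner ?n ?i + width ?n ?i * v) \<le> (C * R (cum_vec h t) + b) / real ?n powr \<alpha>"
          using npos by (subst pos_le_divide_eq) (auto simp: mult.commute)
      qed
      then have le: "real ?n powr \<alpha> * cell_mean ?n ?i \<le> C * R (cum_vec h t) + b"
        using npos by (subst (asm) pos_le_divide_eq) (auto simp: mult.commute)
      have nn: "0 \<le> real ?n powr \<alpha> * cell_mean ?n ?i" by (simp add: cell_mean_nonneg)
      have "(real ?n ^ CARD('d) * measure lborel (stratum h ?n ?i)) * (real ?n powr \<alpha> * cell_mean ?n ?i)
        \<le> e * (C * R (cum_vec h t) + b)"
        by (rule mult_mono[OF e(2)[OF i(1)] le]) (use e(1) nn in auto)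
      moreover have "norm (cell_density ?n ?i)
        = (real ?n ^ CARD('d) * measure lborel (stratum h ?n ?i)) * (real ?n powr \<alpha> * cell_mean ?n ?i) / 2"
        using False by (simp add: cell_density_def abs_mult cell_mean_nonneg)
      ultimately show ?thesis by simp
    qed
    then show ?thesis using t by simp
  qed simp
  have fi: "integrable lebesgue ?f" and conv: "(\<lambda>n. integral\<^sup>L lebesgue (?s n)) \<longlonglongrightarrow> integral\<^sup>L lebesgue ?f"
    using integrable_dominated_convergence[of ?f lebesgue ?s ?w] integral_dominated_convergence[of ?f lebesgue ?s ?w]
      measurable_completion[OF fm] measurable_completion[OF sm] wi lim bound by auto
  \<comment> \<open>The limit is Borel, so integrability and the integral pass back from the
    completion to \<open>lborel\<close>; the open and the closed cube differ by a null set.\<close>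
  have fi': "integrable lborel ?f" using fi fm by (simp add: integrable_completion)
  let ?g = "\<lambda>t. indicator unit_cube t * limit_density t"
  have gm: "?g \<in> borel_measurable lborel" using limit_density_measurable by simp
  have ae: "AE t in lborel. ?f t = ?g t"
    using AE_cbox_box[of 0 "1 :: real ^ 'd"] by eventually_elim (simp add: indicator_def)
  have gi: "integrable lborel ?g" by (rule integrable_cong_AE_imp[OF fi' gm]) (use ae in auto)
  show "integrable cube_measure ?g"
    using gi by (subst integrable_cube_measure[OF limit_density_measurable])
      (simp add: set_integrable_def mult.assoc[symmetric] flip: indicator_inter_arith)
  have "integral\<^sup>L lebesgue ?f = integral\<^sup>L lborel ?g"
    using integral_completion[OF fm] integral_cong_AE[OF fm gm ae] by simp
  then have I: "integral\<^sup>L lebesgue ?f = (LINT t:unit_cube|lborel. limit_density t)"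
    by (simp add: set_lebesgue_integral_def)
  have S: "integral\<^sup>L lebesgue (?s n) = (LINT t:box 0 1|lborel. cell_density (n + n\<^sub>0) (cell (n + n\<^sub>0) t))" for n
    using integral_completion[OF sm] by (simp add: set_lebesgue_integral_def)
  show "(\<lambda>n. LINT t:box 0 1|lborel. cell_density n (cell n t)) \<longlonglongrightarrow> (LINT t:unit_cube|lborel. limit_density t)"
    by (rule LIMSEQ_offset[of _ n\<^sub>0]) (use conv in \<open>simp only: I S\<close>)
qed

lemma limit_density_integral_pos: "0 < (LINT t:unit_cube|lborel. limit_density t)"
proof -
  have "0 < (\<integral>t. indicator unit_cube t * limit_density t \<partial>cube_measure)"
  proof (rule cube_integral_pos[OF limit_density_integrable])
    show "AE t in cube_measure. 0 < indicator unit_cube t * limit_density t"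
      using AE_in_unit_box AE_in_unit_cube by eventually_elim (simp add: limit_density_pos)
  qed
  also have "\<dots> = (LINT t:unit_cube|lborel. indicator unit_cube t * limit_density t)"
    by (rule integral_cube_measure[OF limit_density_measurable])
  also have "\<dots> = (LINT t:unit_cube|lborel. limit_density t)"
    by (rule set_lebesgue_integral_cong) auto
  finally show ?thesis .
qed

text \<open>Here the global Hoelder bound is used. A squared volume of order
  \<open>n powr (- 2 * d)\<close> and a cell mean of order \<open>n powr (- \<beta>)\<close>, scaled
  by \<open>n powr (d + \<alpha>)\<close>, leave the exponent \<alpha> - d - \<beta>, which is
  negative by assumption.\<close>

lemma zero_cell_limit:
  "(\<lambda>n. real n ^ CARD('d) * real n powr \<alpha> * ((measure lborel (stratum h n (\<lambda>_ :: 'd. 0)))\<^sup>2 / 2 * cell_mean n (\<lambda>_. 0)))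
     \<longlonglongrightarrow> 0" (is "?z \<longlonglongrightarrow> 0")
proof -
  obtain e where e: "0 < e" "\<And>n (i :: 'd \<Rightarrow> nat). i \<in> strata_idx n \<Longrightarrow> real n ^ CARD('d) * measure lborel (stratum h n i) \<le> e"
    "\<And>n (i :: 'd \<Rightarrow> nat) m. i \<in> strata_idx n \<Longrightarrow> real n * width n i $ m \<le> e"
    by (rule volume_stratum_bound) (rule that, assumption+)
  let ?d = "real CARD('d)"
  let ?k = "e\<^sup>2 / 2 * (K * (?d * e) powr \<beta>)"
  have bnd: "0 \<le> ?z n \<and> ?z n \<le> ?k * real n powr (\<alpha> - ?d - \<beta>)" if n: "0 < n" for n
  proof -
    define i where "i = (\<lambda>_ :: 'd. 0 :: nat)"
    have i: "i \<in> strata_idx n" using n by (simp add: i_def strata_idx_def)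
    let ?vol = "measure lborel (stratum h n i)"
    have mean: "cell_mean n i \<le> K * (?d * e / real n) powr \<beta>"
    proof (rule cell_mean_le)
      fix u v :: "real ^ 'd" assume uv: "u \<in> unit_cube" "v \<in> unit_cube"
      let ?x = "corner n i + width n i * u" and ?y = "corner n i + width n i * v"
      have "?x \<in> unit_cube" "?y \<in> unit_cube"
        using corner_scale_in_stratum[OF i] stratum_subset[OF i] uv by auto
      then have "\<gamma> ?x ?y \<le> K * norm (?y - ?x) powr \<beta>" by (rule \<gamma>_holder)
      moreover have "?y - ?x = width n i * (v - u)" by (simp add: algebra_simps)
      moreover have "norm (width n i * (v - u)) \<le> ?d * (e / real n)"
      proof (rule norm_scaled_diff_bound[OF uv(2,1)])
        show "\<bar>width n i $ m\<bar> \<le> e / real n" for m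
          using e(3)[OF i, of m] width_pos[OF i, of m] n by (simp add: pos_le_divide_eq mult.commute)
      qed
      then have "K * norm (width n i * (v - u)) powr \<beta> \<le> K * (?d * e / real n) powr \<beta>"
        using K_nonneg \<beta>_pos by (intro mult_left_mono powr_mono2) auto
      ultimately show "\<gamma> ?x ?y \<le> K * (?d * e / real n) powr \<beta>" by simp
    qed
    have nd: "real n ^ CARD('d) = real n powr ?d" using n by (simp add: powr_realpow)
    have vol: "?vol \<le> e / real n powr ?d"
      using e(2)[OF i] n by (simp add: pos_le_divide_eq mult.commute nd)
    have "(?vol)\<^sup>2 \<le> (e / real n powr ?d)\<^sup>2" by (rule power_mono[OF vol]) simp
    then have "?vol\<^sup>2 / 2 * cell_mean n i \<le> (e / real n powr ?d)\<^sup>2 / 2 * (K * (?d * e / real n) powr \<beta>)"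
      using mean by (intro mult_mono) (auto simp: cell_mean_nonneg)
    then have "real n powr ?d * real n powr \<alpha> * (?vol\<^sup>2 / 2 * cell_mean n i)
      \<le> real n powr ?d * real n powr \<alpha> * ((e / real n powr ?d)\<^sup>2 / 2 * (K * (?d * e / real n) powr \<beta>))"
      by (intro mult_left_mono) auto
    also have "\<dots> = ?k * (real n powr ?d * real n powr \<alpha> / ((real n powr ?d)\<^sup>2 * real n powr \<beta>))"
      using n e(1) by (simp add: powr_divide power_divide mult_ac)
    also have "real n powr ?d * real n powr \<alpha> / ((real n powr ?d)\<^sup>2 * real n powr \<beta>) = real n powr (\<alpha> - ?d - \<beta>)"
      using n by (simp add: powr_diff power2_eq_square)
    finally show ?thesis unfolding i_def nd
      by (auto intro!: mult_nonneg_nonneg cell_mean_nonneg)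
  qed
  have "(\<lambda>n. ?k * real n powr (\<alpha> - ?d - \<beta>)) \<longlonglongrightarrow> ?k * 0"
    using \<alpha>_less by (intro tendsto_mult tendsto_const tendsto_neg_powr filterlim_real_sequentially) auto
  then have lim: "(\<lambda>n. ?k * real n powr (\<alpha> - ?d - \<beta>)) \<longlonglongrightarrow> 0" by simp
  show ?thesis
  proof (rule real_tendsto_sandwich[OF _ _ tendsto_const lim])
    show "\<forall>\<^sub>F n in sequentially. 0 \<le> ?z n"
      by (rule eventually_sequentiallyI[of 1], rule bnd[THEN conjunct1], simp)
    show "\<forall>\<^sub>F n in sequentially. ?z n \<le> ?k * real n powr (\<alpha> - ?d - \<beta>)"
      by (rule eventually_sequentiallyI[of 1], rule bnd[THEN conjunct2], simp)
  qed
qed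

lemma stratified_variance_split:
  assumes n: "0 < n"
  shows "real n ^ CARD('d) * real n powr \<alpha> * stratified_variance n
    = real n ^ CARD('d) * real n powr \<alpha> * ((measure lborel (stratum h n (\<lambda>_ :: 'd. 0)))\<^sup>2 / 2 * cell_mean n (\<lambda>_. 0))
      + (LINT t:box 0 1|lborel. cell_density n (cell n t))"
proof -
  let ?i0 = "\<lambda>_ :: 'd. 0 :: nat"
  let ?vol = "\<lambda>i. measure lborel (stratum h n i)"
  have i0: "?i0 \<in> strata_idx n" using n by (simp add: strata_idx_def)
  have "(LINT t:box 0 1|lborel. cell_density n (cell n t)) = (\<Sum>i\<in>strata_idx n. LINT t:stratum h n i|lborel. cell_density n i)"
  proof (rule sum_strata_integral[symmetric, OF n])
    show "set_integrable lborel (stratum h n i) (\<lambda>_. cell_density n i)" for i :: "'d \<Rightarrow> nat"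
      unfolding set_integrable_def stratum_eq
      by (intro integrable_scaleR_left integrable_real_indicator) (auto simp: emeasure_lborel_cbox_finite[unfolded infinity_ennreal_def])
    show "(\<lambda>t. indicator (box 0 1) t *\<^sub>R cell_density n (cell n t)) \<in> borel_measurable lborel"
      using cell_measurable[OF n, of "cell_density n"] by simp
  qed
  also have "\<dots> = (\<Sum>i\<in>strata_idx n. ?vol i * cell_density n i)"
    by (intro sum.cong refl) (simp add: set_lebesgue_integral_def)
  also have "\<dots> = ?vol ?i0 * cell_density n ?i0 + (\<Sum>i\<in>strata_idx n - {?i0}. ?vol i * cell_density n i)"
    by (rule sum.remove[OF finite_strata_idx i0])
  \<comment> \<open>The volume from integrating a constant and the one inside
    \<open>cell_density\<close> combine to the square; the first summand vanishes by
    definition.\<close>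
  also have "\<dots> = (\<Sum>i\<in>strata_idx n - {?i0}. real n ^ CARD('d) * real n powr \<alpha> * ((?vol i)\<^sup>2 / 2 * cell_mean n i))"
    by (auto simp: cell_density_def power2_eq_square intro!: sum.cong)
  finally show ?thesis
    unfolding stratified_variance_def sum.remove[OF finite_strata_idx i0]
    by (simp add: distrib_left sum_distrib_left)
qed

theorem stratified_variance_asymptotics:
  "(\<lambda>n. stratified_variance n / (1 / real (n ^ CARD('d)) powr (1 + \<alpha> / real CARD('d))
      * (LINT t:unit_cube|lborel. limit_density t))) \<longlonglongrightarrow> 1"
proof -
  let ?L = "LINT t:unit_cube|lborel. limit_density t"
  \<comment> \<open>The claim divides by this limit, so it has to be nonzero.\<close>
  have L: "?L \<noteq> 0" using limit_density_integral_pos by simp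
  have "(\<lambda>n. (real n ^ CARD('d) * real n powr \<alpha> * ((measure lborel (stratum h n (\<lambda>_ :: 'd. 0)))\<^sup>2 / 2 * cell_mean n (\<lambda>_. 0))
      + (LINT t:box 0 1|lborel. cell_density n (cell n t))) / ?L) \<longlonglongrightarrow> (0 + ?L) / ?L"
    by (intro tendsto_divide tendsto_add zero_cell_limit cell_density_integral_limit tendsto_const L)
  then have "(\<lambda>n. (real n ^ CARD('d) * real n powr \<alpha> * ((measure lborel (stratum h n (\<lambda>_ :: 'd. 0)))\<^sup>2 / 2 * cell_mean n (\<lambda>_. 0))
      + (LINT t:box 0 1|lborel. cell_density n (cell n t))) / ?L) \<longlonglongrightarrow> 1" using L by simp
  then show ?thesis
  proof (rule Lim_transform_eventually, intro eventually_sequentiallyI[of 1])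
    fix n :: nat assume "1 \<le> n"
    then have n: "0 < n" by simp
    \<comment> \<open>With \<open>N = n ^ d\<close>, the rate
      \<open>N powr (1 + \<alpha> / d)\<close> is exactly the scaling factor
      \<open>n ^ d * n powr \<alpha>\<close> used so far.\<close>
    have "real (n ^ CARD('d)) powr (1 + \<alpha> / real CARD('d)) = (real n powr real CARD('d)) powr (1 + \<alpha> / real CARD('d))"
      using n by (simp add: powr_realpow)
    also have "\<dots> = real n powr (real CARD('d) + \<alpha>)"
      by (simp add: powr_powr distrib_left)
    also have "\<dots> = real n ^ CARD('d) * real n powr \<alpha>" using n by (simp add: powr_add powr_realpow)
    finally have P: "real (n ^ CARD('d)) powr (1 + \<alpha> / real CARD('d)) = real n ^ CARD('d) * real n powr \<alpha>" .
    have "s / (1 / p * l) = p * s / l" for s p l :: real by simp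
    then show "(real n ^ CARD('d) * real n powr \<alpha> * ((measure lborel (stratum h n (\<lambda>_ :: 'd. 0)))\<^sup>2 / 2 * cell_mean n (\<lambda>_. 0))
      + (LINT t:box 0 1|lborel. cell_density n (cell n t))) / ?L
      = stratified_variance n / (1 / real (n ^ CARD('d)) powr (1 + \<alpha> / real CARD('d)) * ?L)"
      unfolding stratified_variance_split[OF n, symmetric] P by (simp only:)
  qed
qed

end

text \<open>Each coordinate is a convex combination of those of \<open>x\<close> and
  \<open>y\<close>. Hence the point at which the local Hoelder condition evaluates \<open>V\<close>
  stays in the hyperrectangle, as \<open>variogram_asymptotics\<close> demands.\<close>

lemma segment_scale_in_cbox:
  fixes x y u :: "real ^ 'd"
  assumes "x \<in> cbox a b" "y \<in> cbox a b" "u \<in> unit_cube"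
  shows "x + (y - x) * u \<in> cbox a b"
proof -
  have "a $ m \<le> (x + (y - x) * u) $ m \<and> (x + (y - x) * u) $ m \<le> b $ m" for m
  proof -
    have u: "0 \<le> u $ m" "u $ m \<le> 1" and xy: "x $ m \<in> {a $ m..b $ m}" "y $ m \<in> {a $ m..b $ m}"
      using assms by (auto simp: mem_box_cart)
    have "(1 - u $ m) *\<^sub>R (x $ m) + (u $ m) *\<^sub>R (y $ m) \<in> {a $ m..b $ m}"
      using u by (intro convexD[OF convex_real_interval(5) xy]) auto
    then show ?thesis by (simp add: algebra_simps)
  qed
  then show ?thesis by (simp add: mem_box_cart)
qed

theorem theorem3:
  fixes M F :: "'a measure"
    and X :: "real ^ 'd \<Rightarrow> 'a \<Rightarrow> real"
    and \<eta> :: "nat \<Rightarrow> ('d \<Rightarrow> nat) \<Rightarrow> 'a \<Rightarrow> real ^ 'd"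
    and c V R :: "real ^ 'd \<Rightarrow> real"
    and h :: "real \<Rightarrow> real"
    and \<alpha> \<beta> K :: real
  assumes "0 < \<beta>" and "\<beta> < \<alpha>" and "\<alpha> < 2" and "\<alpha> - real CARD('d) < \<beta>" and "0 < K"
    and "random_field M F X"
    and "holder_field M X \<beta> K"
    and "CB_field M X \<alpha> c V"
    and "positive_density h"
    and "\<And>n. n \<ge> 1 \<Longrightarrow> stratified_sample M F h n (\<eta> n)"
    and "\<And>t. t \<in> unit_cube - {0} \<Longrightarrow> V (quant_vec h t) \<le> R t"
    and "shifting_condition R (1 / sqrt (3 + real CARD('d))) (sqrt (3 + real CARD('d)))"
    and "(\<lambda>t. R (cum_vec h t)) absolutely_integrable_on unit_cube"
  shows "(\<lambda>n. (rms M (\<lambda>\<omega>. field_integral X \<omega> - quadrature h n (\<eta> n) X \<omega>))\<^sup>2 /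
            (1 / real (n ^ CARD('d)) powr (1 + \<alpha> / real CARD('d)) *
             (LINT t:unit_cube|lborel.
                c t * b_const \<alpha> (\<chi> m. 1 / h (t $ m)) * (\<Prod>m\<in>UNIV. inverse (h (t $ m))))))
         \<longlonglongrightarrow> 1"
proof -
  interpret holder_random_field M F X \<beta> K
    by unfold_locales (use assms in auto)
  have grid: "grid_density h" by unfold_locales (rule assms(9))
  obtain B where B: "\<And>x y. variogram x y \<le> B" using variogram_bounded by blast
  have local: "local_holder_field M X \<alpha> (cbox a b) V" "locally_stationary_field M X \<alpha> (cbox a b) c"
    if "cbox a b \<subseteq> unit_cube - {0}" for a b
    using assms(8) that unfolding CB_field_def by blast+
  \<comment> \<open>The field conditions use a base point and an increment, the abstract setting
    uses two points; the increment is \<open>y - x\<close>.\<close>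
  have vario: "variogram x y = (rms M (\<lambda>\<omega>. X (x + (y - x)) \<omega> - X x \<omega>))\<^sup>2"
    if "x \<in> unit_cube" "y \<in> unit_cube" for x y
    using variogram_eq_rms[of x "y - x"] that by simp
  interpret variogram_asymptotics h variogram c V R \<alpha> \<beta> K B
  proof unfold_locales
    show "positive_density h" by (rule assms(9))
    show "\<exists>z\<in>cbox a b. variogram x y \<le> V z * norm (y - x) powr \<alpha>"
      if box: "cbox a b \<subseteq> unit_cube - {0}" and xy: "x \<in> cbox a b" "y \<in> cbox a b" for a b x y
    proof -
      have "x \<in> unit_cube" "y \<in> unit_cube" using box xy by auto
      note v = vario[OF this]
      have "x + (y - x) \<in> cbox a b" using xy by simp
      with local(1)[OF box] xy(1) obtain u where "u \<in> unit_cube"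
        "(rms M (\<lambda>\<omega>. X (x + (y - x)) \<omega> - X x \<omega>))\<^sup>2 \<le> V (x + (y - x) * u) * norm (y - x) powr \<alpha>"
        unfolding local_holder_field_def by blast
      then show ?thesis using segment_scale_in_cbox[OF xy] unfolding v by blast
    qed
    show "\<exists>\<delta>>0. \<forall>x\<in>cbox a b. \<forall>y\<in>cbox a b. 0 < norm (y - x) \<longrightarrow> norm (y - x) < \<delta>
        \<longrightarrow> \<bar>variogram x y / (c x * norm (y - x) powr \<alpha>) - 1\<bar> < \<epsilon>"
      if box: "cbox a b \<subseteq> unit_cube - {0}" and "0 < \<epsilon>" for a b \<epsilon>
    proof -
      obtain \<delta> where \<delta>: "0 < \<delta>" "\<forall>t s. t \<in> cbox a b \<longrightarrow> t + s \<in> cbox a b \<longrightarrow> 0 < norm s \<longrightarrow> norm s < \<delta> \<longrightarrow>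
        \<bar>(rms M (\<lambda>\<omega>. X (t + s) \<omega> - X t \<omega>))\<^sup>2 / (c t * norm s powr \<alpha>) - 1\<bar> < \<epsilon>"
        using local(2)[OF box] \<open>0 < \<epsilon>\<close> unfolding locally_stationary_field_def by blast
      have "\<bar>variogram x y / (c x * norm (y - x) powr \<alpha>) - 1\<bar> < \<epsilon>"
        if xy: "x \<in> cbox a b" "y \<in> cbox a b" and nrm: "0 < norm (y - x)" "norm (y - x) < \<delta>" for x y
      proof -
        have "x \<in> unit_cube" "y \<in> unit_cube" using box xy by auto
        note v = vario[OF this]
        have "x + (y - x) \<in> cbox a b" using xy by simp
        from \<delta>(2)[rule_format, OF xy(1) this nrm] show ?thesis unfolding v .
      qed
      with \<delta>(1) show ?thesis by blast
    qed
  qed (use assms B variogram_measurable variogram_nonneg variogram_holder in \<open>auto simp: CB_field_def\<close>)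
  show ?thesis
  proof (rule Lim_transform_eventually[OF stratified_variance_asymptotics[unfolded limit_density_def]])
    show "\<forall>\<^sub>F n in sequentially. stratified_variance n /
            (1 / real (n ^ CARD('d)) powr (1 + \<alpha> / real CARD('d)) *
             (LINT t:unit_cube|lborel.
                c t * b_const \<alpha> (\<chi> m. 1 / h (t $ m)) * (\<Prod>m\<in>UNIV. inverse (h (t $ m)))))
        = (rms M (\<lambda>\<omega>. field_integral X \<omega> - quadrature h n (\<eta> n) X \<omega>))\<^sup>2 /
            (1 / real (n ^ CARD('d)) powr (1 + \<alpha> / real CARD('d)) *
             (LINT t:unit_cube|lborel.
                c t * b_const \<alpha> (\<chi> m. 1 / h (t $ m)) * (\<Prod>m\<in>UNIV. inverse (h (t $ m)))))"
    \<comment> \<open>The samples are given from \<open>n = 1\<close> on, so the exact formula holds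
      eventually, which is enough for the limit.\<close>
    proof (rule eventually_sequentiallyI[of 1])
      fix n :: nat assume n: "1 \<le> n"
      then have "0 < n" by simp
      from stratified_error[OF grid this assms(10)[OF n]]
      have "(rms M (\<lambda>\<omega>. field_integral X \<omega> - quadrature h n (\<eta> n) X \<omega>))\<^sup>2 = stratified_variance n"
        unfolding stratified_variance_def cell_mean_def .
      then show "stratified_variance n /
            (1 / real (n ^ CARD('d)) powr (1 + \<alpha> / real CARD('d)) *
             (LINT t:unit_cube|lborel.
                c t * b_const \<alpha> (\<chi> m. 1 / h (t $ m)) * (\<Prod>m\<in>UNIV. inverse (h (t $ m)))))
        = (rms M (\<lambda>\<omega>. field_integral X \<omega> - quadrature h n (\<eta> n) X \<omega>))\<^sup>2 /
            (1 / real (n ^ CARD('d)) powr (1 + \<alpha> / real CARD('d)) *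
             (LINT t:unit_cube|lborel.
                c t * b_const \<alpha> (\<chi> m. 1 / h (t $ m)) * (\<Prod>m\<in>UNIV. inverse (h (t $ m)))))"
        by simp
    qed
  qed
qed

end
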